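(* Let $m > 2$ and let $S \subseteq \{1,\ldots,m-1\}$. Suppose that for every $p \in S$ and all integers $d_1,d_2$ with $0 \le d_1,d_2 < m$ and $d_1+d_2 \equiv p \pmod m$, we have $d_1 \in S$ or $d_2 \in S$. Then the problem $\mathrm{UC}(S,m)$ is solvable in deterministic polynomial time.
   Context: An undirected graph is a pair $G=(V,E)$ with $V$ finite, $E\subseteq V\times V$ symmetric and with no self-loops. A walk of length $k\ge1$ is a sequence of vertices $(u_0,\ldots,u_k)$ with $(u_i,u_{i+1})\in E$ for all $0\le i<k$. A cycle of length $k$ in an undirected graph is a closed walk $(u_0,u_1,\ldots,u_{k-1},u_0)$ with $k\ge 3$ in which $u_0,\ldots,u_{k-1}$ are $k$ distinct vertices. For $m\ge1$ and $S\subseteq\{0,\ldots,m-1\}$, the decision problem $\mathrm{UC}(S,m)$ is: given an undirected graph $G$, does $G$ contain a cycle of some length $\ell$ with $\ell\bmod m\in S$? *)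

theory Defs
  imports Main "HOL-Computational_Algebra.Polynomial" "HOL-Number_Theory.Cong"
begin

section \<open>Graphs, walks and cycles\<close>

definition undirected_graph :: "'a set \<Rightarrow> ('a \<times> 'a) set \<Rightarrow> bool" where
  "undirected_graph V E \<longleftrightarrow> finite V \<and> E \<subseteq> V \<times> V \<and> sym E \<and> irrefl E"

text \<open>The length \<open>k\<close> counts edges, so a walk of length \<open>k\<close> lists \<open>k + 1\<close> vertices.\<close>

definition walk :: "('a \<times> 'a) set \<Rightarrow> nat \<Rightarrow> 'a list \<Rightarrow> bool" where
  "walk E k us \<longleftrightarrow> k \<ge> 1 \<and> length us = k + 1 \<and> (\<forall>i<k. (us ! i, us ! (i + 1)) \<in> E)"

definition cycle :: "('a \<times> 'a) set \<Rightarrow> nat \<Rightarrow> 'a list \<Rightarrow> bool" where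
  "cycle E k us \<longleftrightarrow> k \<ge> 3 \<and> walk E k us \<and> last us = hd us \<and> distinct (butlast us)"

definition has_cycle_mod :: "nat set \<Rightarrow> nat \<Rightarrow> ('a \<times> 'a) set \<Rightarrow> bool" where
  "has_cycle_mod S m E \<longleftrightarrow> (\<exists>l us. cycle E l us \<and> l mod m \<in> S)"


section \<open>Decision problems as languages over the binary alphabet\<close>

text \<open>
  Instances are graphs on the vertex set \<open>{0, \<dots>, n - 1}\<close>, encoded by the row-by-row
  listing of the adjacency matrix, a string of \<open>n\<^sup>2\<close> bits. A string that does not
  encode an undirected graph is not in the language and must be rejected.
\<close>

definition adjacency_matrix :: "nat \<Rightarrow> (nat \<times> nat) set \<Rightarrow> bool list" where
  "adjacency_matrix n E = concat (map (\<lambda>u. map (\<lambda>v. (u, v) \<in> E) [0..<n]) [0..<n])"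

definition UC :: "nat set \<Rightarrow> nat \<Rightarrow> bool list set" where
  "UC S m = {adjacency_matrix n E | n E. undirected_graph {0..<n} E \<and> has_cycle_mod S m E}"


section \<open>Deterministic multi-tape Turing machines\<close>

text \<open>
  States are \<open>{..<num_states}\<close> and tape symbols \<open>{..<num_symbols}\<close>; the symbol
  \<open>0\<close> is the blank, \<open>1\<close> and \<open>2\<close> are the input bits. Tapes are infinite in both directions.
  The transition function maps a state and the list of scanned symbols (one per tape) to
  the next state and, for each tape, the symbol to write and the head movement.
\<close>

datatype movement = MoveLeft | Stay | MoveRight

record turing_machine =
  num_tapes :: nat
  num_symbols :: nat
  num_states :: nat
  start_state :: nat
  accept_state :: nat
  reject_state :: nat
  transition :: "nat \<Rightarrow> nat list \<Rightarrow> nat \<times> (nat \<times> movement) list"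

definition wf_tm :: "turing_machine \<Rightarrow> bool" where
  "wf_tm M \<longleftrightarrow>
     num_tapes M \<ge> 1 \<and> num_symbols M \<ge> 3 \<and>
     start_state M < num_states M \<and> accept_state M < num_states M \<and>
     reject_state M < num_states M \<and> accept_state M \<noteq> reject_state M \<and>
     (\<forall>q xs. q < num_states M \<and> length xs = num_tapes M \<and> set xs \<subseteq> {..<num_symbols M} \<longrightarrow>
        fst (transition M q xs) < num_states M \<and>
        length (snd (transition M q xs)) = num_tapes M \<and>
        fst ` set (snd (transition M q xs)) \<subseteq> {..<num_symbols M})"

text \<open>A tape is its contents together with the head position.\<close>

type_synonym tape = "(int \<Rightarrow> nat) \<times> int"

type_synonym config = "nat \<times> tape list"

fun read_tape :: "tape \<Rightarrow> nat" where
  "read_tape (c, h) = c h"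

fun shift :: "movement \<Rightarrow> int" where
  "shift MoveLeft = -1"
| "shift Stay = 0"
| "shift MoveRight = 1"

fun act_tape :: "nat \<times> movement \<Rightarrow> tape \<Rightarrow> tape" where
  "act_tape (a, d) (c, h) = (c(h := a), h + shift d)"

definition halted :: "turing_machine \<Rightarrow> config \<Rightarrow> bool" where
  "halted M cf \<longleftrightarrow> fst cf = accept_state M \<or> fst cf = reject_state M"

definition step :: "turing_machine \<Rightarrow> config \<Rightarrow> config" where
  "step M cf =
     (if halted M cf then cf
      else let (q', acts) = transition M (fst cf) (map read_tape (snd cf))
           in (q', map2 act_tape acts (snd cf)))"

definition input_tape :: "bool list \<Rightarrow> tape" where
  "input_tape x =
     ((\<lambda>i. if 0 \<le> i \<and> i < int (length x) then (if x ! nat i then 2 else 1) else 0), 0)"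

definition blank_tape :: tape where
  "blank_tape = ((\<lambda>_. 0), 0)"

definition initial_config :: "turing_machine \<Rightarrow> bool list \<Rightarrow> config" where
  "initial_config M x = (start_state M, input_tape x # replicate (num_tapes M - 1) blank_tape)"

definition decides_in_time :: "turing_machine \<Rightarrow> bool list set \<Rightarrow> (nat \<Rightarrow> nat) \<Rightarrow> bool" where
  "decides_in_time M L T \<longleftrightarrow>
     (\<forall>x. \<exists>t \<le> T (length x).
        fst ((step M ^^ t) (initial_config M x)) =
          (if x \<in> L then accept_state M else reject_state M))"

definition solvable_in_polynomial_time :: "bool list set \<Rightarrow> bool" where
  "solvable_in_polynomial_time L \<longleftrightarrow>
     (\<exists>M (p :: nat poly). wf_tm M \<and> decides_in_time M L (poly p))"

end

theory Submission
  imports Defs "HOL-Library.Product_Lexorder"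
begin

text \<open>
  The hypothesis says that the complement of \<open>S\<close> modulo \<open>m\<close> is closed under addition, hence consists of
  the multiples of some \<open>d\<close>, and the problem becomes: is there a cycle whose length is not divisible
  by \<open>d\<close>? Let \<open>T\<close> be a spanning forest and write \<open>P e\<close> for the tree path between the ends of a non-tree
  edge \<open>e\<close>. All cycles have length divisible by \<open>d\<close> iff \<open>d\<close> divides \<open>card (P e) + 1\<close> and
  \<open>2 * card (P e \<inter> P f)\<close> for all distinct non-tree edges \<open>e\<close>, \<open>f\<close>. Necessity: the fundamental cycles
  and their symmetric differences have even degrees, hence split into cycles. Sufficiency: if a
  cycle has the set \<open>F\<close> of non-tree edges, its length is the sum over \<open>F\<close> of \<open>card (P e) + 1\<close> minus a sum over
  the tree edges \<open>g\<close> of \<open>2 * (k div 2)\<close>, \<open>k\<close> being the number of \<open>e \<in> F\<close> with \<open>g \<in> P e\<close>. The summand depends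
  only on the set of \<open>e\<close> with \<open>g \<in> P e\<close>, and the classes of equal sets have sizes \<open>c\<close> with \<open>d dvd 2 * c\<close>
  because an intersection of tree paths with a common edge is the intersection of two of them.

  With the lexicographically greedy forest this criterion is a formula with
  reachability and counting modulo \<open>d\<close> over the adjacency matrix. Such formulas are
  compiled to while-programs on tapes, whose control stacks (of which only finitely many are
  reachable) serve as the states of a Turing machine.
\<close>

section \<open>While-programs on tapes\<close>

text \<open>Since \<open>S\<close> avoids the residue 0, the lengths outside it include
  \<open>m\<close>; adding \<open>(m - 1) * d\<close> acts as subtracting \<open>d\<close> modulo
  \<open>m\<close>, so closure under addition alone yields all multiples of some \<open>d\<close>.
  Pairs of non-tree edges suffice because of a Helly property: a tree edge other than
  \<open>g\<close> lies on one side of \<open>g\<close>. If three paths through \<open>g\<close> had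
  pairwise intersections not contained in the third path, two of the three witnessing edges would
  lie on the same side, and their cuts would cross, which cuts of tree edges cannot do. The factor 2
  comes from the size of a symmetric difference. A tree edge contributes only if at least two
  non-tree edges use it, so no single path length has to be divisible. On the machine side the
  obstacle is the bare tape model. The criterion is therefore kept definable: an edge is greedy iff
  smaller edges do not connect its ends, and a tree edge is on a path iff its removal disconnects
  the ends, so neither forest nor path is ever stored. Since only divisibility matters, a counter
  fits into one cell.\<close>

type_synonym store = "(nat \<Rightarrow> int \<Rightarrow> nat) \<times> (nat \<Rightarrow> int)"

definition sym_at :: "store \<Rightarrow> nat \<Rightarrow> nat" where
  "sym_at s i = fst s i (snd s i)"

definition move :: "nat set \<Rightarrow> movement \<Rightarrow> store \<Rightarrow> store" where
  "move X d s = (fst s, \<lambda>i. if i \<in> X then snd s i + shift d else snd s i)"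

definition put :: "nat set \<Rightarrow> nat \<Rightarrow> store \<Rightarrow> store" where
  "put X v s = (\<lambda>i. if i \<in> X then (fst s i)(snd s i := v) else fst s i, snd s)"

text \<open>Moves and writes act on a whole set of tapes, possibly infinite, while tests and written
  values look at two tapes only. Sets keep heads in lockstep and let one command treat all tapes at
  once, as in \<open>grow\<close>.\<close>

datatype com =
    Move "nat set" movement
  | Write "nat set" "nat \<Rightarrow> nat \<Rightarrow> nat" nat nat
  | Seq com com (infixr \<open>;;\<close> 60)
  | Cond "nat \<Rightarrow> nat \<Rightarrow> bool" nat nat com com
  | While "nat \<Rightarrow> nat \<Rightarrow> bool" nat nat com

fun cstep :: "com list \<times> store \<Rightarrow> com list \<times> store" where
  "cstep ([], s) = ([], s)"
| "cstep (Move X d # r, s) = (r, move X d s)"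
| "cstep (Write X f i j # r, s) = (r, put X (f (sym_at s i) (sym_at s j)) s)"
| "cstep ((a ;; b) # r, s) = (a # b # r, s)"
| "cstep (Cond P i j a b # r, s) = ((if P (sym_at s i) (sym_at s j) then a else b) # r, s)"
| "cstep (While P i j a # r, s) =
     (if P (sym_at s i) (sym_at s j) then a # While P i j a # r else r, s)"

text \<open>A timed Hoare triple for total correctness. The number of steps and the final store are
  fixed before the remaining stack \<open>r\<close>, so a command does not depend on what follows it
  and triples compose.\<close>

definition runs :: "nat \<Rightarrow> com \<Rightarrow> store \<Rightarrow> (store \<Rightarrow> bool) \<Rightarrow> bool" where
  "runs T c s Q \<longleftrightarrow> (\<exists>t\<le>T. \<exists>s'. Q s' \<and> (\<forall>r. (cstep ^^ t) (c # r, s) = (r, s')))"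

lemma runs_I: "t \<le> T \<Longrightarrow> Q s' \<Longrightarrow> (\<And>r. (cstep ^^ t) (c # r, s) = (r, s')) \<Longrightarrow> runs T c s Q"
  unfolding runs_def by blast

lemma runs_mono:
  assumes "runs T c s Q" "T \<le> T'" "\<And>s'. Q s' \<Longrightarrow> Q' s'"
  shows "runs T' c s Q'"
  using assms unfolding runs_def by (meson order_trans)

lemma runs_Move: "Q (move X d s) \<Longrightarrow> runs 1 (Move X d) s Q"
  by (rule runs_I[of 1]) auto

lemma runs_Write: "Q (put X (f (sym_at s i) (sym_at s j)) s) \<Longrightarrow> runs 1 (Write X f i j) s Q"
  by (rule runs_I[of 1]) auto

lemma runs_Seq:
  assumes "runs T a s (\<lambda>s1. runs U b s1 Q)"
  shows "runs (T + U + 1) (a ;; b) s Q"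
proof -
  obtain t s1 where t: "t \<le> T" "runs U b s1 Q" "\<And>r. (cstep ^^ t) (a # r, s) = (r, s1)"
    using assms unfolding runs_def by blast
  then obtain u s2 where u: "u \<le> U" "Q s2" "\<And>r. (cstep ^^ u) (b # r, s1) = (r, s2)"
    unfolding runs_def by blast
  have "(cstep ^^ (u + t + 1)) ((a ;; b) # r, s) = (r, s2)" for r
    using t(3) u(3) by (simp add: funpow_add funpow_Suc_right del: funpow.simps)
  then show ?thesis
    using t(1) u(1,2) by (intro runs_I[of "u + t + 1" _ Q s2]) auto
qed

lemma runs_Cond:
  assumes "P (sym_at s i) (sym_at s j) \<Longrightarrow> runs T a s Q"
    and "\<not> P (sym_at s i) (sym_at s j) \<Longrightarrow> runs T b s Q"
  shows "runs (T + 1) (Cond P i j a b) s Q"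
proof -
  obtain t s1 where t: "t \<le> T" "Q s1"
    "\<And>r. (cstep ^^ t) ((if P (sym_at s i) (sym_at s j) then a else b) # r, s) = (r, s1)"
    using assms unfolding runs_def by (cases "P (sym_at s i) (sym_at s j)") auto
  have "(cstep ^^ (t + 1)) (Cond P i j a b # r, s) = (r, s1)" for r
    using t(3) by (simp add: funpow_Suc_right del: funpow.simps)
  then show ?thesis
    using t(1,2) by (intro runs_I[of "t + 1" _ Q s1]) auto
qed

text \<open>The number \<open>n\<close> of iterations is known in advance and the invariant is
  indexed by the iterations done, so the index also provides termination.\<close>

lemma runs_While:
  assumes "\<And>j s. j < n \<Longrightarrow> I j s \<Longrightarrow> P (sym_at s a) (sym_at s b) \<and> runs T c s (I (Suc j))"
    and "\<And>s. I n s \<Longrightarrow> \<not> P (sym_at s a) (sym_at s b) \<and> Q s"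
    and "I 0 s"
  shows "runs (n * (T + 1) + 1) (While P a b c) s Q"
proof -
  \<comment> \<open>Here \<open>k\<close> counts the iterations that remain.\<close>
  have "runs (k * (T + 1) + 1) (While P a b c) s Q" if "I (n - k) s" "k \<le> n" for k s
    using that
  proof (induction k arbitrary: s)
    case 0
    then show ?case
      using assms(2)[of s] by (intro runs_I[of 1 _ Q s]) auto
  next
    case (Suc k)
    have B: "P (sym_at s a) (sym_at s b)" "runs T c s (I (Suc (n - Suc k)))"
      using assms(1)[of "n - Suc k" s] Suc.prems by auto
    then obtain t s1 where t: "t \<le> T" "I (n - k) s1" "\<And>r. (cstep ^^ t) (c # r, s) = (r, s1)"
      using Suc.prems unfolding runs_def by (metis Suc_diff_le diff_Suc_Suc)
    obtain u s2 where u: "u \<le> k * (T + 1) + 1" "Q s2"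
      "\<And>r. (cstep ^^ u) (While P a b c # r, s1) = (r, s2)"
      using Suc.IH[OF t(2)] Suc.prems unfolding runs_def by auto
    have "(cstep ^^ (u + t + 1)) (While P a b c # r, s) = (r, s2)" for r
      using t(3) u(3) B(1) by (simp add: funpow_add funpow_Suc_right del: funpow.simps)
    then show ?case
      using t(1) u(1,2) by (intro runs_I[of "u + t + 1" _ Q s2]) auto
  qed
  from this[of n s] assms(3) show ?thesis by simp
qed

text \<open>The stacks that may arise while \<open>c\<close> runs on top of \<open>r\<close>, before
  \<open>r\<close> itself is exposed. A loop body runs on top of its own loop, so stacks do not grow
  with the number of iterations and structural recursion already closes the set.\<close>

fun conts :: "com \<Rightarrow> com list \<Rightarrow> com list set" where
  "conts (a ;; b) r = {(a ;; b) # r} \<union> conts a (b # r) \<union> conts b r"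
| "conts (Cond P i j a b) r = {Cond P i j a b # r} \<union> conts a r \<union> conts b r"
| "conts (While P i j a) r = {While P i j a # r} \<union> conts a (While P i j a # r)"
| "conts c r = {c # r}"

lemma finite_conts: "finite (conts c r)"
  by (induction c arbitrary: r) auto

lemma conts_start: "c # r \<in> conts c r"
  by (cases c) auto

lemma conts_closed: "st \<in> conts c r \<Longrightarrow> fst (cstep (st, s)) \<in> insert r (conts c r)"
proof (induction c arbitrary: r st)
  case (Seq a b)
  then show ?case using conts_start[of a "b # r"] conts_start[of b r] by fastforce
next
  case (Cond P i j a b)
  from Cond.prems show ?case
    using conts_start[of a r] conts_start[of b r] Cond.IH(1)[of st r] Cond.IH(2)[of st r] by auto
next
  case (While P i j a)
  then show ?case using conts_start[of a "While P i j a # r"] by fastforce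
qed auto

text \<open>Only tapes that are read are bounded by \<open>k\<close>. The sets in
  \<open>Move\<close> and \<open>Write\<close> stay free, because tapes from \<open>k\<close> on
  never influence the first \<open>k\<close> and the machine omits them.\<close>

fun bounded_com :: "nat \<Rightarrow> nat \<Rightarrow> com \<Rightarrow> bool" where
  "bounded_com k G (Move X d) = True"
| "bounded_com k G (Write X f i j) = (i < k \<and> j < k \<and> (\<forall>a<G. \<forall>b<G. f a b < G))"
| "bounded_com k G (a ;; b) = (bounded_com k G a \<and> bounded_com k G b)"
| "bounded_com k G (Cond P i j a b) = (i < k \<and> j < k \<and> bounded_com k G a \<and> bounded_com k G b)"
| "bounded_com k G (While P i j a) = (i < k \<and> j < k \<and> bounded_com k G a)"

lemma conts_bounded:
  "st \<in> conts c r \<Longrightarrow> bounded_com k G c \<Longrightarrow> list_all (bounded_com k G) r \<Longrightarrow> list_all (bounded_com k G) st"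
proof (induction c arbitrary: r st)
  case (Seq a b)
  then show ?case using Seq.IH(1)[of st "b # r"] Seq.IH(2)[of st r] by auto
next
  case (Cond P i j a b)
  then show ?case using Cond.IH[of st r] by auto
next
  case (While P i j a)
  then show ?case using While.IH[of st "While P i j a # r"] by auto
qed auto

text \<open>A transition sees only the scanned symbols \<open>y\<close>, so \<open>cstep\<close> is
  split into its effect on the control stack, \<open>ctl\<close>, and its action on each single
  tape, \<open>out\<close>.\<close>

fun ctl :: "com list \<Rightarrow> (nat \<Rightarrow> nat) \<Rightarrow> com list" where
  "ctl [] y = []"
| "ctl ((a ;; b) # r) y = a # b # r"
| "ctl (Cond P i j a b # r) y = (if P (y i) (y j) then a else b) # r"
| "ctl (While P i j a # r) y = (if P (y i) (y j) then a # While P i j a # r else r)"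
| "ctl (_ # r) y = r"

fun out :: "com list \<Rightarrow> (nat \<Rightarrow> nat) \<Rightarrow> nat \<Rightarrow> nat \<times> movement" where
  "out (Move X d # r) y i = (y i, if i \<in> X then d else Stay)"
| "out (Write X f a b # r) y i = (if i \<in> X then f (y a) (y b) else y i, Stay)"
| "out _ y i = (y i, Stay)"

definition tape_of :: "store \<Rightarrow> nat \<Rightarrow> tape" where
  "tape_of s i = (fst s i, snd s i)"

lemma fst_cstep: "fst (cstep (st, s)) = ctl st (sym_at s)"
  by (cases "(st, s)" rule: cstep.cases) auto

lemma tape_of_cstep:
  "tape_of (snd (cstep (st, s))) i = act_tape (out st (sym_at s) i) (tape_of s i)"
  by (cases "(st, s)" rule: cstep.cases) (auto simp: tape_of_def move_def put_def sym_at_def)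

lemma ctl_cong: "list_all (bounded_com k G) st \<Longrightarrow> (\<And>i. i < k \<Longrightarrow> y i = y' i) \<Longrightarrow> ctl st y = ctl st y'"
  by (cases "(st, y)" rule: ctl.cases) auto

lemma out_cong:
  "list_all (bounded_com k G) st \<Longrightarrow> (\<And>i. i < k \<Longrightarrow> y i = y' i) \<Longrightarrow> i < k \<Longrightarrow> out st y i = out st y' i"
  by (cases "(st, y, i)" rule: out.cases) auto

lemma out_bounded:
  "list_all (bounded_com k G) st \<Longrightarrow> (\<And>i. i < k \<Longrightarrow> y i < G) \<Longrightarrow> i < k \<Longrightarrow> fst (out st y i) < G"
  by (cases "(st, y, i)" rule: out.cases) auto

section \<open>Simulation of a while-program by a Turing machine\<close>

definition initial_store :: "bool list \<Rightarrow> store" where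
  "initial_store x = (\<lambda>i. if i = 0 then fst (input_tape x) else (\<lambda>_. 0), \<lambda>_. 0)"

locale machine =
  fixes k G :: nat and c :: com and f :: "com list \<Rightarrow> nat"
  assumes k: "k \<ge> 2" and G: "G \<ge> 3" and bd: "bounded_com k G c"
    and f: "bij_betw f (insert [] (conts c [])) {0..<card (insert [] (conts c []))}"
begin

abbreviation stacks where "stacks \<equiv> insert [] (conts c [])"

definition syms where "syms xs i = (if i < k then xs ! i else (0::nat))"

text \<open>States 0 and 1 accept and reject; \<open>2 + f st\<close> stands for the control stack
  \<open>st\<close>. At the empty stack, where the program has ended, one more step reads the answer
  from tape 1, where symbol 2 means yes.\<close>

definition tm_trans :: "nat \<Rightarrow> nat list \<Rightarrow> nat \<times> (nat \<times> movement) list" where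
  "tm_trans q xs =
     (let st = inv_into stacks f (q - 2) in
      if q < 2 \<or> q \<ge> 2 + card stacks then (0, map (\<lambda>x. (x, Stay)) xs)
      else if st = [] then (if syms xs 1 = 2 then 0 else 1, map (\<lambda>x. (x, Stay)) xs)
      else (2 + f (ctl st (syms xs)), map (out st (syms xs)) [0..<k]))"

definition M :: turing_machine where
  "M = \<lparr>num_tapes = k, num_symbols = G, num_states = 2 + card stacks, start_state = 2 + f [c],
        accept_state = 0, reject_state = 1, transition = tm_trans\<rparr>"

lemma stack_bounded: "st \<in> stacks \<Longrightarrow> list_all (bounded_com k G) st"
  using conts_bounded[OF _ bd] by auto

lemma f_less: "st \<in> stacks \<Longrightarrow> f st < card stacks"
  using f by (auto simp: bij_betw_def)

lemma inv_f: "st \<in> stacks \<Longrightarrow> inv_into stacks f (f st) = st"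
  using f by (meson bij_betw_def inv_into_f_f)

lemma ctl_in: "st \<in> stacks \<Longrightarrow> ctl st y \<in> stacks"
proof -
  assume st: "st \<in> stacks"
  \<comment> \<open>Any vector of scanned symbols is realised by a store with constant tapes, so
    closure under \<open>cstep\<close> transfers to \<open>ctl\<close>.\<close>
  define s :: store where "s = (\<lambda>i _. y i, \<lambda>_. 0)"
  have "sym_at s = y" by (auto simp: s_def sym_at_def)
  then have "ctl st y = fst (cstep (st, s))" by (simp add: fst_cstep)
  then show ?thesis using conts_closed[of st c "[]" s] st by auto
qed

lemma start_in: "[c] \<in> stacks"
  using conts_start[of c "[]"] by simp

lemma wf: "wf_tm M"
proof -
  have "fst (tm_trans q xs) < 2 + card stacks \<and> length (snd (tm_trans q xs)) = k \<and>
        fst ` set (snd (tm_trans q xs)) \<subseteq> {..<G}"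
    if q: "q < 2 + card stacks" and xs: "length xs = k" "set xs \<subseteq> {..<G}" for q xs
  proof -
    let ?st = "inv_into stacks f (q - 2)"
    have y: "syms xs i < G" if "i < k" for i
      using that xs subsetD[OF xs(2) nth_mem[of i xs]] by (simp add: syms_def)
    have "?st \<in> stacks" if "q \<ge> 2"
    proof -
      have "q - 2 \<in> f ` stacks" using f q that by (auto simp: bij_betw_def)
      then show ?thesis by (rule inv_into_into)
    qed
    note st = this
    show ?thesis
      using xs f_less[OF ctl_in[OF st]] out_bounded[OF stack_bounded[OF st] y] q
      unfolding tm_trans_def Let_def by auto
  qed
  moreover have "card stacks \<ge> 1" 
    using finite_conts[of c "[]"] card_gt_0_iff[of stacks] by (simp add: Suc_le_eq del: card_gt_0_iff)
  ultimately show ?thesis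
    using k G f_less[OF start_in] unfolding wf_tm_def M_def by simp
qed

definition conf :: "com list \<times> store \<Rightarrow> config" where
  "conf p = (2 + f (fst p), map (tape_of (snd p)) [0..<k])"

lemma syms_conf: "i < k \<Longrightarrow> syms (map read_tape (map (tape_of s) [0..<k])) i = sym_at s i"
  by (simp add: syms_def tape_of_def sym_at_def del: map_map)

lemma step_conf:
  assumes "st \<in> stacks" "st \<noteq> []"
  shows "step M (conf (st, s)) = conf (cstep (st, s))"
proof -
  let ?y = "syms (map read_tape (map (tape_of s) [0..<k]))"
  have c: "ctl st ?y = ctl st (sym_at s)"
    by (rule ctl_cong[OF stack_bounded[OF assms(1)]]) (simp add: syms_conf del: map_map)
  have o: "out st ?y i = out st (sym_at s) i" if "i < k" for i
    by (rule out_cong[OF stack_bounded[OF assms(1)] _ that]) (simp add: syms_conf del: map_map)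
  have "map2 act_tape (map (out st ?y) [0..<k]) (map (tape_of s) [0..<k])
      = map (tape_of (snd (cstep (st, s)))) [0..<k]"
    by (rule nth_equalityI) (auto simp: tape_of_cstep o simp del: map_map)
  then show ?thesis
    using assms f_less[OF assms(1)] inv_f[OF assms(1)] c
    unfolding step_def conf_def halted_def M_def tm_trans_def Let_def
    by (simp add: fst_cstep del: map_map)
qed

lemma step_final: "fst (step M (conf ([], s))) = (if sym_at s 1 = 2 then 0 else 1)"
proof -
  have "syms (map read_tape (map (tape_of s) [0..<k])) 1 = sym_at s 1"
    using k by (intro syms_conf) auto
  then show ?thesis
    using f_less[of "[]"] inv_f[of "[]"]
    unfolding step_def conf_def halted_def M_def tm_trans_def Let_def
    by (simp del: map_map)
qed

lemma cstep_funpow_Nil: "(cstep ^^ t) ([], s) = ([], s)"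
  by (induction t) auto

lemma decides:
  assumes "runs T c s Q"
  shows "\<exists>t\<le>T + 1. \<exists>s'. Q s' \<and>
    fst ((step M ^^ t) (conf ([c], s))) = (if sym_at s' 1 = 2 then 0 else 1)"
proof -
  obtain t s' where t: "t \<le> T" "Q s'" "(cstep ^^ t) ([c], s) = ([], s')"
    using assms unfolding runs_def by blast
  let ?p = "\<lambda>i. (cstep ^^ i) ([c], s)"
  \<comment> \<open>\<open>runs\<close> provides some time at which the stack is empty, but the
    machine leaves the simulation at the first such time. From then on \<open>cstep\<close> idles,
    so the store is already the final one.\<close>
  define u where "u = (LEAST i. fst (?p i) = [])"
  have "fst (?p t) = []" using t(3) by simp
  then have u: "fst (?p u) = []" and ut: "u \<le> t"
    unfolding u_def by (rule LeastI, rule Least_le)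
  have ne: "fst (?p i) \<noteq> []" if "i < u" for i
    using that not_less_Least unfolding u_def by blast
  have in_st: "fst (?p i) \<in> stacks" for i
  proof (induction i)
    case (Suc i)
    then show ?case
      using ctl_in[OF Suc] fst_cstep[of "fst (?p i)" "snd (?p i)"] by simp
  qed (use start_in in auto)
  have sim: "(step M ^^ i) (conf ([c], s)) = conf (?p i)" if "i \<le> u" for i
    using that
  proof (induction i)
    case (Suc i)
    then show ?case using step_conf[of "fst (?p i)" "snd (?p i)"] in_st[of i] ne[of i] by simp
  qed simp
  have pu: "?p u = ([], snd (?p u))" using u by (metis prod.collapse)
  have "?p t = (cstep ^^ (t - u)) (?p u)"
    using ut by (metis add_diff_cancel_right' comp_apply funpow_add le_add_diff_inverse2)
  also have "\<dots> = ?p u" by (subst (1 2) pu) (rule cstep_funpow_Nil)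
  finally have "?p u = ([], s')" using t(3) by simp
  then have "fst ((step M ^^ Suc u) (conf ([c], s))) = (if sym_at s' 1 = 2 then 0 else 1)"
    using sim[of u] step_final by simp
  moreover have "Suc u \<le> T + 1" using ut t(1) by simp
  ultimately show ?thesis using t(2) by blast
qed

lemma conf_initial: "conf ([c], initial_store x) = initial_config M x"
proof -
  have "map (tape_of (initial_store x)) [0..<k] = input_tape x # replicate (k - 1) blank_tape"
  proof (rule nth_equalityI)
    fix i assume "i < length (map (tape_of (initial_store x)) [0..<k])"
    then show "map (tape_of (initial_store x)) [0..<k] ! i = (input_tape x # replicate (k - 1) blank_tape) ! i"
      by (cases i) (auto simp: tape_of_def initial_store_def input_tape_def blank_tape_def)
  qed (use k in auto)
  then show ?thesis by (simp add: conf_def initial_config_def M_def)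
qed

end

theorem program_solvable:
  assumes "k \<ge> 2" "G \<ge> 3" "bounded_com k G c"
    and run: "\<And>x. runs (poly p (length x)) c (initial_store x) (\<lambda>s. sym_at s 1 = 2 \<longleftrightarrow> x \<in> L)"
  shows "solvable_in_polynomial_time L"
proof -
  have "finite (insert [] (conts c []))" using finite_conts by simp
  then obtain f where f: "bij_betw f (insert [] (conts c [])) {0..<card (insert [] (conts c []))}"
    using ex_bij_betw_finite_nat by blast
  interpret machine k G c f
    by unfold_locales (use assms f in auto)
  have "decides_in_time M L (poly (p + 1))"
    unfolding decides_in_time_def
  proof
    fix x
    from decides[OF run[of x]] obtain t s' where
      "t \<le> poly p (length x) + 1" "sym_at s' 1 = 2 \<longleftrightarrow> x \<in> L"
      "fst ((step M ^^ t) (conf ([c], initial_store x))) = (if sym_at s' 1 = 2 then 0 else 1)"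
      by blast
    then show "\<exists>t\<le>poly (p + 1) (length x). fst ((step M ^^ t) (initial_config M x)) =
          (if x \<in> L then accept_state M else reject_state M)"
      by (intro exI[of _ t]) (auto simp: conf_initial M_def)
  qed
  then show ?thesis using wf unfolding solvable_in_polynomial_time_def by blast
qed

section \<open>A query language with reachability and counting\<close>

lemma move_simps [simp]:
  "fst (move X d s) = fst s"
  "snd (move X d s) = (\<lambda>i. if i \<in> X then snd s i + shift d else snd s i)"
  by (simp_all add: move_def)

lemma put_simps [simp]:
  "fst (put X v s) = (\<lambda>i. if i \<in> X then (fst s i)(snd s i := v) else fst s i)"
  "snd (put X v s) = snd s"
  by (simp_all add: put_def)

abbreviation nonblank :: "nat \<Rightarrow> nat \<Rightarrow> bool" where
  "nonblank a b \<equiv> a \<noteq> 0"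

definition skip :: com where "skip = Move {} Stay"

definition rewind :: "nat \<Rightarrow> com" where
  "rewind i = (While nonblank i i (Move {i} MoveLeft)) ;; Move {i} MoveRight"

text \<open>Tape \<open>i\<close> serves as the ruler, and the body must leave the heads of
  \<open>X\<close> where it found them. After the last pass they stand on the blank behind the
  block: one step left re-enters it, the scan runs to the blank before it, and one step right ends
  at cell 0.\<close>

definition loop :: "nat \<Rightarrow> nat set \<Rightarrow> com \<Rightarrow> com" where
  "loop i X c = While nonblank i i (c ;; Move X MoveRight) ;; Move X MoveLeft ;;
     While nonblank i i (Move X MoveLeft) ;; Move X MoveRight"

definition at_pos :: "nat set \<Rightarrow> int \<Rightarrow> store \<Rightarrow> store" where
  "at_pos X p s = (fst s, \<lambda>i. if i \<in> X then p else snd s i)"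

lemma at_pos_simps [simp]:
  "fst (at_pos X p s) = fst s"
  "snd (at_pos X p s) = (\<lambda>i. if i \<in> X then p else snd s i)"
  by (simp_all add: at_pos_def)

text \<open>A block is a unary copy of \<open>n\<close> with blanks at both ends, so heads can find
  either end and the program never has to compute \<open>n\<close>.\<close>

definition block :: "nat \<Rightarrow> (int \<Rightarrow> nat) \<Rightarrow> bool" where
  "block n c \<longleftrightarrow> (\<forall>p. c p \<noteq> 0 \<longleftrightarrow> 0 \<le> p \<and> p < int n)"

definition marks :: "nat \<Rightarrow> nat set \<Rightarrow> int \<Rightarrow> nat" where
  "marks n A p = (if 0 \<le> p \<and> p < int n then if nat p \<in> A then 2 else 1 else 0)"

lemma block_marks [simp]: "block n (marks n A)"
  by (auto simp: block_def marks_def)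

lemma block_upd: "block n c \<Longrightarrow> 0 \<le> p \<Longrightarrow> p < int n \<Longrightarrow> v \<noteq> 0 \<Longrightarrow> block n (c(p := v))"
  by (auto simp: block_def)

lemma marks_insert: "j < n \<Longrightarrow> (marks n A)(int j := 2) = marks n (insert j A)"
  by (auto simp: marks_def fun_eq_iff)

lemma marks_remove: "j < n \<Longrightarrow> (marks n A)(int j := Suc 0) = marks n (A - {j})"
  by (auto simp: marks_def fun_eq_iff)

lemma marks_at [simp]: "j < n \<Longrightarrow> marks n A (int j) = (if j \<in> A then 2 else 1)"
  by (simp add: marks_def)

lemma runs_skip: "Q s \<Longrightarrow> runs 1 skip s Q"
  unfolding skip_def by (rule runs_Move) (cases s, simp add: move_def)

lemma runs_scan:
  assumes "\<And>t. t < m \<Longrightarrow> P (sym_at (fst s, \<lambda>i. if i \<in> X then snd s i + int t * shift d else snd s i) a)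
      (sym_at (fst s, \<lambda>i. if i \<in> X then snd s i + int t * shift d else snd s i) b)"
    and "\<not> P (sym_at (fst s, \<lambda>i. if i \<in> X then snd s i + int m * shift d else snd s i) a)
      (sym_at (fst s, \<lambda>i. if i \<in> X then snd s i + int m * shift d else snd s i) b)"
    and "Q (fst s, \<lambda>i. if i \<in> X then snd s i + int m * shift d else snd s i)"
  shows "runs (2 * m + 1) (While P a b (Move X d)) s Q"
proof -
  let ?s = "\<lambda>t. (fst s, \<lambda>i. if i \<in> X then snd s i + int t * shift d else snd s i)"
  have "runs (m * (1 + 1) + 1) (While P a b (Move X d)) s Q"
  proof (rule runs_While[where I = "\<lambda>t s'. s' = ?s t"])
    fix j s' assume "j < m" "s' = ?s j"
    then show "P (sym_at s' a) (sym_at s' b) \<and> runs 1 (Move X d) s' (\<lambda>s'. s' = ?s (Suc j))"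
      using assms(1)[of j] by (intro conjI runs_Move) (auto intro!: prod_eqI simp: fun_eq_iff algebra_simps)
  qed (use assms(2,3) in \<open>auto intro!: prod_eqI simp: fun_eq_iff\<close>)
  then show ?thesis by (rule runs_mono) auto
qed

lemma runs_rewind:
  assumes "block n (fst s i)" "snd s i = int p" "p < n" "Q (fst s, (snd s)(i := 0))"
  shows "runs (2 * n + 3) (rewind i) s Q"
proof -
  have "runs ((2 * (p + 1) + 1) + 1 + 1) (rewind i) s Q"
    unfolding rewind_def
  proof (intro runs_Seq runs_scan runs_Move)
    show "Q (move {i} MoveRight (fst s, \<lambda>j. if j \<in> {i} then snd s j + int (p + 1) * shift MoveLeft else snd s j))"
      using assms(2,4) by (auto simp: move_def fun_upd_def elim!: back_subst[of Q] intro!: prod_eqI)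
  qed (use assms in \<open>auto simp: sym_at_def block_def\<close>)
  then show ?thesis by (rule runs_mono) (use assms(3) in auto)
qed

text \<open>The invariant speaks of the store with the heads of \<open>X\<close> reset to 0. It thus
  need not track the progress of the loop, and for \<open>j = n\<close> it directly describes the
  rewound store.\<close>

lemma runs_loop:
  assumes i: "i \<in> X"
    and step: "\<And>j s. j < n \<Longrightarrow> \<forall>x\<in>X. snd s x = int j \<Longrightarrow> I j (at_pos X 0 s) \<Longrightarrow>
      runs T c s (\<lambda>s'. (\<forall>x\<in>X. snd s' x = int j) \<and> I (Suc j) (at_pos X 0 s'))"
    and block: "\<And>j s. j \<le> n \<Longrightarrow> I j s \<Longrightarrow> block n (fst s i)"
    and start: "I 0 s" "\<forall>x\<in>X. snd s x = 0"
    and fin: "\<And>s'. I n s' \<Longrightarrow> \<forall>x\<in>X. snd s' x = 0 \<Longrightarrow> Q s'"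
  shows "runs ((n + 1) * (T + 7)) (loop i X c) s Q"
proof -
  have "runs ((n * ((T + 1 + 1) + 1) + 1) + (1 + (2 * n + 1 + 1 + 1) + 1) + 1) (loop i X c) s Q"
    unfolding loop_def
  proof (rule runs_Seq, rule runs_While[where I = "\<lambda>j s. (\<forall>x\<in>X. snd s x = int j) \<and> I j (at_pos X 0 s)"])
    fix j s assume j: "j < n" and s: "(\<forall>x\<in>X. snd s x = int j) \<and> I j (at_pos X 0 s)"
    have "block n (fst s i)" using block[OF _ conjunct2[OF s]] j by simp
    then have "nonblank (sym_at s i) (sym_at s i)"
      using s i j by (auto simp: sym_at_def block_def)
    moreover have "runs (T + 1 + 1) (c ;; Move X MoveRight) s
        (\<lambda>s. (\<forall>x\<in>X. snd s x = int (Suc j)) \<and> I (Suc j) (at_pos X 0 s))"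
    proof (rule runs_Seq, rule runs_mono[OF step[OF j]], goal_cases)
      case (4 s')
      then show ?case by (intro runs_Move) (auto simp: at_pos_def cong: if_cong)
    qed (use s in auto)
    ultimately show "nonblank (sym_at s i) (sym_at s i) \<and> runs (T + 1 + 1) (c ;; Move X MoveRight) s
        (\<lambda>s. (\<forall>x\<in>X. snd s x = int (Suc j)) \<and> I (Suc j) (at_pos X 0 s))" by blast
  next
    fix s assume s: "(\<forall>x\<in>X. snd s x = int n) \<and> I n (at_pos X 0 s)"
    have b: "block n (fst s i)" using block[OF _ conjunct2[OF s]] by simp
    then have "\<not> nonblank (sym_at s i) (sym_at s i)"
      using s i by (auto simp: sym_at_def block_def)
    moreover have "runs (1 + (2 * n + 1 + 1 + 1) + 1)
       (Move X MoveLeft ;; While nonblank i i (Move X MoveLeft) ;; Move X MoveRight) s Q"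
    proof (intro runs_Seq runs_Move runs_scan)
      let ?m = "move X MoveLeft s"
      let ?s = "\<lambda>t. (fst ?m, \<lambda>i. if i \<in> X then snd ?m i + int t * shift MoveLeft else snd ?m i)"
      show "nonblank (sym_at (?s t) i) (sym_at (?s t) i)" if "t < n" for t
        using s i b that by (auto simp: sym_at_def block_def)
      show "\<not> nonblank (sym_at (?s n) i) (sym_at (?s n) i)"
        using s i b by (auto simp: sym_at_def block_def)
      have "move X MoveRight (?s n) = at_pos X 0 s"
        using s by (auto intro!: prod_eqI simp: fun_eq_iff)
      then show "Q (move X MoveRight (?s n))"
        using fin[OF conjunct2[OF s]] by simp
    qed
    ultimately show "\<not> nonblank (sym_at s i) (sym_at s i) \<and> runs (1 + (2 * n + 1 + 1 + 1) + 1)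
       (Move X MoveLeft ;; While nonblank i i (Move X MoveLeft) ;; Move X MoveRight) s Q" by blast
  next
    have "at_pos X 0 s = s" using start(2) by (auto intro!: prod_eqI simp: fun_eq_iff)
    then show "(\<forall>x\<in>X. snd s x = int 0) \<and> I 0 (at_pos X 0 s)" using start by simp
  qed
  then show ?thesis by (rule runs_mono) (auto simp: algebra_simps)
qed

text \<open>
  Every tape but the input carries a block of \<open>n\<close> nonblank cells, where a value \<open>v < K\<close> is the symbol
  \<open>v + 1\<close>. Tape 1 holds the result in its cell 0. Tapes \<open>2, \<dots>, V - 1\<close> are variables: the value is the head
  position, and the block is marked there so that the head may leave and find its way back. Tapes
  from \<open>k\<close> on are scratch space.
\<close>

datatype expr =
    Edge nat nat
  | Less nat nat
  | Op "nat \<Rightarrow> nat \<Rightarrow> nat" expr expr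
  | Fold nat "nat \<Rightarrow> nat \<Rightarrow> nat" expr
  | Reach nat nat expr nat nat

fun value_of :: "nat \<Rightarrow> nat \<Rightarrow> (nat \<Rightarrow> nat \<Rightarrow> bool) \<Rightarrow> expr \<Rightarrow> (nat \<Rightarrow> nat) \<Rightarrow> nat" where
  "value_of K n E (Edge x y) \<rho> = of_bool (E (\<rho> x) (\<rho> y))"
| "value_of K n E (Less x y) \<rho> = of_bool (\<rho> x < \<rho> y)"
| "value_of K n E (Op f a b) \<rho> = f (value_of K n E a \<rho>) (value_of K n E b \<rho>) mod K"
| "value_of K n E (Fold x f e) \<rho> =
     fold (\<lambda>i s. f s (value_of K n E e (\<rho>(x := i))) mod K) [0..<n] 0"
| "value_of K n E (Reach x y e u v) \<rho> =
     of_bool ((\<rho> u, \<rho> v) \<in> {(i, j). i < n \<and> j < n \<and> value_of K n E e (\<rho>(x := i, y := j)) \<noteq> 0}\<^sup>*)"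

text \<open>\<open>L\<close> is the set of variables in scope. A bound variable must be new, since
  its value is the head position of one fixed tape and an outer value would be lost.\<close>

fun wf_expr :: "nat \<Rightarrow> nat set \<Rightarrow> expr \<Rightarrow> bool" where
  "wf_expr V L (Edge x y) = (x \<in> L \<and> y \<in> L)"
| "wf_expr V L (Less x y) = (x \<in> L \<and> y \<in> L \<and> x \<noteq> y)"
| "wf_expr V L (Op f a b) = (wf_expr V L a \<and> wf_expr V L b)"
| "wf_expr V L (Fold x f e) = (x \<notin> L \<and> 2 \<le> x \<and> x < V \<and> wf_expr V (insert x L) e)"
| "wf_expr V L (Reach x y e u v) = (x \<notin> L \<and> y \<notin> L \<and> x \<noteq> y \<and> 2 \<le> x \<and> x < V \<and> 2 \<le> y \<and> y < V \<and>
     u \<in> L \<and> v \<in> L \<and> wf_expr V (insert y (insert x L)) e)"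

abbreviation always :: "nat \<Rightarrow> nat \<Rightarrow> nat \<Rightarrow> nat" where
  "always v a b \<equiv> v"

abbreviation Fill :: "nat set \<Rightarrow> nat \<Rightarrow> com" where
  "Fill X v \<equiv> Write X (always v) 0 0"

abbreviation unmarked :: "nat \<Rightarrow> nat \<Rightarrow> bool" where
  "unmarked a b \<equiv> a = 1"

text \<open>\<open>k\<close> is the first free scratch tape. \<open>Edge\<close> walks to cell
  \<open>\<rho> x * n + \<rho> y\<close> of the input, using tape \<open>k\<close> as a ruler of
  length \<open>n\<close> for each row. \<open>Reach\<close> keeps the reached set on
  \<open>k\<close>, collects successors on \<open>k + 1\<close> and counts \<open>n\<close> rounds
  on \<open>k + 2\<close>. A bound variable is marked before its body runs and unmarked
  afterwards.\<close>

fun compile :: "nat \<Rightarrow> nat \<Rightarrow> expr \<Rightarrow> com" where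
  "compile K k (Edge x y) =
     rewind x ;; While unmarked x x (Move {x} MoveRight ;; loop k {k} (Move {0} MoveRight)) ;;
     rewind y ;; While unmarked y y (Move {y, 0} MoveRight) ;;
     Write {1} (\<lambda>a b. if a = 2 then 2 else 1) 0 0 ;; rewind 0"
| "compile K k (Less x y) =
     rewind x ;; rewind y ;; While (\<lambda>a b. a = 1 \<and> b = 1) x y (Move {x, y} MoveRight) ;;
     Write {1} (\<lambda>a b. if a = 2 \<and> b = 1 then 2 else 1) x y ;;
     While unmarked x x (Move {x} MoveRight) ;; While unmarked y y (Move {y} MoveRight)"
| "compile K k (Op f a b) =
     compile K (k + 1) a ;; Write {k} (\<lambda>a b. a) 1 1 ;; compile K (k + 1) b ;;
     Write {1} (\<lambda>a b. Suc (f (a - 1) (b - 1) mod K)) k 1"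
| "compile K k (Fold x f e) =
     Fill {k} 1 ;;
     loop x {x} (Fill {x} 2 ;; compile K (k + 1) e ;;
       Write {k} (\<lambda>a b. Suc (f (a - 1) (b - 1) mod K)) k 1 ;; Fill {x} 1) ;;
     Write {1} (\<lambda>a b. a) k k"
| "compile K k (Reach x y e u v) =
     loop k {k, k + 1} (Fill {k, k + 1} 1) ;;
     rewind u ;; While unmarked u u (Move {u, k} MoveRight) ;; Fill {k} 2 ;; rewind k ;;
     loop (k + 2) {k + 2}
       (loop x {x, k}
         (Cond (\<lambda>a b. a = 2) k k
           (Fill {x} 2 ;;
            loop y {y, k + 1} (Fill {y} 2 ;; compile K (k + 3) e ;;
              Write {k + 1} (\<lambda>a b. if a = 1 then b else 2) 1 (k + 1) ;; Fill {y} 1) ;;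
            Fill {x} 1)
           skip) ;;
        loop k {k, k + 1} (Write {k} (\<lambda>a b. if a = 2 \<or> b = 2 then 2 else 1) k (k + 1))) ;;
     rewind v ;; While unmarked v v (Move {v, k} MoveRight) ;; Write {1} (\<lambda>a b. a) k k ;; rewind k"

definition pre :: "nat \<Rightarrow> nat \<Rightarrow> (nat \<Rightarrow> nat \<Rightarrow> bool) \<Rightarrow> nat \<Rightarrow> nat set \<Rightarrow> (nat \<Rightarrow> nat) \<Rightarrow> store \<Rightarrow> bool" where
  "pre V n E k L \<rho> s \<longleftrightarrow>
     block (n * n) (fst s 0) \<and> (\<forall>i<n. \<forall>j<n. fst s 0 (int (i * n + j)) = 2 \<longleftrightarrow> E i j) \<and>
     snd s 0 = 0 \<and> snd s 1 = 0 \<and> (\<forall>i\<ge>k. snd s i = 0) \<and>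
     (\<forall>i\<ge>1. block n (fst s i)) \<and>
     (\<forall>x\<in>{2..<V}. if x \<in> L then \<rho> x < n \<and> snd s x = int (\<rho> x) \<and> fst s x = marks n {\<rho> x}
        else snd s x = 0 \<and> fst s x = marks n {})"

text \<open>What a compiled expression may disturb: the result and the scratch contents. Even
  garbage must remain a block of length \<open>n\<close>, because scratch tapes serve as
  rulers.\<close>

definition frame :: "nat \<Rightarrow> nat \<Rightarrow> store \<Rightarrow> store \<Rightarrow> bool" where
  "frame n k s s' \<longleftrightarrow> snd s' = snd s \<and> (\<forall>i<k. i \<noteq> 1 \<longrightarrow> fst s' i = fst s i) \<and>
     (\<forall>i\<ge>1. block n (fst s' i))"

text \<open>Each factor \<open>[:1, 1:]\<close>, that is \<open>n + 1\<close>, pays for one level of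
  nested passes over a block; the numerals are generous roundings.\<close>

fun cost :: "expr \<Rightarrow> nat poly" where
  "cost (Edge x y) = [:100:] * [:1, 1:] ^ 2"
| "cost (Less x y) = [:100:] * [:1, 1:]"
| "cost (Op f a b) = cost a + cost b + 5"
| "cost (Fold x f e) = [:1, 1:] * (cost e + 30)"
| "cost (Reach x y e u v) = [:1, 1:] ^ 3 * (cost e + 200)"

section \<open>Correctness and running time of compiled expressions\<close>

lemma runs_find:
  assumes "fst s u = marks n {p}" "snd s u = 0" "p < n" "u \<in> X"
    and "Q (fst s, \<lambda>i. if i \<in> X then snd s i + int p else snd s i)"
  shows "runs (2 * n) (While unmarked u u (Move X MoveRight)) s Q"
proof -
  have "runs (2 * p + 1) (While unmarked u u (Move X MoveRight)) s Q"
    by (rule runs_scan) (use assms in \<open>auto simp: sym_at_def marks_def cong: if_cong\<close>)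
  then show ?thesis by (rule runs_mono) (use assms(3) in auto)
qed

lemma pre_var:
  assumes "pre V n E k L \<rho> s" "L \<subseteq> {2..<V}" "V \<le> k" "x \<in> L"
  shows "2 \<le> x" "x < k" "fst s x = marks n {\<rho> x}" "snd s x = int (\<rho> x)" "\<rho> x < n"
proof -
  have "x \<in> {2..<V}" using assms by blast
  then show "2 \<le> x" "x < k" "fst s x = marks n {\<rho> x}" "snd s x = int (\<rho> x)" "\<rho> x < n"
    using assms unfolding pre_def by auto
qed

lemma pre_free:
  assumes "pre V n E k L \<rho> s" "x \<notin> L" "2 \<le> x" "x < V"
  shows "fst s x = marks n {}" "snd s x = 0"
proof -
  have "x \<in> {2..<V}" using assms by auto
  then show "fst s x = marks n {}" "snd s x = 0"
    using assms unfolding pre_def by auto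
qed

lemma pre_rest:
  assumes "pre V n E k L \<rho> s"
  shows "\<And>i. i \<ge> 1 \<Longrightarrow> block n (fst s i)" "block (n * n) (fst s 0)"
    "snd s 0 = 0" "snd s 1 = 0" "\<And>i. i \<ge> k \<Longrightarrow> snd s i = 0"
    "\<And>i j. i < n \<Longrightarrow> j < n \<Longrightarrow> fst s 0 (int (i * n + j)) = 2 \<longleftrightarrow> E i j"
  using assms unfolding pre_def by auto

lemma correct_Edge:
  assumes pre: "pre V n E k L \<rho> s" and wf: "wf_expr V L (Edge x y)" "L \<subseteq> {2..<V}" "2 \<le> V" "V \<le> k"
  shows "runs (poly (cost (Edge x y)) n) (compile K k (Edge x y)) s
    (\<lambda>s'. frame n k s s' \<and> fst s' 1 0 = Suc (value_of K n E (Edge x y) \<rho>))"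
proof -
  have "x \<in> L" "y \<in> L" using wf by auto
  note x = pre_var[OF pre wf(2,4) this(1)] and y = pre_var[OF pre wf(2,4) this(2)]
  note b = pre_rest(1,2)[OF pre]
  have h: "snd s 0 = 0" "snd s 1 = 0" "snd s k = 0"
    using pre_rest(3-5)[OF pre] by auto
  note E = pre_rest(6)[OF pre x(5) y(5)]
  \<comment> \<open>The store after \<open>j\<close> rows: the input head has passed
    \<open>j * n\<close> cells, and the head of \<open>x\<close> is \<open>j\<close> cells on its
    way to the mark.\<close>
  let ?r = "\<lambda>j. (fst s, (snd s)(x := int j, 0 := int (j * n)))"
  let ?p = "\<rho> x * n + \<rho> y"
  have p: "?p < n * n"
  proof -
    have "?p < (\<rho> x + 1) * n" using y(5) by (simp add: algebra_simps)
    also have "\<dots> \<le> n * n" using x(5) by (intro mult_right_mono) auto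
    finally show ?thesis .
  qed
  \<comment> \<open>The bound mirrors the nesting of the sequencing rules, so that these apply by
    unification; it is rounded up to \<open>cost\<close> at the end.\<close>
  have "runs ((2 * n + 3) + ((\<rho> x * ((1 + (n + 1) * (1 + 7) + 1) + 1) + 1)
      + ((2 * n + 3) + ((2 * n) + (1 + (2 * (n * n) + 3) + 1) + 1) + 1) + 1) + 1)
    (compile K k (Edge x y)) s (\<lambda>s'. frame n k s s' \<and> fst s' 1 0 = Suc (value_of K n E (Edge x y) \<rho>))"
    unfolding compile.simps
  proof (rule runs_Seq, rule runs_rewind[of n _ _ "\<rho> x"],
      goal_cases _ _ _ body)
    case body
    show ?case
    proof (rule runs_Seq, rule runs_While[where I = "\<lambda>j s'. s' = ?r j"], goal_cases row rest start)
      case (row j s')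
      have "runs (1 + (n + 1) * (1 + 7) + 1)
         (Move {x} MoveRight ;; loop k {k} (Move {0} MoveRight)) s' (\<lambda>s'. s' = ?r (Suc j))"
      proof (intro runs_Seq runs_Move, rule runs_loop[where n = n and
            I = "\<lambda>i s'. s' = (fst s, (snd s)(x := int (Suc j), 0 := int (j * n + i)))"], goal_cases)
        case (2 i s')
        then show ?case
          by (intro runs_Move) (use x wf h in \<open>auto simp: at_pos_def fun_eq_iff split: if_splits\<close>)
      next
        case 4
        show ?case using row x by (auto simp: move_def fun_eq_iff)
      qed (use row x h b wf in \<open>auto simp: algebra_simps\<close>)
      moreover have "unmarked (sym_at s' x) (sym_at s' x)"
        using row x by (auto simp: sym_at_def marks_def)
      ultimately show ?case by blast
    next
      case (rest s')
      have "\<not> unmarked (sym_at s' x) (sym_at s' x)"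
        using rest x by (auto simp: sym_at_def marks_def)
      moreover have "runs ((2 * n + 3) + ((2 * n) + (1 + (2 * (n * n) + 3) + 1) + 1) + 1)
        (rewind y ;; While unmarked y y (Move {y, 0} MoveRight) ;;
          Write {1} (\<lambda>a b. if a = 2 then 2 else 1) 0 0 ;; rewind 0) s'
        (\<lambda>s'. frame n k s s' \<and> fst s' 1 0 = Suc (value_of K n E (Edge x y) \<rho>))"
      proof (rule runs_Seq, rule runs_rewind[of n _ _ "\<rho> y"], goal_cases _ _ _ rest2)
        case rest2
        let ?s2 = "(fst s, (snd s)(0 := int ?p))"
        show ?case
        proof (rule runs_Seq, rule runs_mono[where Q = "\<lambda>s'. s' = ?s2"], rule runs_find[of _ _ n "\<rho> y"],
            goal_cases _ _ _ _ _ _ A)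
          case (A s')
          have "runs (1 + (2 * (n * n) + 3) + 1) (Write {1} (\<lambda>a b. if a = 2 then 2 else 1) 0 0 ;; rewind 0)
            ?s2 (\<lambda>s'. frame n k s s' \<and> fst s' 1 0 = Suc (value_of K n E (Edge x y) \<rho>))"
            by (rule runs_Seq, rule runs_Write, rule runs_rewind[of "n * n" _ _ ?p])
              (use p b E h x y wf in \<open>auto simp: frame_def fun_eq_iff sym_at_def block_upd\<close>)
          then show ?case using A by simp
        qed (use rest x y h in \<open>auto simp: fun_eq_iff\<close>)
      qed (use rest x y b wf in auto)
      ultimately show ?case by blast
    next
      case start
      show ?case using h by (auto simp: fun_eq_iff)
    qed
  qed (use x b in auto)
  then show ?thesis
  proof (rule runs_mono)
    have "\<rho> x * (8 * n + 11) \<le> n * (8 * n + 11)" using x(5) by simp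
    then show "2 * n + 3 + (\<rho> x * (1 + (n + 1) * (1 + 7) + 1 + 1) + 1 +
      (2 * n + 3 + (2 * n + (1 + (2 * (n * n) + 3) + 1) + 1) + 1) + 1) + 1 \<le> poly (cost (Edge x y)) n"
      by (simp add: algebra_simps power2_eq_square)
  qed
qed

lemma correct_Less:
  assumes pre: "pre V n E k L \<rho> s" and wf: "wf_expr V L (Less x y)" "L \<subseteq> {2..<V}" "2 \<le> V" "V \<le> k"
  shows "runs (poly (cost (Less x y)) n) (compile K k (Less x y)) s
    (\<lambda>s'. frame n k s s' \<and> fst s' 1 0 = Suc (value_of K n E (Less x y) \<rho>))"
proof -
  have "x \<in> L" "y \<in> L" and xy: "x \<noteq> y" using wf by auto
  note x = pre_var[OF pre wf(2,4) this(1)] and y = pre_var[OF pre wf(2,4) this(2)]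
  note b = pre_rest(1,2)[OF pre]
  note h = pre_rest(3,4)[OF pre]
  \<comment> \<open>The heads advance together until the first mark and stop at \<open>m\<close>;
    there \<open>x\<close> is marked and \<open>y\<close> is not exactly if
    \<open>\<rho> x < \<rho> y\<close>. Afterwards each head goes on to its own mark.\<close>
  define m where "m = min (\<rho> x) (\<rho> y)"
  have m: "m \<le> \<rho> x" "m \<le> \<rho> y" "m = \<rho> x \<or> m = \<rho> y" by (auto simp: m_def)
  define s1 where "s1 = (fst s, (snd s)(x := int m, y := int m))"
  define s2 where "s2 = ((fst s)(1 := (fst s 1)(0 := if \<rho> x < \<rho> y then 2 else 1)), snd s1)"
  define s3 where "s3 = (fst s2, (snd s2)(x := int (\<rho> x)))"
  define s4 where "s4 = (fst s2, (snd s3)(y := int (\<rho> y)))"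
  have "runs ((2 * n + 3) + ((2 * n + 3) + ((2 * m + 1) + (1 + ((2 * (\<rho> x - m) + 1) + (2 * (\<rho> y - m) + 1) + 1) + 1) + 1) + 1) + 1)
    (compile K k (Less x y)) s (\<lambda>s'. frame n k s s' \<and> fst s' 1 0 = Suc (value_of K n E (Less x y) \<rho>))"
    unfolding compile.simps
  proof (rule runs_Seq, rule runs_rewind[of n _ _ "\<rho> x"], goal_cases _ _ _ A)
    case A
    show ?case
    proof (rule runs_Seq, rule runs_rewind[of n _ _ "\<rho> y"], goal_cases _ _ _ B)
      case B
      show ?case
      proof (rule runs_Seq, rule runs_mono[where Q = "\<lambda>s'. s' = s1"], rule runs_scan[where m = m], goal_cases _ _ _ _ C)
        case (C s')
        have "runs (1 + ((2 * (\<rho> x - m) + 1) + (2 * (\<rho> y - m) + 1) + 1) + 1)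
          (Write {1} (\<lambda>a b. if a = 2 \<and> b = 1 then 2 else 1) x y ;;
           While unmarked x x (Move {x} MoveRight) ;; While unmarked y y (Move {y} MoveRight)) s1
          (\<lambda>s'. frame n k s s' \<and> fst s' 1 0 = Suc (value_of K n E (Less x y) \<rho>))"
        proof (rule runs_Seq, rule runs_Write, goal_cases D)
          case D
          have s2: "put {1} ((\<lambda>a b. if a = 2 \<and> b = 1 then 2 else 1) (sym_at s1 x) (sym_at s1 y)) s1 = s2"
            using x y xy m h unfolding s1_def s2_def by (auto simp: put_def sym_at_def fun_eq_iff)
          show ?case unfolding s2
          proof (rule runs_Seq, rule runs_mono[where Q = "\<lambda>s'. s' = s3"], rule runs_scan[where m = "\<rho> x - m"], goal_cases _ _ _ _ F)
            case (F s')
            have "runs (2 * (\<rho> y - m) + 1) (While unmarked y y (Move {y} MoveRight)) s3 (\<lambda>s'. s' = s4)"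
              by (rule runs_scan) (use x y xy m in \<open>auto simp: s4_def s3_def s2_def s1_def sym_at_def fun_eq_iff marks_def\<close>)
            moreover have "frame n k s s4" "fst s4 1 0 = Suc (value_of K n E (Less x y) \<rho>)"
              using x y xy b h by (auto simp: frame_def s4_def s3_def s2_def s1_def fun_eq_iff intro!: block_upd)
            ultimately show ?case using F by (auto elim!: runs_mono)
          qed (use x y xy m in \<open>auto simp: s3_def s2_def s1_def sym_at_def fun_eq_iff marks_def\<close>)
        qed
        then show ?case using C by simp
      qed (use x y xy m in \<open>auto simp: s1_def sym_at_def fun_eq_iff marks_def\<close>)
    qed (use x y xy b in auto)
  qed (use x b in auto)
  then show ?thesis
    by (rule runs_mono) (use x(5) y(5) m in \<open>auto simp: algebra_simps\<close>)
qed

lemma frame_block: "frame n k s s' \<Longrightarrow> 1 \<le> i \<Longrightarrow> block n (fst s' i)"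
  by (auto simp: frame_def)

lemma frame_trans: "frame n k s s1 \<Longrightarrow> frame n k s1 s2 \<Longrightarrow> frame n k s s2"
  by (auto simp: frame_def)

lemma frame_le: "frame n k s s' \<Longrightarrow> k' \<le> k \<Longrightarrow> frame n k' s s'"
  by (auto simp: frame_def)

lemma pre_frame:
  assumes "pre V n E k L \<rho> s" "frame n k s s'" "2 \<le> V" "V \<le> k"
  shows "pre V n E k L \<rho> s'"
proof -
  have "fst s' 0 = fst s 0" "snd s' = snd s" "\<And>i. 2 \<le> i \<Longrightarrow> i < V \<Longrightarrow> fst s' i = fst s i"
    "\<And>i. 1 \<le> i \<Longrightarrow> block n (fst s' i)"
    using assms by (auto simp: frame_def)
  then show ?thesis using assms(1) unfolding pre_def by simp
qed

lemma pre_weaken: "pre V n E k L \<rho> s \<Longrightarrow> k \<le> k' \<Longrightarrow> pre V n E k' L \<rho> s"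
  unfolding pre_def by auto

text \<open>The value of \<open>a\<close> is parked on tape \<open>k\<close>. Both operands are
  compiled from \<open>k + 1\<close> on, so evaluating \<open>b\<close> cannot overwrite it.\<close>

lemma correct_Op:
  assumes IHa: "\<And>s. pre V n E (k + 1) L \<rho> s \<Longrightarrow> runs (poly (cost a) n) (compile K (k + 1) a) s
      (\<lambda>s'. frame n (k + 1) s s' \<and> fst s' 1 0 = Suc (value_of K n E a \<rho>))"
    and IHb: "\<And>s. pre V n E (k + 1) L \<rho> s \<Longrightarrow> runs (poly (cost b) n) (compile K (k + 1) b) s
      (\<lambda>s'. frame n (k + 1) s s' \<and> fst s' 1 0 = Suc (value_of K n E b \<rho>))"
    and pre: "pre V n E k L \<rho> s" and wf: "2 \<le> V" "V \<le> k" and n: "0 < n"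
  shows "runs (poly (cost (Op f a b)) n) (compile K k (Op f a b)) s
    (\<lambda>s'. frame n k s s' \<and> fst s' 1 0 = Suc (value_of K n E (Op f a b) \<rho>))"
proof -
  have "runs (poly (cost a) n + (1 + (poly (cost b) n + 1 + 1) + 1) + 1) (compile K k (Op f a b)) s
    (\<lambda>s'. frame n k s s' \<and> fst s' 1 0 = Suc (value_of K n E (Op f a b) \<rho>))"
    unfolding compile.simps
  proof (rule runs_Seq, rule runs_mono[OF IHa], goal_cases)
    case (3 s1)
    then have f1: "frame n (k + 1) s s1" and v1: "fst s1 1 0 = Suc (value_of K n E a \<rho>)" by auto
    show ?case
    proof (rule runs_Seq, rule runs_Write, goal_cases)
      case 1
      let ?s2 = "put {k} (sym_at s1 1) s1"
      have h: "snd s1 1 = 0" "snd s1 k = 0"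
        using f1 pre_rest(4,5)[OF pre] by (auto simp: frame_def)
      have f2: "frame n k s ?s2"
        using f1 h v1 n by (auto simp: frame_def sym_at_def intro!: block_upd)
      show ?case
      proof (rule runs_Seq, rule runs_mono[OF IHb], goal_cases)
        case 1
        show ?case by (rule pre_weaken[OF pre_frame[OF pre f2 wf]]) auto
      next
        case (3 s3)
        then have f3: "frame n (k + 1) ?s2 s3" and v3: "fst s3 1 0 = Suc (value_of K n E b \<rho>)" by auto
        have "k \<noteq> 1" using wf by auto
        then have k: "sym_at s3 k = Suc (value_of K n E a \<rho>)" "sym_at s3 1 = Suc (value_of K n E b \<rho>)"
          "snd s3 = snd s"
          using f3 v1 v3 h f2 by (auto simp: frame_def sym_at_def)
        have "frame n k s s3" using frame_trans[OF f2 frame_le[OF f3]] by simp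
        then show ?case
          using k n pre_rest(4)[OF pre]
          by (intro runs_Write) (auto simp: frame_def intro!: block_upd)
      qed auto
    qed
  qed (use pre_weaken[OF pre] in auto)
  then show ?thesis by (rule runs_mono) auto
qed

text \<open>For entering a binder at value \<open>j\<close>. Heads of tapes \<open>V\<close> to
  \<open>k' - 1\<close> are unconstrained, since surrounding loops may be in the middle of their
  blocks.\<close>

lemma pre_bind:
  assumes pre: "pre V n E k L \<rho> s" and x: "x \<notin> L" "2 \<le> x" "x < V" and j: "j < n" and k: "V \<le> k" "k \<le> k'"
    and s': "snd s' x = int j" "\<And>i. i < V \<or> k' \<le> i \<Longrightarrow> i \<noteq> x \<Longrightarrow> snd s' i = snd s i"
      "fst s' x = marks n {j}" "\<And>i. i < V \<Longrightarrow> i \<noteq> 1 \<Longrightarrow> i \<noteq> x \<Longrightarrow> fst s' i = fst s i"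
      "\<And>i. 1 \<le> i \<Longrightarrow> block n (fst s' i)"
  shows "pre V n E k' (insert x L) (\<rho>(x := j)) s'"
proof -
  have "fst s' 0 = fst s 0" "snd s' 0 = snd s 0" "snd s' 1 = snd s 1" using s' x k by auto
  moreover have "\<forall>i\<ge>k'. snd s' i = 0" using pre_rest(5)[OF pre] s' x k by auto
  moreover have "\<forall>i\<in>{2..<V}. if i \<in> insert x L then (\<rho>(x := j)) i < n \<and> snd s' i = int ((\<rho>(x := j)) i) \<and> fst s' i = marks n {(\<rho>(x := j)) i}
        else snd s' i = 0 \<and> fst s' i = marks n {}"
    using pre s' x k j unfolding pre_def by auto
  ultimately show ?thesis using pre s'(5) unfolding pre_def by simp
qed

lemma correct_Fold:
  assumes IH: "\<And>s \<rho>. pre V n E (k + 1) (insert x L) \<rho> s \<Longrightarrow> runs (poly (cost e) n) (compile K (k + 1) e) s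
      (\<lambda>s'. frame n (k + 1) s s' \<and> fst s' 1 0 = Suc (value_of K n E e \<rho>))"
    and pre: "pre V n E k L \<rho> s" and wf: "wf_expr V L (Fold x f e)" "2 \<le> V" "V \<le> k" and n: "0 < n"
  shows "runs (poly (cost (Fold x f e)) n) (compile K k (Fold x f e)) s
    (\<lambda>s'. frame n k s s' \<and> fst s' 1 0 = Suc (value_of K n E (Fold x f e) \<rho>))"
proof -
  have x: "x \<notin> L" "2 \<le> x" "x < V" "x < k" using wf by auto
  note free = pre_free[OF pre x(1-3)]
  \<comment> \<open>The accumulator after \<open>j\<close> values, kept on tape \<open>k\<close> as
    the symbol \<open>Suc (F j)\<close>; the initial fill with 1 encodes
    \<open>F 0 = 0\<close>.\<close>
  define F where "F = (\<lambda>j. fold (\<lambda>i s. f s (value_of K n E e (\<rho>(x := i))) mod K) [0..<j] 0)"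
  let ?I = "\<lambda>j s'. frame n k s s' \<and> fst s' k 0 = Suc (F j)"
  let ?T = "1 + (poly (cost e) n + (1 + 1 + 1) + 1) + 1"
  note h = pre_rest(3-5)[OF pre]
  have "runs (1 + ((n + 1) * (?T + 7) + 1 + 1) + 1) (compile K k (Fold x f e)) s
    (\<lambda>s'. frame n k s s' \<and> fst s' 1 0 = Suc (value_of K n E (Fold x f e) \<rho>))"
    unfolding compile.simps
  proof (rule runs_Seq, rule runs_Write, rule runs_Seq, rule runs_loop[where I = ?I], goal_cases _ step bl start start2 fin)
    case (step j s1)
    then have fr: "\<And>i. i < k \<Longrightarrow> i \<noteq> 1 \<Longrightarrow> fst s1 i = fst s i" "\<And>i. i \<noteq> x \<Longrightarrow> snd s1 i = snd s i"
      "snd s1 x = int j" "\<And>i. i \<ge> 1 \<Longrightarrow> block n (fst s1 i)"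
      by (auto simp: frame_def fun_eq_iff split: if_splits)
    have F1: "fst s1 k 0 = Suc (F j)" using step by simp
    have mk: "fst (put {x} 2 s1) x = marks n {j}" using fr x wf free step by (simp add: marks_insert)
    show ?case
    proof (rule runs_Seq, rule runs_Write, rule runs_Seq, rule runs_mono[OF IH[of "\<rho>(x := j)"]], goal_cases)
      case 1
      show ?case
        by (rule pre_bind[OF pre x(1-3) step(1) wf(3)])
          (use wf(3) fr x step(1) mk in \<open>auto simp: block_upd\<close>)
    next
      case (3 s2)
      then have f2: "frame n (k + 1) (put {x} 2 s1) s2"
        and v2: "fst s2 1 0 = Suc (value_of K n E e (\<rho>(x := j)))" by auto
      have g: "\<And>i. i < k \<Longrightarrow> i \<noteq> 1 \<Longrightarrow> i \<noteq> x \<Longrightarrow> fst s2 i = fst s i" "fst s2 x = marks n {j}"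
        "fst s2 k 0 = Suc (F j)" "snd s2 = snd s1" "\<And>i. i \<ge> 1 \<Longrightarrow> block n (fst s2 i)"
        using f2 fr x mk F1 wf unfolding frame_def by auto
      have hd: "snd s1 k = 0" "snd s1 1 = 0" using h fr x by auto
      show ?case
      proof (rule runs_Seq, rule runs_Write, rule runs_Write, goal_cases)
        case 1
        have "sym_at s2 k = Suc (F j)" "sym_at s2 1 = Suc (value_of K n E e (\<rho>(x := j)))"
          using g v2 hd by (auto simp: sym_at_def)
        then have "Suc (f (sym_at s2 k - 1) (sym_at s2 1 - 1) mod K) = Suc (F (Suc j))"
          by (simp add: F_def)
        moreover have "\<And>q. q \<noteq> int j \<Longrightarrow> marks n {j} q = marks n {} q" by (auto simp: marks_def)
        ultimately show ?case
          using g hd fr x step(1) wf free n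
          by (auto simp: frame_def fun_eq_iff marks_remove block_upd)
      qed
    qed auto
  next
    case (bl j s1)
    then show ?case using frame_block[of n k s s1 x] x by simp
  next
    case start
    then show ?case
      using h wf n pre_rest(1)[OF pre] by (auto simp: frame_def F_def block_upd)
  next
    case start2
    then show ?case using free by auto
  next
    case (fin s1)
    then show ?case
      using h wf n by (intro runs_Write) (auto simp: frame_def F_def sym_at_def intro!: block_upd)
  qed auto
  then show ?thesis by (rule runs_mono) (auto simp: algebra_simps)
qed

text \<open>A round that adds nothing leaves a closed set, and every other round adds a vertex; only
  \<open>n\<close> vertices are available, so \<open>n\<close> rounds suffice.\<close>

lemma reach_iterate:
  fixes R :: "(nat \<times> nat) set"
  assumes R: "R \<subseteq> {..<n} \<times> {..<n}" and u: "u < n"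
  shows "((\<lambda>A. A \<union> R `` A) ^^ n) {u} = R\<^sup>* `` {u}"
proof -
  define A where "A = (\<lambda>t. ((\<lambda>A. A \<union> R `` A) ^^ t) {u})"
  have A0: "A 0 = {u}" and AS: "A (Suc t) = A t \<union> R `` A t" for t by (auto simp: A_def)
  have sub: "A t \<subseteq> R\<^sup>* `` {u} \<and> A t \<subseteq> {..<n} \<and> u \<in> A t" for t
  proof (induction t)
    case (Suc t)
    then show ?case using R unfolding AS by (blast intro: rtrancl_into_rtrancl)
  qed (use A0 u in auto)
  have grow: "R `` A t \<subseteq> A t \<or> t < card (A t)" for t
  proof (induction t)
    case (Suc t)
    have fin: "finite (A (Suc t))" using sub[of "Suc t"] finite_subset by blast
    show ?case
    proof (cases "R `` A t \<subseteq> A t")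
      case True
      then show ?thesis by (auto simp: AS)
    next
      case False
      then have "A t \<subset> A (Suc t)" by (auto simp: AS)
      then have "card (A t) < card (A (Suc t))" by (rule psubset_card_mono[OF fin])
      then show ?thesis using Suc False by auto
    qed
  qed (simp add: A0)
  have "card (A n) \<le> n" using card_mono[of "{..<n}" "A n"] sub by auto
  with grow[of n] have closed: "R `` A n \<subseteq> A n" by linarith
  have "v \<in> A n" if "(u, v) \<in> R\<^sup>*" for v
    using that by (induction rule: rtrancl_induct) (use sub closed in blast)+
  then show ?thesis using sub[of n] by (auto simp: A_def)
qed

lemma block_zero: "block n c \<Longrightarrow> p < 0 \<or> int n \<le> p \<Longrightarrow> c p = 0"
  unfolding block_def by (metis linorder_not_le)

text \<open>Scratch tapes may carry garbage from earlier evaluations, so both sets are reset to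
  unmarked cells first.\<close>

lemma reach_clear:
  assumes "block n (fst s k)" "block n (fst s (Suc k))" "snd s k = 0" "snd s (Suc k) = 0" "1 \<le> k"
    and "\<And>i. i \<ge> 1 \<Longrightarrow> block n (fst s i)"
  shows "runs ((n + 1) * (1 + 7)) (loop k {k, k + 1} (Fill {k, k + 1} 1)) s
    (\<lambda>s'. frame n k s s' \<and> fst s' k = marks n {} \<and> fst s' (Suc k) = marks n {})"
proof (rule runs_loop[where n = n and I = "\<lambda>j s'. frame n k s s' \<and>
      (\<forall>p<int j. fst s' k p = marks n {} p \<and> fst s' (Suc k) p = marks n {} p)"], goal_cases _ step bl start _ fin)
  case (step j s1)
  then have "snd s1 k = int j" "snd s1 (Suc k) = int j" "\<And>i. i \<ge> 1 \<Longrightarrow> block n (fst s1 i)"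
    "\<And>i. i < k \<Longrightarrow> i \<noteq> 1 \<Longrightarrow> fst s1 i = fst s i" "\<And>i. i \<noteq> k \<Longrightarrow> i \<noteq> Suc k \<Longrightarrow> snd s1 i = snd s i"
    by (auto simp: frame_def fun_eq_iff split: if_splits)
  then show ?case
    using step assms by (intro runs_Write) (auto simp: frame_def fun_eq_iff block_upd marks_def)
next
  case start
  then show ?case
    using assms block_zero[OF assms(1)] block_zero[OF assms(2)] by (auto simp: frame_def marks_def)
next
  case (fin s1)
  then have "\<And>i. i \<ge> 1 \<Longrightarrow> block n (fst s1 i)" by (auto simp: frame_def)
  then have "fst s1 i p = 0" if "int n \<le> p" "i \<ge> 1" for i p using that by (auto intro: block_zero)
  then have "fst s1 i p = marks n {} p" if "i = k \<or> i = Suc k" for i p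
    using fin assms(5) that by (cases "p < int n") (auto simp: marks_def)
  then show ?case using fin by (auto simp: fun_eq_iff)
qed (use assms in \<open>auto simp: frame_def\<close>)

lemma reach_merge:
  assumes "fst s k = marks n A" "fst s (Suc k) = marks n B" "snd s k = 0" "snd s (Suc k) = 0" "2 \<le> k"
    and "\<And>i. i \<ge> 1 \<Longrightarrow> block n (fst s i)"
  shows "runs ((n + 1) * (1 + 7)) (loop k {k, k + 1} (Write {k} (\<lambda>a b. if a = 2 \<or> b = 2 then 2 else 1) k (k + 1))) s
    (\<lambda>s'. frame n k s s' \<and> fst s' k = marks n (A \<union> B) \<and> fst s' (Suc k) = marks n B)"
proof (rule runs_loop[where n = n and I = "\<lambda>j s'. frame n k s s' \<and>
      fst s' k = marks n (A \<union> {p \<in> B. p < j}) \<and> fst s' (Suc k) = marks n B"], goal_cases _ step bl start _ fin)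
  case (step j s1)
  then have s1: "snd s1 k = int j" "snd s1 (Suc k) = int j" "\<And>i. i \<ge> 1 \<Longrightarrow> block n (fst s1 i)"
    "\<And>i. i < k \<Longrightarrow> i \<noteq> 1 \<Longrightarrow> fst s1 i = fst s i" "\<And>i. i \<noteq> k \<Longrightarrow> i \<noteq> Suc k \<Longrightarrow> snd s1 i = snd s i"
    "fst s1 k = marks n (A \<union> {p \<in> B. p < j})" "fst s1 (Suc k) = marks n B"
    by (auto simp: frame_def fun_eq_iff split: if_splits)
  have "(fst s1 k)(int j := if sym_at s1 k = 2 \<or> sym_at s1 (Suc k) = 2 then 2 else 1) = marks n (A \<union> {p \<in> B. p < Suc j})"
    using s1 step(1) by (auto simp: sym_at_def marks_def fun_eq_iff less_Suc_eq)
  note mk = this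
  show ?case
  proof (rule runs_Write, goal_cases)
    case 1
    let ?s2 = "put {k} (if sym_at s1 k = 2 \<or> sym_at s1 (k + 1) = 2 then 2 else 1) s1"
    have c: "fst ?s2 k = marks n (A \<union> {p \<in> B. p < Suc j})" "fst ?s2 (Suc k) = marks n B"
      using mk s1 by auto
    have d: "\<forall>i<k. i \<noteq> 1 \<longrightarrow> fst ?s2 i = fst s i" using s1 by simp
    have e: "block n (fst ?s2 i)" if "1 \<le> i" for i
      using c s1(3)[OF that] by (cases "i = k") auto
    have f: "snd (at_pos {k, k + 1} 0 ?s2) = snd s"
      using s1 assms by (auto simp: fun_eq_iff)
    have "\<forall>a\<in>{k, k + 1}. snd ?s2 a = int j" using s1 by simp
    then show ?case
      unfolding frame_def using c d e f by (simp only: at_pos_simps(1) simp_thms) blast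
  qed
next
  case (fin s1)
  have "marks n (A \<union> {p \<in> B. p < n}) = marks n (A \<union> B)" by (auto simp: marks_def fun_eq_iff)
  then show ?case using fin by simp
qed (use assms in \<open>auto simp: frame_def\<close>)

definition related :: "nat \<Rightarrow> nat \<Rightarrow> (nat \<Rightarrow> nat \<Rightarrow> bool) \<Rightarrow> expr \<Rightarrow> (nat \<Rightarrow> nat) \<Rightarrow> nat \<Rightarrow> nat \<Rightarrow> (nat \<times> nat) set" where
  "related K n E e \<rho> x y = {(i, j). i < n \<and> j < n \<and> value_of K n E e (\<rho>(x := i, y := j)) \<noteq> 0}"

text \<open>One round of the search: each \<open>x\<close> marked on tape \<open>k\<close> is
  combined with every \<open>y\<close>, and hits are marked on \<open>k + 1\<close>. New vertices do
  not enter \<open>A\<close> during the scan, so the round is exactly one image step.\<close>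

lemma reach_scan:
  assumes IH: "\<And>s \<rho>. pre V n E (k + 3) (insert y (insert x L)) \<rho> s \<Longrightarrow> runs (poly (cost e) n) (compile K (k + 3) e) s
      (\<lambda>s'. frame n (k + 3) s s' \<and> fst s' 1 0 = Suc (value_of K n E e \<rho>))"
    and pre: "pre V n E (k + 3) L \<rho> s" and wf: "wf_expr V L (Reach x y e u v)" "2 \<le> V" "V \<le> k"
    and h0: "snd s k = 0" "snd s (Suc k) = 0"
    and A: "fst s k = marks n A" and B: "fst s (Suc k) = marks n B"
  shows "runs ((n + 1) * ((n + 1) * (poly (cost e) n + 13) + 13))
    (loop x {x, k}
         (Cond (\<lambda>a b. a = 2) k k
           (Fill {x} 2 ;;
            loop y {y, k + 1} (Fill {y} 2 ;; compile K (k + 3) e ;;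
              Write {k + 1} (\<lambda>a b. if a = 1 then b else 2) 1 (k + 1) ;; Fill {y} 1) ;;
            Fill {x} 1)
           skip)) s
    (\<lambda>s'. frame n k s s' \<and> fst s' k = marks n A \<and> fst s' (Suc k) = marks n (B \<union> related K n E e \<rho> x y `` A))"
proof -
  let ?R = "related K n E e \<rho> x y"
  have x: "x \<notin> L" "2 \<le> x" "x < V" "x < k" "x \<noteq> y" and y: "y \<notin> L" "2 \<le> y" "y < V" "y < k" using wf by auto
  note xf = pre_free[OF pre x(1-3)] and yf = pre_free[OF pre y(1-3)]
  note h = pre_rest(3,4)[OF pre] h0 and bl = pre_rest(1)[OF pre]
  have R: "(i, j) \<in> ?R \<longleftrightarrow> i < n \<and> j < n \<and> value_of K n E e (\<rho>(x := i, y := j)) \<noteq> 0" for i j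
    by (simp add: related_def)
  let ?I = "\<lambda>i s'. frame n k s s' \<and> fst s' k = marks n A \<and> fst s' (Suc k) = marks n (B \<union> ?R `` {p \<in> A. p < i})"
  let ?T = "(n + 1) * (poly (cost e) n + 13) + 6"
  have "runs ((n + 1) * (?T + 7)) (loop x {x, k}
         (Cond (\<lambda>a b. a = 2) k k
           (Fill {x} 2 ;;
            loop y {y, k + 1} (Fill {y} 2 ;; compile K (k + 3) e ;;
              Write {k + 1} (\<lambda>a b. if a = 1 then b else 2) 1 (k + 1) ;; Fill {y} 1) ;;
            Fill {x} 1)
           skip)) s
    (\<lambda>s'. frame n k s s' \<and> fst s' k = marks n A \<and> fst s' (Suc k) = marks n (B \<union> ?R `` A))"
  proof (rule runs_loop[where I = ?I], goal_cases _ step bl start heads fin)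
    case (step i s1)
    then have s1: "snd s1 k = int i" "snd s1 x = int i" "\<And>i. i \<ge> 1 \<Longrightarrow> block n (fst s1 i)"
      "\<And>i. i < k \<Longrightarrow> i \<noteq> 1 \<Longrightarrow> fst s1 i = fst s i" "\<And>i. i \<noteq> k \<Longrightarrow> i \<noteq> x \<Longrightarrow> snd s1 i = snd s i"
      "fst s1 k = marks n A" "fst s1 (Suc k) = marks n (B \<union> ?R `` {p \<in> A. p < i})"
      by (auto simp: frame_def fun_eq_iff split: if_splits)
    have in_A: "sym_at s1 k = 2 \<longleftrightarrow> i \<in> A" using s1 step(1) by (simp add: sym_at_def)
    have next_set: "?R `` {p \<in> A. p < Suc i} = ?R `` {p \<in> A. p < i} \<union> (if i \<in> A then ?R `` {i} else {})"
      by (auto simp: less_Suc_eq)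
    let ?B = "B \<union> ?R `` {p \<in> A. p < i}"
    let ?t = "1 + (poly (cost e) n + (1 + 1 + 1) + 1) + 1"
    have "runs ((1 + ((n + 1) * (?t + 7) + 1 + 1) + 1) + 1) (Cond (\<lambda>a b. a = 2) k k
           (Fill {x} 2 ;;
            loop y {y, k + 1} (Fill {y} 2 ;; compile K (k + 3) e ;;
              Write {k + 1} (\<lambda>a b. if a = 1 then b else 2) 1 (k + 1) ;; Fill {y} 1) ;;
            Fill {x} 1)
           skip) s1 (\<lambda>s'. (\<forall>a\<in>{x, k}. snd s' a = int i) \<and> ?I (Suc i) (at_pos {x, k} 0 s'))"
    proof (rule runs_Cond, goal_cases marked unmarked)
      case unmarked
      show ?case
        by (rule runs_mono[OF runs_skip[of "\<lambda>s'. s' = s1"]])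
          (use step(2,3) unmarked in_A next_set in auto)
    next
      case marked
      then have iA: "i \<in> A" using in_A by simp
      let ?s2 = "put {x} 2 s1"
      have pre2: "pre V n E (k + 3) (insert x L) (\<rho>(x := i)) ?s2"
        by (rule pre_bind[OF pre x(1-3) step(1)])
          (use wf(3) s1 x step(1) xf in \<open>auto simp: block_upd marks_insert\<close>)
      have y2: "y \<notin> insert x L" using y x by auto
      note yf2 = pre_free[OF pre2 y2 y(2,3)]
      \<comment> \<open>The inner loop is framed against \<open>?s2\<close>, where \<open>x\<close>
        is already marked at \<open>i\<close>, instead of against \<open>s\<close>.\<close>
      let ?J = "\<lambda>j s'. frame n k ?s2 s' \<and> fst s' k = marks n A \<and> fst s' (Suc k) = marks n (?B \<union> {q \<in> ?R `` {i}. q < j})"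
      show ?case
      proof (rule runs_Seq, rule runs_Write, rule runs_Seq, rule runs_loop[where I = ?J], goal_cases _ inner bl start heads fin)
        case (inner j s3)
        then have s3: "snd s3 (Suc k) = int j" "snd s3 y = int j" "\<And>i. i \<ge> 1 \<Longrightarrow> block n (fst s3 i)"
          "\<And>i. i < k \<Longrightarrow> i \<noteq> 1 \<Longrightarrow> fst s3 i = fst ?s2 i" "\<And>i. i \<noteq> Suc k \<Longrightarrow> i \<noteq> y \<Longrightarrow> snd s3 i = snd s1 i"
          "fst s3 k = marks n A" "fst s3 (Suc k) = marks n (?B \<union> {q \<in> ?R `` {i}. q < j})"
          by (auto simp: frame_def fun_eq_iff split: if_splits)
        let ?s4 = "put {y} 2 s3"
        have pre4: "pre V n E (k + 3) (insert y (insert x L)) (\<rho>(x := i, y := j)) ?s4"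
          by (rule pre_bind[OF pre2 y2 y(2,3) inner(1)])
            (use wf(3) s3 s1 x y inner(1) yf2 in \<open>auto simp: block_upd marks_insert less_Suc_eq\<close>)
        show ?case
        proof (rule runs_Seq, rule runs_Write, rule runs_Seq, rule runs_mono[OF IH[OF pre4]], goal_cases _ upd)
          case (upd s5)
          then have s5: "snd s5 = snd s3" "\<And>i. i < k \<Longrightarrow> i \<noteq> 1 \<Longrightarrow> i \<noteq> y \<Longrightarrow> fst s5 i = fst ?s2 i"
            "fst s5 k = marks n A" "fst s5 (Suc k) = marks n (?B \<union> {q \<in> ?R `` {i}. q < j})"
            "\<And>i. i \<ge> 1 \<Longrightarrow> block n (fst s5 i)" "fst s5 y = marks n {j}"
            "fst s5 1 0 = Suc (value_of K n E e (\<rho>(x := i, y := j)))"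
            using s3 y wf yf2 inner(1) by (auto simp: frame_def marks_insert)
          have "snd s5 1 = 0" using s5 s3 s1 x y wf h by auto
          then have acc: "sym_at s5 1 = 1 \<longleftrightarrow> (i, j) \<notin> ?R"
            using s5(7) step(1) inner(1) by (simp add: sym_at_def R)
          have "sym_at s5 (Suc k) = (if j \<in> ?B \<union> {q \<in> ?R `` {i}. q < j} then 2 else 1)"
            using s5 s3 inner(1) by (simp add: sym_at_def)
          then have mk: "(fst s5 (Suc k))(int j := (if sym_at s5 1 = 1 then sym_at s5 (Suc k) else 2))
              = marks n (?B \<union> {q \<in> ?R `` {i}. q < Suc j})"
            using s5(4) acc inner(1) by (auto simp: marks_def fun_eq_iff less_Suc_eq)
          show ?case
          proof (rule runs_Seq, rule runs_Write, rule runs_Write, goal_cases)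
            case 1
            let ?s6 = "put {k + 1} (if sym_at s5 1 = 1 then sym_at s5 (k + 1) else 2) s5"
            let ?s7 = "put {y} 1 ?s6"
            have c: "fst ?s7 (Suc k) = marks n (?B \<union> {q \<in> ?R `` {i}. q < Suc j})"
            proof -
              have "fst ?s7 (Suc k) = (fst s5 (Suc k))(snd s5 (Suc k) := (if sym_at s5 1 = 1 then sym_at s5 (Suc k) else 2))"
                using y by auto
              also have "\<dots> = (fst s5 (Suc k))(int j := (if sym_at s5 1 = 1 then sym_at s5 (Suc k) else 2))"
                by (simp only: s5(1) s3(1))
              finally show ?thesis using mk by (rule trans)
            qed
            have "fst ?s7 y = fst ?s2 y" using s5 s3 y x inner(1) yf2 by (simp add: marks_remove)
            moreover have "fst ?s7 l = fst ?s2 l" if "l < k" "l \<noteq> 1" "l \<noteq> y" for l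
              using that s5 s3 y x by simp
            ultimately have d: "\<forall>l<k. l \<noteq> 1 \<longrightarrow> fst ?s7 l = fst ?s2 l" by blast
            have e: "fst ?s7 k = marks n A" using s5 y by simp
            have f: "block n (fst ?s7 l)" if "l \<ge> 1" for l
            proof (cases "l = Suc k \<or> l = y")
              case True
              then show ?thesis using c d y wf(2) yf2 \<open>fst ?s7 y = fst ?s2 y\<close> by auto
            next
              case False
              then show ?thesis using s5(5) that by simp
            qed
            have g: "snd ?s7 = snd s3" using s5 by simp
            have hh: "snd (at_pos {y, k + 1} 0 ?s7) = snd ?s2"
              using s3 s1 yf h g y x by (auto simp: fun_eq_iff)
            have "\<forall>a\<in>{y, k + 1}. snd ?s7 a = int j" using s3 g by auto
            moreover have "?J (Suc j) (at_pos {y, k + 1} 0 ?s7)"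
              unfolding frame_def using c d e f hh by (simp only: at_pos_simps(1) simp_thms) blast
            ultimately show ?case by blast
          qed
        qed (use wf in auto)
      next
        case (bl j s3)
        then show ?case using frame_block[of n k ?s2 s3 y] y by simp
      next
        case start
        have "block n (fst ?s2 l)" if "l \<ge> 1" for l
          using pre_rest(1)[OF pre2 that] .
        then show ?case using s1 x wf by (auto simp: frame_def)
      next
        case heads
        then show ?case using s1 x y yf h wf by auto
      next
        case (fin s3)
        then have s3: "snd s3 = snd s1" "\<And>i. i \<ge> 1 \<Longrightarrow> block n (fst s3 i)"
          "\<And>i. i < k \<Longrightarrow> i \<noteq> 1 \<Longrightarrow> fst s3 i = fst ?s2 i"
          "fst s3 k = marks n A" "fst s3 (Suc k) = marks n (?B \<union> {q \<in> ?R `` {i}. q < n})"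
          by (auto simp: frame_def)
        have "{q \<in> ?R `` {i}. q < n} = ?R `` {i}" by (auto simp: R)
        with s3(5) have mk: "fst s3 (Suc k) = marks n (B \<union> ?R `` {p \<in> A. p < Suc i})"
          using next_set iA by (simp add: Un_assoc)
        have "fst s3 x = marks n {i}" using s3 s1 x xf step(1) by (simp add: marks_insert)
        then have xr: "(fst s3 x)(int i := 1) = fst s x" using xf step(1) by (simp add: marks_remove)
        show ?case
        proof (rule runs_Write, goal_cases)
          case 1
          let ?s4 = "put {x} 1 s3"
          have "fst ?s4 x = fst s x" using xr s3 s1 by simp
          moreover have "fst ?s4 l = fst s l" if "l < k" "l \<noteq> 1" "l \<noteq> x" for l
            using that s3 s1 by simp
          ultimately have d: "\<forall>l<k. l \<noteq> 1 \<longrightarrow> fst ?s4 l = fst s l" by blast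
          have f: "block n (fst ?s4 l)" if "l \<ge> 1" for l
            using that s3(2) \<open>fst ?s4 x = fst s x\<close> xf by (cases "l = x") auto
          have hh: "snd (at_pos {x, k} 0 ?s4) = snd s"
            using s3 s1 xf h by (auto simp: fun_eq_iff)
          have e: "fst ?s4 k = marks n A" "fst ?s4 (Suc k) = marks n (B \<union> ?R `` {p \<in> A. p < Suc i})"
            using s3 mk x by auto
          have "\<forall>a\<in>{x, k}. snd ?s4 a = int i" using s3 s1 by auto
          moreover have "?I (Suc i) (at_pos {x, k} 0 ?s4)"
            unfolding frame_def using d e f hh by (simp only: at_pos_simps(1) simp_thms) blast
          ultimately show ?case by blast
        qed
      qed auto
    qed
    then show ?case by (rule runs_mono) (auto simp: algebra_simps)
  next
    case (bl j s1)
    then show ?case using frame_block[of n k s s1 x] x by simp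
  next
    case start
    then show ?case using A B bl by (auto simp: frame_def)
  next
    case heads
    then show ?case using xf h by auto
  next
    case (fin s1)
    have "?R `` {p \<in> A. p < n} = ?R `` A" by (auto simp: R)
    then show ?case using fin by simp
  qed auto
  then show ?thesis
    by (rule runs_mono) (rule mult_le_mono2, simp)
qed

text \<open>Carries the head of tape \<open>k\<close> to the position stored in \<open>u\<close>;
  rewinding \<open>u\<close> and searching for its mark returns its own head to that value.\<close>

lemma runs_seek:
  assumes "fst s u = marks n {p}" "snd s u = int p" "p < n" "snd s k = 0" "u \<noteq> k"
    and "runs T c (fst s, (snd s)(k := int p)) Q"
  shows "runs (4 * n + T + 5) (rewind u ;; While unmarked u u (Move {u, k} MoveRight) ;; c) s Q"
proof -
  have "runs ((2 * n + 3) + (2 * n + T + 1) + 1) (rewind u ;; While unmarked u u (Move {u, k} MoveRight) ;; c) s Q"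
  proof (rule runs_Seq, rule runs_rewind[of n _ _ p], goal_cases _ _ _ A)
    case A
    show ?case
    proof (rule runs_Seq, rule runs_find[of _ _ n p], goal_cases _ _ _ _ A)
      case A
      have "(\<lambda>i. if i \<in> {u, k} then snd (fst s, (snd s)(u := 0)) i + int p else snd (fst s, (snd s)(u := 0)) i)
        = (snd s)(k := int p)" using assms by (auto simp: fun_eq_iff)
      then show ?case using assms(6) by simp
    qed (use assms in auto)
  qed (use assms in auto)
  then show ?thesis by (rule runs_mono) auto
qed

lemma correct_Reach:
  assumes IH: "\<And>s \<rho>. pre V n E (k + 3) (insert y (insert x L)) \<rho> s \<Longrightarrow> runs (poly (cost e) n) (compile K (k + 3) e) s
      (\<lambda>s'. frame n (k + 3) s s' \<and> fst s' 1 0 = Suc (value_of K n E e \<rho>))"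
    and pre: "pre V n E k L \<rho> s" and wf: "wf_expr V L (Reach x y e u v)" "2 \<le> V" "V \<le> k" "L \<subseteq> {2..<V}"
  shows "runs (poly (cost (Reach x y e u v)) n) (compile K k (Reach x y e u v)) s
    (\<lambda>s'. frame n k s s' \<and> fst s' 1 0 = Suc (value_of K n E (Reach x y e u v) \<rho>))"
proof -
  let ?R = "related K n E e \<rho> x y"
  have uv: "u \<in> L" "v \<in> L" using wf by auto
  note u = pre_var[OF pre wf(4,3) uv(1)] and v = pre_var[OF pre wf(4,3) uv(2)]
  note h = pre_rest(3-5)[OF pre] and bl = pre_rest(1)[OF pre]
  define A where "A = (\<lambda>t. ((\<lambda>A. A \<union> ?R `` A) ^^ t) {\<rho> u})"
  have An: "A n = ?R\<^sup>* `` {\<rho> u}"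
    unfolding A_def by (rule reach_iterate) (use u(5) in \<open>auto simp: related_def\<close>)
  \<comment> \<open>Tape \<open>k + 1\<close> is not cleared between rounds; its leftovers are
    harmless because they already lie in \<open>A t\<close>.\<close>
  let ?I = "\<lambda>t s'. frame n k s s' \<and> fst s' k = marks n (A t) \<and> (\<exists>B. B \<subseteq> A t \<and> fst s' (Suc k) = marks n B)"
  let ?s = "(n + 1) * ((n + 1) * (poly (cost e) n + 13) + 13)"
  let ?m = "(n + 1) * (1 + 7)"
  have "runs (?m + (4 * n + (1 + ((2 * n + 3) + ((n + 1) * (?s + ?m + 1 + 7) +
      (4 * n + (1 + (2 * n + 3) + 1) + 5) + 1) + 1) + 1) + 5) + 1)
    (compile K k (Reach x y e u v)) s
    (\<lambda>s'. frame n k s s' \<and> fst s' 1 0 = Suc (value_of K n E (Reach x y e u v) \<rho>))"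
    unfolding compile.simps
  proof (rule runs_Seq, rule runs_mono[OF reach_clear[of n]], goal_cases _ _ _ _ _ _ _ seek)
    case (seek s1)
    then have s1: "fst s1 u = marks n {\<rho> u}" "snd s1 = snd s" "\<And>i. i < k \<Longrightarrow> i \<noteq> 1 \<Longrightarrow> fst s1 i = fst s i"
      "fst s1 k = marks n {}" "fst s1 (Suc k) = marks n {}" "\<And>i. i \<ge> 1 \<Longrightarrow> block n (fst s1 i)"
      using u by (auto simp: frame_def)
    show ?case
    proof (rule runs_seek[OF s1(1)], goal_cases _ _ _ _ A)
      case A
      show ?case
      proof (rule runs_Seq, rule runs_Write, rule runs_Seq, rule runs_rewind[of n _ _ "\<rho> u"], goal_cases _ _ _ B)
        case B
        let ?s2 = "(fst (put {k} 2 (fst s1, (snd s1)(k := int (\<rho> u)))), snd s1)"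
        have hk: "(snd s1)(k := 0) = snd s1" using h s1 by (auto simp: fun_eq_iff)
        have s2: "frame n k s ?s2" "fst ?s2 k = marks n {\<rho> u}" "fst ?s2 (Suc k) = marks n {}"
          using s1 u(5) by (auto simp: frame_def marks_insert)
        have "runs ((n + 1) * (?s + ?m + 1 + 7) + (4 * n + (1 + (2 * n + 3) + 1) + 5) + 1)
          (loop (k + 2) {k + 2}
            (loop x {x, k}
              (Cond (\<lambda>a b. a = 2) k k
                (Fill {x} 2 ;;
                 loop y {y, k + 1} (Fill {y} 2 ;; compile K (k + 3) e ;;
                   Write {k + 1} (\<lambda>a b. if a = 1 then b else 2) 1 (k + 1) ;; Fill {y} 1) ;;
                 Fill {x} 1)
                skip) ;;
             loop k {k, k + 1} (Write {k} (\<lambda>a b. if a = 2 \<or> b = 2 then 2 else 1) k (k + 1))) ;;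
           rewind v ;; While unmarked v v (Move {v, k} MoveRight) ;; Write {1} (\<lambda>a b. a) k k ;; rewind k) ?s2
          (\<lambda>s'. frame n k s s' \<and> fst s' 1 0 = Suc (value_of K n E (Reach x y e u v) \<rho>))"
        proof (rule runs_Seq, rule runs_loop[where I = ?I], goal_cases _ step bl start heads fin)
          case (step t s3)
          then obtain B where B: "B \<subseteq> A t" "fst s3 (Suc k) = marks n B" by auto
          have s3: "fst s3 k = marks n (A t)" "\<And>i. i < k \<Longrightarrow> i \<noteq> 1 \<Longrightarrow> fst s3 i = fst s i"
            "\<And>i. i \<ge> 1 \<Longrightarrow> block n (fst s3 i)" "\<And>i. i \<noteq> k + 2 \<Longrightarrow> snd s3 i = snd s i" "snd s3 (k + 2) = int t"
            using step by (auto simp: frame_def fun_eq_iff split: if_splits)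
          have pre3: "pre V n E (k + 3) L \<rho> s3"
          proof -
            have "fst s3 0 = fst s 0" "snd s3 0 = snd s 0" "snd s3 1 = snd s 1" using s3 wf by auto
            moreover have "\<forall>i\<ge>k + 3. snd s3 i = 0" using h s3 by auto
            moreover have "\<forall>i\<in>{2..<V}. fst s3 i = fst s i \<and> snd s3 i = snd s i" using s3 wf by auto
            ultimately show ?thesis using pre s3(3) unfolding pre_def by simp
          qed
          show ?case
          proof (rule runs_Seq, rule runs_mono[OF reach_scan[OF IH pre3 wf(1-3) _ _ s3(1) B(2)]], goal_cases _ _ _ _ merge)
            case (merge s4)
            then have s4: "frame n k s3 s4" "fst s4 k = marks n (A t)" "fst s4 (Suc k) = marks n (B \<union> ?R `` A t)" by auto
            show ?case
            proof (rule runs_mono[OF reach_merge[OF s4(2,3)]], goal_cases _ _ _ _ _ fin)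
              case (fin s5)
              have At: "A (Suc t) = A t \<union> ?R `` A t" by (simp add: A_def)
              have "A t \<union> (B \<union> ?R `` A t) = A (Suc t)" "B \<union> ?R `` A t \<subseteq> A (Suc t)" using B At by auto
              moreover have f5: "frame n k s3 s5" using frame_trans[OF s4(1)] fin by blast
              moreover have "frame n k s (at_pos {k + 2} 0 s5)"
                using f5 s3 h unfolding frame_def by (auto simp: fun_eq_iff)
              ultimately show ?case using fin s3(5) by (auto simp: frame_def)
            qed (use s4 s3 h wf in \<open>auto simp: frame_def\<close>)
          qed (use s3 B h in auto)
        next
          case (bl t s3)
          then show ?case using frame_block[of n k s s3] by simp
        next
          case start
          then show ?case using s2 by (auto simp: A_def)
        next
          case heads
          then show ?case using s1 h by simp
        next
          case (fin s3)
          then have s3: "fst s3 v = marks n {\<rho> v}" "snd s3 = snd s" "fst s3 k = marks n (A n)" "frame n k s s3"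
            using v by (auto simp: frame_def)
          show ?case
          proof (rule runs_seek[OF s3(1)], goal_cases _ _ _ _ A)
            case A
            show ?case
            proof (rule runs_Seq, rule runs_Write, rule runs_rewind[of n _ _ "\<rho> v"], goal_cases _ _ _ B)
              case B
              have val: "sym_at (fst s3, (snd s3)(k := int (\<rho> v))) k = Suc (value_of K n E (Reach x y e u v) \<rho>)"
                using s3 v(5) An by (simp add: sym_at_def related_def)
              have hd: "(snd s3)(k := 0) = snd s" using s3 h by (auto simp: fun_eq_iff)
              show ?case
                unfolding val using s3 h wf(2,3) v(5) hd
                by (auto simp: frame_def simp del: value_of.simps intro!: block_upd)
            qed (use s3 wf v in \<open>auto simp: frame_def\<close>)
          qed (use s3 v h in auto)
        qed auto
        then show ?case using hk by simp
      qed (use s1 h u in \<open>auto simp: marks_insert\<close>)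
    qed (use s1 u h in auto)
  qed (use bl h wf in auto)
  then show ?thesis
  proof (rule runs_mono)
    show "?m + (4 * n + (1 + ((2 * n + 3) + ((n + 1) * (?s + ?m + 1 + 7) +
      (4 * n + (1 + (2 * n + 3) + 1) + 5) + 1) + 1) + 1) + 5) + 1 \<le> poly (cost (Reach x y e u v)) n"
      by (simp add: algebra_simps power3_eq_cube)
  qed
qed

theorem compile_correct:
  assumes "pre V n E k L \<rho> s" "wf_expr V L e" "L \<subseteq> {2..<V}" "2 \<le> V" "V \<le> k" "0 < n"
  shows "runs (poly (cost e) n) (compile K k e) s
    (\<lambda>s'. frame n k s s' \<and> fst s' 1 0 = Suc (value_of K n E e \<rho>))"
  using assms
proof (induction e arbitrary: k L \<rho> s)
  case (Edge x y)
  then show ?case by (intro correct_Edge)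
next
  case (Less x y)
  then show ?case by (intro correct_Less)
next
  case (Op f a b)
  show ?case
    by (rule correct_Op[OF Op.IH(1) Op.IH(2) Op.prems(1)]) (use Op.prems in auto)
next
  case (Fold x f e)
  show ?case
  proof (rule correct_Fold[OF _ Fold.prems(1,2)])
    fix s \<rho> assume "pre V n E (k + 1) (insert x L) \<rho> s"
    then show "runs (poly (cost e) n) (compile K (k + 1) e) s
      (\<lambda>s'. frame n (k + 1) s s' \<and> fst s' 1 0 = Suc (value_of K n E e \<rho>))"
      by (rule Fold.IH) (use Fold.prems in auto)
  qed (use Fold.prems in auto)
next
  case (Reach x y e u v)
  show ?case
  proof (rule correct_Reach[OF _ Reach.prems(1,2)])
    fix s \<rho> assume "pre V n E (k + 3) (insert y (insert x L)) \<rho> s"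
    then show "runs (poly (cost e) n) (compile K (k + 3) e) s
      (\<lambda>s'. frame n (k + 3) s s' \<and> fst s' 1 0 = Suc (value_of K n E e \<rho>))"
      by (rule Reach.IH) (use Reach.prems in auto)
  qed (use Reach.prems in auto)
qed

section \<open>Recovering the number of vertices\<close>

fun temps :: "expr \<Rightarrow> nat" where
  "temps (Edge x y) = 1"
| "temps (Less x y) = 0"
| "temps (Op f a b) = 1 + max (temps a) (temps b)"
| "temps (Fold x f e) = 1 + temps e"
| "temps (Reach x y e u v) = 3 + temps e"

text \<open>\<open>Suc K\<close> symbols are the blank and \<open>v + 1\<close> for each value
  \<open>v < K\<close>; \<open>2 \<le> K\<close> makes room for the mark 2.\<close>

lemma bounded_compile:
  assumes "wf_expr V L e" "L \<subseteq> {2..<V}" "2 \<le> V" "V \<le> k" "k + temps e \<le> N" "2 \<le> K"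
  shows "bounded_com N (Suc K) (compile K k e)"
  using assms
proof (induction e arbitrary: k L)
  case (Edge x y)
  then have "x < N" "y < N" "k < N" by auto
  then show ?case using Edge by (auto simp: rewind_def loop_def)
next
  case (Less x y)
  then have "x < N" "y < N" by auto
  then show ?case using Less by (auto simp: rewind_def loop_def)
next
  case (Op f a b)
  then show ?case using Op.IH(1)[of L "k + 1"] Op.IH(2)[of L "k + 1"] by auto
next
  case (Fold x f e)
  then show ?case using Fold.IH[of "insert x L" "k + 1"] by (auto simp: loop_def)
next
  case (Reach x y e u v)
  then have "u < N" "v < N" by auto
  moreover have "bounded_com N (Suc K) (compile K (k + 3) e)"
    using Reach.prems by (intro Reach.IH[of "insert y (insert x L)"]) auto
  ultimately show ?case using Reach.prems by (auto simp: rewind_def loop_def skip_def)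
qed

text \<open>
  The input head runs through the squares \<open>j\<^sup>2\<close> while all other tapes grow blocks of length
  \<open>j\<close>: each pass moves it by \<open>j + 1 + j\<close> cells.
\<close>

definition grow :: com where
  "grow = While nonblank 1 1 (Move UNIV MoveRight) ;; Fill {1..} 1 ;; Move {0} MoveRight ;;
     Move {1..} MoveLeft ;; While nonblank 1 1 (Move {1..} MoveLeft ;; Move {0} MoveRight) ;;
     Move {1..} MoveRight"

definition grown :: "(int \<Rightarrow> nat) \<Rightarrow> nat \<Rightarrow> store" where
  "grown c j = (\<lambda>i. if i = 0 then c else marks j {}, \<lambda>i. if i = 0 then int (j * j) else 0)"

lemma runs_grow: "runs (6 * j + 12) grow (grown c j) (\<lambda>s. s = grown c (Suc j))"
proof -
  let ?C = "\<lambda>i::nat. if i = 0 then c else marks j {}" and ?D = "\<lambda>i::nat. if i = 0 then c else marks (Suc j) {}"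
  have "runs ((2 * j + 1) + (1 + (1 + (1 + ((j * ((1 + 1 + 1) + 1) + 1) + 1 + 1) + 1) + 1) + 1) + 1)
    grow (grown c j) (\<lambda>s. s = grown c (Suc j))"
    unfolding grow_def
  proof (rule runs_Seq, rule runs_mono[where Q = "\<lambda>s. s = (?C, \<lambda>i. if i = 0 then int (j * j + j) else int j)"],
      rule runs_scan[where m = j], goal_cases _ _ _ _ A)
    case (A s)
    have "runs (1 + (1 + (1 + ((j * ((1 + 1 + 1) + 1) + 1) + 1 + 1) + 1) + 1) + 1)
      (Fill {1..} 1 ;; Move {0} MoveRight ;;
        Move {1..} MoveLeft ;; While nonblank 1 1 (Move {1..} MoveLeft ;; Move {0} MoveRight) ;;
        Move {1..} MoveRight) (?C, \<lambda>i. if i = 0 then int (j * j + j) else int j) (\<lambda>s. s = grown c (Suc j))"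
    proof (rule runs_Seq, rule runs_Write, rule runs_Seq, rule runs_Move, rule runs_Seq, rule runs_Move, rule runs_Seq,
        rule runs_While[where I = "\<lambda>t s. s = (?D, \<lambda>i. if i = 0 then int (j * j + j + 1 + t) else int j - 1 - int t)"],
        goal_cases)
      case (1 t s)
      have "runs (1 + 1 + 1) (Move {1..} MoveLeft ;; Move {0} MoveRight) s
        (\<lambda>s. s = (?D, \<lambda>i. if i = 0 then int (j * j + j + 1 + Suc t) else int j - 1 - int (Suc t)))"
        by (rule runs_Seq, rule runs_Move, rule runs_Move)
          (use 1 in \<open>auto simp: move_def fun_eq_iff\<close>)
      moreover have "sym_at s 1 \<noteq> 0" using 1 by (auto simp: sym_at_def marks_def)
      ultimately show ?case by blast
    next
      case (2 s)
      have "runs 1 (Move {1..} MoveRight) s (\<lambda>s. s = grown c (Suc j))"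
        by (rule runs_Move) (use 2 in \<open>auto simp: move_def grown_def fun_eq_iff algebra_simps\<close>)
      moreover have "sym_at s 1 = 0" using 2 by (auto simp: sym_at_def marks_def)
      ultimately show ?case by blast
    next
      case 3
      show ?case by (auto simp: move_def put_def fun_eq_iff marks_def)
    qed
    then show ?case using A by simp
  qed (auto simp: grown_def sym_at_def marks_def fun_eq_iff)
  then show ?thesis by (rule runs_mono) auto
qed

text \<open>The loop stops at the first square that is at least the input length. The cell to the
  left of the head is nonblank exactly if that square is positive and equals the length; otherwise
  the program ends with tape 1 not showing 2, which rejects.\<close>

definition main_program :: "nat \<Rightarrow> nat \<Rightarrow> expr \<Rightarrow> com" where
  "main_program K V e = While nonblank 0 0 grow ;; Move {0} MoveLeft ;;
     Cond nonblank 0 0 (rewind 0 ;; compile K V e) skip"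

lemma poly_nat_mono: "x \<le> y \<Longrightarrow> poly p x \<le> poly p y" for x y :: nat
  by (induction p) (auto intro!: add_mono mult_mono)

lemma runs_main:
  fixes x :: "bool list"
  assumes wf: "wf_expr V {} e" "2 \<le> V"
  defines "N \<equiv> length x"
  shows "runs (N * (N * 6 + 14) + (N * 2 + poly (cost e) N + 9)) (main_program K V e) (initial_store x)
    (\<lambda>s. sym_at s 1 = 2 \<longleftrightarrow> (\<exists>n>0. N = n * n \<and> value_of K n (\<lambda>i j. x ! (i * n + j)) e (\<lambda>_. 0) = 1))"
    (is "runs _ _ _ (\<lambda>s. _ = 2 \<longleftrightarrow> ?P)")
proof -
  define c where "c = fst (input_tape x)"
  have c: "c p \<noteq> 0 \<longleftrightarrow> 0 \<le> p \<and> p < int N" "0 \<le> p \<Longrightarrow> p < int N \<Longrightarrow> c p = 2 \<longleftrightarrow> x ! nat p" for p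
    by (auto simp: c_def input_tape_def N_def)
  \<comment> \<open>The number of rounds of \<open>grow\<close>; as \<open>J \<le> N\<close>, they
    take quadratic time in total.\<close>
  define J where "J = (LEAST j. N \<le> j * j)"
  have NJ: "N \<le> J * J" unfolding J_def by (rule LeastI[of _ N]) (cases N, auto)
  have JN: "J \<le> N" unfolding J_def by (rule Least_le) (cases N, auto)
  have less: "j * j < N" if "j < J" for j
    using not_less_Least[OF that[unfolded J_def]] by simp
  have "marks 0 {} = (\<lambda>_. 0)" by (auto simp: marks_def fun_eq_iff)
  then have init: "initial_store x = grown c 0"
    by (simp add: initial_store_def grown_def c_def cong: if_cong)
  let ?rest = "(2 * (J * J) + 3) + poly (cost e) J + 1"
  let ?rest' = "2 * N + poly (cost e) N + 4"
  have "runs ((J * ((6 * J + 12) + 1) + 1) + (1 + (?rest' + 1) + 1) + 1) (main_program K V e) (initial_store x)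
     (\<lambda>s. sym_at s 1 = 2 \<longleftrightarrow> ?P)"
    unfolding main_program_def
  proof (rule runs_Seq, rule runs_While[where I = "\<lambda>j s. s = grown c j"], goal_cases step fin init)
    case (step j s)
    have "runs (6 * J + 12) grow s (\<lambda>s. s = grown c (Suc j))"
      using step by (auto intro: runs_mono[OF runs_grow])
    moreover have "int (j * j) < int N" using step(1) less[of j] by (simp only: of_nat_less_iff)
    then have "sym_at s 0 \<noteq> 0" using step(2) c(1)[of "int (j * j)"] by (simp add: sym_at_def grown_def)
    ultimately show ?case by blast
  next
    case (fin s)
    have "\<not> int (J * J) < int N" using NJ by (simp only: of_nat_less_iff not_less)
    then have "\<not> nonblank (sym_at s 0) (sym_at s 0)"
      using fin c(1)[of "int (J * J)"] by (simp add: sym_at_def grown_def)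
    moreover have "runs (1 + (?rest' + 1) + 1) (Move {0} MoveLeft ;;
       Cond nonblank 0 0 (rewind 0 ;; compile K V e) skip) s (\<lambda>s. sym_at s 1 = 2 \<longleftrightarrow> ?P)"
    proof (rule runs_Seq, rule runs_Move, rule runs_Cond, goal_cases)
      case 1
      let ?s = "move {0} MoveLeft s"
      have "snd ?s 0 = int (J * J) - 1" "fst ?s 0 = c" using fin by (auto simp: grown_def)
      then have "0 \<le> int (J * J) - 1" "int (J * J) - 1 < int N"
        using 1 c(1)[of "int (J * J) - 1"] unfolding sym_at_def by auto
      then have "int (J * J) \<le> int N" "J \<noteq> 0" by (linarith, cases J, auto)
      then have "J * J \<le> N" "0 < J" by (simp only: of_nat_le_iff, simp)
      then have N: "N = J * J" and J0: "0 < J" using NJ by auto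
      have sq: "J * J - 1 < J * J" using J0 by simp
      have "int (J * J - 1) = int (J * J) - 1" using J0 by (subst of_nat_diff) auto
      with \<open>snd ?s 0 = _\<close> have hd: "snd ?s 0 = int (J * J - 1)" by simp
      let ?E = "\<lambda>i j. x ! (i * J + j)"
      have P: "?P \<longleftrightarrow> value_of K J ?E e (\<lambda>_. 0) = 1"
      proof -
        have "n = J" if "N = n * n" for n using that N by (metis power2_eq_square power2_eq_iff_nonneg zero_le)
        then show ?thesis using N J0 by blast
      qed
      have bl: "block (J * J) c" using c(1) N by (auto simp: block_def)
      have "runs ?rest (rewind 0 ;; compile K V e) ?s (\<lambda>s. sym_at s 1 = 2 \<longleftrightarrow> ?P)"
      proof (rule runs_Seq, rule runs_rewind[OF _ hd sq], goal_cases)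
        case 1
        show ?case using bl \<open>fst ?s 0 = c\<close> by simp
      next
        case 2
        let ?t = "(fst ?s, (snd ?s)(0 := 0))"
        have "?E i j \<longleftrightarrow> c (int (i * J + j)) = 2" if "i < J" "j < J" for i j
        proof -
          have "i * J + j < (i + 1) * J" using that by simp
          also have "\<dots> \<le> J * J" using that by (intro mult_right_mono) auto
          finally have "int (i * J + j) < int N" unfolding N by (simp only: of_nat_less_iff)
          then have "c (int (i * J + j)) = 2 \<longleftrightarrow> x ! nat (int (i * J + j))" by (intro c(2)) auto
          then show ?thesis by (simp only: nat_int)
        qed
        then have "pre V J ?E V {} (\<lambda>_. 0) ?t"
          using bl fin J0 unfolding pre_def by (auto simp: grown_def)
        from compile_correct[OF this wf(1) _ wf(2) order_refl J0]
        have "runs (poly (cost e) J) (compile K V e) ?t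
          (\<lambda>s'. frame J V ?t s' \<and> fst s' 1 0 = Suc (value_of K J ?E e (\<lambda>_. 0)))" by simp
        then show ?case
        proof (rule runs_mono)
          fix s' assume s': "frame J V ?t s' \<and> fst s' 1 0 = Suc (value_of K J ?E e (\<lambda>_. 0))"
          then have "snd s' 1 = 0" using fin by (auto simp: frame_def grown_def)
          then show "sym_at s' 1 = 2 \<longleftrightarrow> ?P" unfolding P using s' by (simp add: sym_at_def)
        qed simp
      qed
      then show ?case
        by (rule runs_mono) (use N JN poly_nat_mono[OF JN] in auto)
    next
      case 2
      let ?s = "move {0} MoveLeft s"
      have "\<not> ?P"
      proof
        assume ?P
        then obtain n where n: "n > 0" "N = n * n" by blast
        then have "J \<le> n" unfolding J_def by (intro Least_le) auto
        then have "J * J \<le> N" unfolding n by (intro mult_mono) auto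
        with NJ have "N = J * J" by simp
        moreover have "J > 0" using \<open>N = J * J\<close> n by (cases J) auto
        ultimately show False
          using 2 fin c(1)[of "int (J * J) - 1"] by (auto simp: sym_at_def grown_def)
      qed
      moreover have "sym_at ?s 1 \<noteq> 2" using fin by (auto simp: sym_at_def grown_def marks_def)
      ultimately have "runs 1 skip ?s (\<lambda>s. sym_at s 1 = 2 \<longleftrightarrow> ?P)" by (intro runs_skip) blast
      then show ?case by (rule runs_mono) auto
    qed
    ultimately show ?case by blast
  next
    case init
    show ?case using \<open>initial_store x = grown c 0\<close> .
  qed
  then show ?thesis
  proof (rule runs_mono)
    have "J * (6 * J + 13) \<le> N * (6 * N + 13)" using JN by (intro mult_mono) auto
    then show "J * ((6 * J + 12) + 1) + 1 + (1 + (?rest' + 1) + 1) + 1 \<le> N * (N * 6 + 14) + (N * 2 + poly (cost e) N + 9)"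
      by (simp add: algebra_simps)
  qed
qed

theorem expr_solvable:
  assumes wf: "wf_expr V {} e" "2 \<le> V" and K: "2 \<le> K"
    and L: "\<And>x. x \<in> L \<longleftrightarrow>
      (\<exists>n>0. length x = n * n \<and> value_of K n (\<lambda>i j. x ! (i * n + j)) e (\<lambda>_. 0) = 1)"
  shows "solvable_in_polynomial_time L"
proof (rule program_solvable)
  let ?N = "V + temps e"
  show "bounded_com ?N (Suc K) (main_program K V e)"
    using bounded_compile[OF wf(1) _ wf(2) order_refl order_refl K] wf(2) K
    by (simp add: main_program_def grow_def rewind_def skip_def)
  show "2 \<le> ?N" "3 \<le> Suc K" using wf K by auto
  let ?p = "[:0, 1:] * (6 * [:0, 1:] + 14) + (2 * [:0, 1:] + cost e + 9) :: nat poly"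
  show "runs (poly ?p (length x)) (main_program K V e) (initial_store x) (\<lambda>s. sym_at s 1 = 2 \<longleftrightarrow> x \<in> L)" for x
    using runs_main[OF wf, of x K] unfolding L[of x] by simp
qed

section \<open>Cycle lengths and spanning forests\<close>

definition conn :: "('a \<times> 'a) set \<Rightarrow> 'a \<Rightarrow> 'a \<Rightarrow> bool" where
  "conn A u v \<longleftrightarrow> (u, v) \<in> (A \<union> A\<inverse>)\<^sup>*"

lemma conn_refl [simp]: "conn A u u"
  by (simp add: conn_def)

lemma conn_trans: "conn A u v \<Longrightarrow> conn A v w \<Longrightarrow> conn A u w"
  unfolding conn_def by (rule rtrancl_trans)

lemma conn_sym: "conn A u v \<Longrightarrow> conn A v u"
  unfolding conn_def by (rule symD[OF sym_rtrancl]) (auto intro: symI)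

lemma conn_mono: "conn A u v \<Longrightarrow> A \<subseteq> B \<Longrightarrow> conn B u v"
  unfolding conn_def using rtrancl_mono[of "A \<union> A\<inverse>" "B \<union> B\<inverse>"] by blast

lemma conn_edge: "(u, v) \<in> A \<Longrightarrow> conn A u v"
  unfolding conn_def by auto

lemma conn_lift:
  assumes "conn A u v" and "\<And>x y. (x, y) \<in> A \<Longrightarrow> conn B x y"
  shows "conn B u v"
  using assms(1)[unfolded conn_def]
proof (induction rule: rtrancl_induct)
  case (step y z)
  have "conn B y z" using step.hyps(2) assms(2)[of y z] conn_sym[OF assms(2)[of z y]] by blast
  with step.IH show ?case by (rule conn_trans)
qed simp

text \<open>A walk through the new edge can be shortened so that it uses the edge once, in one of
  the two directions.\<close>

lemma conn_insert:
  assumes "conn (insert (x, y) A) u v"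
  shows "conn A u v \<or> conn A u x \<and> conn A y v \<or> conn A u y \<and> conn A x v"
  using assms unfolding conn_def
proof (induction rule: rtrancl_induct)
  case (step v w)
  have "conn A v w \<or> (v = x \<and> w = y) \<or> (v = y \<and> w = x)"
    using step.hyps(2) conn_edge[of v w A] conn_sym[OF conn_edge[of w v A]] by auto
  then show ?case
    using step.IH unfolding conn_def[symmetric] by (metis conn_refl conn_trans)
qed simp

section \<open>Parity of degrees and cuts, decomposition into cycles\<close>

lemma odd_changes: "odd (card {i. i < k \<and> Q i \<noteq> Q (Suc i)}) \<longleftrightarrow> Q 0 \<noteq> Q k"
  for Q :: "nat \<Rightarrow> bool"
proof (induction k)
  case (Suc k)
  have "{i. i < Suc k \<and> Q i \<noteq> Q (Suc i)} =
      (if Q k \<noteq> Q (Suc k) then insert k {i. i < k \<and> Q i \<noteq> Q (Suc i)} else {i. i < k \<and> Q i \<noteq> Q (Suc i)})"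
    by (auto simp: less_Suc_eq)
  then have "odd (card {i. i < Suc k \<and> Q i \<noteq> Q (Suc i)}) \<longleftrightarrow>
      odd (card {i. i < k \<and> Q i \<noteq> Q (Suc i)}) \<noteq> (Q k \<noteq> Q (Suc k))"
    by (cases "Q k \<noteq> Q (Suc k)") (simp_all only: if_True if_False card_insert_disjoint finite_Collect_conjI
        finite_Collect_less_nat mem_Collect_eq even_Suc less_irrefl simp_thms not_False_eq_True)
  then show ?case unfolding Suc by blast
qed simp

definition degree_odd :: "('a \<times> 'a) set \<Rightarrow> 'a \<Rightarrow> bool" where
  "degree_odd A w \<longleftrightarrow> odd (card {e \<in> A. fst e = w \<or> snd e = w})"

lemma card_symdiff:
  "finite A \<Longrightarrow> finite B \<Longrightarrow> card (A - B \<union> (B - A)) + 2 * card (A \<inter> B) = card A + card B"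
proof -
  assume f: "finite A" "finite B"
  have "card (A - B \<union> (B - A)) = card (A - B) + card (B - A)"
    by (rule card_Un_disjoint) (use f in auto)
  moreover have "card A = card (A - B) + card (A \<inter> B)"
    using card_Int_Diff[OF f(1), of B] by simp
  moreover have "card B = card (B - A) + card (A \<inter> B)"
    using card_Int_Diff[OF f(2), of A] by (simp add: Int_commute)
  ultimately show ?thesis by simp
qed

lemma degree_odd_symdiff:
  assumes "finite A" "finite B"
  shows "degree_odd (A - B \<union> (B - A)) w \<longleftrightarrow> degree_odd A w \<noteq> degree_odd B w"
proof -
  let ?r = "\<lambda>A. {e \<in> A. fst e = w \<or> snd e = w}"
  have "?r (A - B \<union> (B - A)) = ?r A - ?r B \<union> (?r B - ?r A)" by auto
  then have r: "card (?r (A - B \<union> (B - A))) = card (?r A - ?r B \<union> (?r B - ?r A))" by (rule arg_cong)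
  have "card (?r A - ?r B \<union> (?r B - ?r A)) + 2 * card (?r A \<inter> ?r B) = card (?r A) + card (?r B)"
    by (rule card_symdiff) (use assms in auto)
  then have "even (card (?r A - ?r B \<union> (?r B - ?r A))) \<longleftrightarrow> even (card (?r A) + card (?r B))"
    by (drule_tac arg_cong[of _ _ even]) (simp only: even_add even_mult_iff even_numeral simp_thms)
  then show ?thesis unfolding degree_odd_def r even_add by blast
qed

text \<open>
  An undirected graph is given by one orientation \<open>A\<close> of its edges; its cycles are those of
  \<open>A \<union> A\<inverse>\<close>.
\<close>

definition oriented :: "('a \<times> 'a) set \<Rightarrow> bool" where
  "oriented A \<longleftrightarrow> finite A \<and> (\<forall>x y. (x, y) \<in> A \<longrightarrow> (y, x) \<notin> A)"

lemma oriented_subset: "oriented A \<Longrightarrow> B \<subseteq> A \<Longrightarrow> oriented B"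
  unfolding oriented_def using finite_subset by blast

lemma oriented_irrefl: "oriented A \<Longrightarrow> (x, x) \<notin> A"
  by (auto simp: oriented_def)

lemma even_degree_second_neighbour:
  assumes A: "oriented A" and ev: "\<not> degree_odd A x" and xy: "(x, y) \<in> A \<union> A\<inverse>"
  obtains z where "(x, z) \<in> A \<union> A\<inverse>" "z \<noteq> y"
proof -
  let ?r = "{e \<in> A. fst e = x \<or> snd e = x}"
  define e where "e = (if (x, y) \<in> A then (x, y) else (y, x))"
  have e: "e \<in> ?r" using xy by (auto simp: e_def)
  have "?r \<noteq> {e}" using ev by (auto simp: degree_odd_def)
  then obtain f where f: "f \<in> ?r" "f \<noteq> e" using e by blast
  define z where "z = (if fst f = x then snd f else fst f)"
  have "(x, z) \<in> A \<union> A\<inverse>" using f by (cases f) (auto simp: z_def)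
  moreover have "z \<noteq> y"
    using f e A by (cases f) (auto simp: z_def e_def oriented_def split: if_splits)
  ultimately show thesis using that by blast
qed

text \<open>In a longest path, a second neighbour of the first vertex lies on the path by
  maximality; not being the next vertex, it closes a cycle on at least three vertices.\<close>

lemma even_degree_cycle:
  assumes A: "oriented A" and ev: "\<And>w. \<not> degree_odd A w" and ne: "A \<noteq> {}"
  obtains l us where "cycle (A \<union> A\<inverse>) l us"
proof -
  let ?E = "A \<union> A\<inverse>"
  define V where "V = fst ` A \<union> snd ` A"
  have finV: "finite V" using A by (auto simp: V_def oriented_def)
  have EV: "(a, b) \<in> ?E \<Longrightarrow> a \<in> V \<and> b \<in> V" for a b by (force simp: V_def)
  define paths where "paths = {p. set p \<subseteq> V \<and> distinct p \<and> 2 \<le> length p \<and>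
      (\<forall>i. Suc i < length p \<longrightarrow> (p ! i, p ! Suc i) \<in> ?E)}"
  have fin: "finite paths"
    by (rule finite_subset[OF _ finite_subset_distinct[OF finV]]) (auto simp: paths_def)
  obtain x y where xy: "(x, y) \<in> A" using ne by auto
  have "[x, y] \<in> paths"
    using xy EV[of x y] oriented_irrefl[OF A] by (auto simp: paths_def)
  then have "Max (length ` paths) \<in> length ` paths"
    using fin by (intro Max_in) auto
  then obtain p where p: "p \<in> paths" "length p = Max (length ` paths)" by auto
  then have longest: "length q \<le> length p" if "q \<in> paths" for q
    using that fin by simp
  have p': "set p \<subseteq> V" "distinct p" "2 \<le> length p" "\<And>i. Suc i < length p \<Longrightarrow> (p ! i, p ! Suc i) \<in> ?E"
    using p(1) by (auto simp: paths_def)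
  have "(p ! 0, p ! 1) \<in> ?E" using p'(3) p'(4)[of 0] by auto
  then obtain z where z: "(p ! 0, z) \<in> ?E" "z \<noteq> p ! 1"
    using even_degree_second_neighbour[OF A ev] by blast
  have "z \<in> set p"
  proof (rule ccontr)
    assume "z \<notin> set p"
    have "(( z # p) ! i, (z # p) ! Suc i) \<in> ?E" if "Suc i < length (z # p)" for i
      using that z(1) p'(4) by (cases i) auto
    then have "z # p \<in> paths" using \<open>z \<notin> set p\<close> p' EV[OF z(1)] by (auto simp: paths_def)
    then show False using longest by fastforce
  qed
  then obtain j where j: "j < length p" "p ! j = z" by (auto simp: in_set_conv_nth)
  have "j \<noteq> 0" "j \<noteq> 1" using z j oriented_irrefl[OF A] by (auto intro: ccontr)
  then have j2: "2 \<le> j" by auto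
  define us where "us = take (Suc j) p @ [p ! 0]"
  have len: "length us = Suc j + 1" using j by (simp add: us_def)
  have nth: "us ! i = p ! i" if "i \<le> j" for i using that j by (simp add: us_def nth_append)
  have nthl: "us ! Suc j = p ! 0" using j by (simp add: us_def nth_append)
  have "(us ! i, us ! (i + 1)) \<in> ?E" if "i < Suc j" for i
  proof (cases "i = j")
    case True
    then show ?thesis using nth[of j] nthl j z(1) by auto
  next
    case False
    then show ?thesis using that nth[of i] nth[of "Suc i"] p'(4)[of i] j by auto
  qed
  moreover have "hd us = p ! 0" using j by (cases p) (auto simp: us_def)
  ultimately have "cycle ?E (Suc j) us"
    using j2 len p'(2) by (auto simp: cycle_def walk_def us_def butlast_append)
  then show thesis using that by blast
qed

text \<open>A cycle meets every cut in an even number of edges. The cut is given by a side function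
  \<open>Q\<close>: singling out one vertex yields even degrees, and taking the two sides of a
  removed tree edge yields the parity behind the criterion.\<close>

lemma cycle_edges:
  assumes A: "oriented A" and c: "cycle (A \<union> A\<inverse>) l us"
  shows "\<exists>Z\<subseteq>A. card Z = l \<and> (\<forall>R (Q :: _ \<Rightarrow> bool).
    (\<forall>a b. (a, b) \<in> A \<longrightarrow> R (a, b) \<longleftrightarrow> Q a \<noteq> Q b) \<longrightarrow> even (card {e \<in> Z. R e}))"
proof -
  let ?E = "A \<union> A\<inverse>"
  have l3: "3 \<le> l" and len: "length us = Suc l" and st: "\<And>i. i < l \<Longrightarrow> (us ! i, us ! Suc i) \<in> ?E"
    and closed: "last us = hd us" and dist: "distinct (butlast us)"
    using c by (auto simp: cycle_def walk_def)
  have us_l: "us ! l = us ! 0"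
    using closed len by (metis diff_Suc_1 hd_conv_nth last_conv_nth length_0_conv nat.distinct(1))
  have inj: "i = j" if "us ! i = us ! j" "i < l" "j < l" for i j
    using that dist len nth_butlast[of i us] nth_butlast[of j us]
    by (metis diff_Suc_1 length_butlast nth_eq_iff_index_eq)
  define ed where "ed = (\<lambda>i. if (us ! i, us ! Suc i) \<in> A then (us ! i, us ! Suc i) else (us ! Suc i, us ! i))"
  define Z where "Z = ed ` {..<l}"
  have inj_lt: "ed i \<noteq> ed j" if "i < j" "j < l" for i j
  proof
    assume eq: "ed i = ed j"
    have "us ! i \<noteq> us ! j" using inj[of i j] that by auto
    then have 1: "us ! i = us ! Suc j" "us ! Suc i = us ! j"
      using eq by (auto simp: ed_def split: if_splits)
    show False
    proof (cases "Suc j < l")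
      case True
      then show ?thesis using inj[of i "Suc j"] 1 that by auto
    next
      case False
      \<comment> \<open>At the closing edge a repetition would force \<open>l = 2\<close>, which
        \<open>3 \<le> l\<close> excludes.\<close>
      then have jl: "Suc j = l" using that by simp
      then have "us ! i = us ! 0" using 1 us_l by simp
      then have "i = 0" using inj[of i 0] that by auto
      then have "Suc 0 = j" using 1(2) inj[of "Suc 0" j] that l3 by auto
      then show False using jl l3 by simp
    qed
  qed
  have inj_ed: "inj_on ed {..<l}"
  proof (rule inj_onI)
    fix i j assume "i \<in> {..<l}" "j \<in> {..<l}" "ed i = ed j"
    then show "i = j" using inj_lt[of i j] inj_lt[of j i] by (cases i j rule: linorder_cases) auto
  qed
  have sub: "Z \<subseteq> A" using st by (auto simp: Z_def ed_def)
  have "card Z = l" using inj_ed by (simp add: Z_def card_image)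
  moreover have "even (card {e \<in> Z. R e})"
    if R: "\<And>a b. (a, b) \<in> A \<Longrightarrow> R (a, b) \<longleftrightarrow> Q a \<noteq> Q b" for R and Q :: "_ \<Rightarrow> bool"
  proof -
    have "{e \<in> Z. R e} = ed ` {i. i < l \<and> Q (us ! i) \<noteq> Q (us ! Suc i)}"
    proof -
      have "R (ed i) \<longleftrightarrow> Q (us ! i) \<noteq> Q (us ! Suc i)" if "i < l" for i
        using st[OF that] R by (auto simp: ed_def)
      then show ?thesis by (auto simp: Z_def)
    qed
    moreover have "inj_on ed {i. i < l \<and> Q (us ! i) \<noteq> Q (us ! Suc i)}"
      by (rule inj_on_subset[OF inj_ed]) auto
    ultimately have "card {e \<in> Z. R e} = card {i. i < l \<and> Q (us ! i) \<noteq> Q (us ! Suc i)}"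
      by (simp add: card_image)
    \<comment> \<open>Once around a closed walk, the side changes an even number of times.\<close>
    then show ?thesis using odd_changes[of l "\<lambda>i. Q (us ! i)"] us_l by simp
  qed
  ultimately show ?thesis using sub by blast
qed

text \<open>Cycles are peeled off one at a time: removing the edges of a cycle keeps all degrees
  even, and each removed piece has a length divisible by \<open>d\<close>.\<close>

lemma even_degree_card_dvd:
  assumes cyc: "\<And>l us. cycle (D \<union> D\<inverse>) l us \<Longrightarrow> d dvd l" and D: "oriented D"
    and "A \<subseteq> D" "\<And>w. \<not> degree_odd A w"
  shows "d dvd card A"
  using assms(3,4)
proof (induction "card A" arbitrary: A rule: less_induct)
  case less
  have A: "oriented A" by (rule oriented_subset[OF D less.prems(1)])
  then have fin: "finite A" by (simp add: oriented_def)
  show ?case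
  proof (cases "A = {}")
    case False
    obtain l us where c: "cycle (A \<union> A\<inverse>) l us"
      using even_degree_cycle[OF A less.prems(2) False] by blast
    then have "cycle (D \<union> D\<inverse>) l us"
      using less.prems(1) by (auto simp: cycle_def walk_def)
    then have dl: "d dvd l" by (rule cyc)
    obtain Z where Z: "Z \<subseteq> A" "card Z = l" and ev:
      "\<And>R (Q :: _ \<Rightarrow> bool). \<forall>a b. (a, b) \<in> A \<longrightarrow> R (a, b) \<longleftrightarrow> Q a \<noteq> Q b \<Longrightarrow> even (card {e \<in> Z. R e})"
      using cycle_edges[OF A c] by blast
    have finZ: "finite Z" using Z fin finite_subset by blast
    have "even (card {e \<in> Z. fst e = w \<or> snd e = w})" for w
      by (rule ev[of _ "\<lambda>a. a = w"]) (use oriented_irrefl[OF A] in auto)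
    then have "\<not> degree_odd Z w" for w by (simp add: degree_odd_def)
    then have "\<not> degree_odd (A - Z) w" for w
      using degree_odd_symdiff[OF fin finZ, of w] less.prems(2)[of w] Z(1) by (simp add: Diff_eq_empty_iff[THEN iffD2])
    moreover have "card (A - Z) + l = card A" using Z fin by (metis card_Diff_subset card_mono finZ le_add_diff_inverse2)
    moreover have "3 \<le> l" using c by (simp add: cycle_def)
    ultimately have "d dvd card (A - Z)"
      by (intro less.hyps) (use less.prems(1) in auto)
    then show ?thesis using dl \<open>card (A - Z) + l = card A\<close> by (metis dvd_add)
  qed simp
qed

section \<open>Divisibility of sums over classes of equal sets\<close>

lemma sum_dvd_by_class:
  fixes \<psi> :: "'b \<Rightarrow> nat"
  assumes "finite S" "\<And>g. g \<in> S \<Longrightarrow> d dvd 2 * card {h \<in> S. N h = N g}"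
  shows "d dvd (\<Sum>g\<in>S. 2 * \<psi> (N g))"
proof -
  have "(\<Sum>g\<in>S. 2 * \<psi> (N g)) = (\<Sum>y\<in>N ` S. \<Sum>h | h \<in> S \<and> N h = y. 2 * \<psi> (N h))"
    by (rule sum.image_gen[OF assms(1)])
  also have "\<dots> = (\<Sum>y\<in>N ` S. 2 * card {h \<in> S. N h = y} * \<psi> y)"
    by (intro sum.cong) auto
  also have "d dvd \<dots>"
  proof (rule dvd_sum)
    fix y assume "y \<in> N ` S"
    then show "d dvd 2 * card {h \<in> S. N h = y} * \<psi> y" using assms(2) by (auto intro: dvd_mult2)
  qed
  finally show ?thesis .
qed

text \<open>Moebius inversion over the preorder \<open>N g \<subseteq> N h\<close>.\<close>

lemma class_dvd:
  fixes N :: "'a \<Rightarrow> 'b set"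
  assumes fin: "finite S" "\<And>g. g \<in> S \<Longrightarrow> finite (N g)"
    and up: "\<And>g. g \<in> S \<Longrightarrow> d dvd 2 * card {h \<in> S. N g \<subseteq> N h}"
    and g: "g \<in> S"
  shows "d dvd 2 * card {h \<in> S. N h = N g}"
proof -
  define b where "b = card (\<Union>(N ` S))"
  have bound: "card (N h) \<le> b" if "h \<in> S" for h
    unfolding b_def using that fin by (intro card_mono) auto
  show ?thesis
    using g
  \<comment> \<open>Largest sets first: the elements strictly above \<open>g\<close> fall into whole
    classes treated before, and removing them from the up-set of \<open>g\<close> leaves its
    class.\<close>
  proof (induction "b - card (N g)" arbitrary: g rule: less_induct)
    case less
    let ?U = "{h \<in> S. N g \<subset> N h}"
    have "d dvd 2 * card {h' \<in> ?U. N h' = N h}" if h: "h \<in> ?U" for h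
    proof -
      have "card (N g) < card (N h)" using h fin by (intro psubset_card_mono) auto
      then have "b - card (N h) < b - card (N g)" using bound[of h] h by auto
      then have "d dvd 2 * card {h' \<in> S. N h' = N h}" using less.hyps h by blast
      moreover have "{h' \<in> ?U. N h' = N h} = {h' \<in> S. N h' = N h}" using h by auto
      ultimately show ?thesis by simp
    qed
    then have "d dvd (\<Sum>h\<in>?U. 2 * (\<lambda>_. 1) (N h))"
      by (rule sum_dvd_by_class[rotated]) (assumption, rule finite_subset[OF _ fin(1)], auto)
    then have "d dvd 2 * card ?U" by (simp add: mult.commute)
    moreover have "card {h \<in> S. N g \<subseteq> N h} = card {h \<in> S. N h = N g} + card ?U"
      by (subst card_Un_disjoint[symmetric]) (use fin(1) in \<open>auto intro: arg_cong[of _ _ card]\<close>)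
    ultimately show ?case
      using up[OF less.prems] by (simp add: distrib_left dvd_add_left_iff)
  qed
qed

section \<open>Tree paths in a spanning forest\<close>

locale forest =
  fixes D T :: "('a \<times> 'a) set"
  assumes D: "oriented D" and TD: "T \<subseteq> D"
    and span: "(u, v) \<in> D \<Longrightarrow> conn T u v"
    and acyc: "(x, y) \<in> T \<Longrightarrow> \<not> conn (T - {(x, y)}) x y"
begin

definition sep :: "'a \<times> 'a \<Rightarrow> 'a \<Rightarrow> 'a \<Rightarrow> bool" where
  "sep g u v \<longleftrightarrow> conn T u v \<and> \<not> conn (T - {g}) u v"

text \<open>Defining the path by separating edges avoids choosing a walk, and it is the form that a
  reachability query can express.\<close>

definition path :: "'a \<Rightarrow> 'a \<Rightarrow> ('a \<times> 'a) set" where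
  "path u v = {g \<in> T. sep g u v}"

abbreviation tree_path :: "'a \<times> 'a \<Rightarrow> ('a \<times> 'a) set" where
  "tree_path e \<equiv> path (fst e) (snd e)"

lemma finite_D: "finite D" and finite_T: "finite T"
  using D TD finite_subset by (auto simp: oriented_def)

lemma finite_path: "finite (path u v)"
  using finite_T by (simp add: path_def)

lemma path_subset: "path u v \<subseteq> T"
  by (auto simp: path_def)

lemma sep_sym: "sep g u v \<longleftrightarrow> sep g v u"
  unfolding sep_def using conn_sym by metis

text \<open>Without the tree edge its component falls into the part of \<open>x\<close> and the part
  of \<open>y\<close>, and the edge separates exactly the vertices in different parts. As a
  comparison of sides, separation is additive, which gives \<open>sep_xor\<close>.\<close>

lemma sep_side:
  assumes g: "(x, y) \<in> T" and c: "conn T u v"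
  shows "sep (x, y) u v \<longleftrightarrow> conn (T - {(x, y)}) x u \<noteq> conn (T - {(x, y)}) x v"
proof -
  let ?c = "conn (T - {(x, y)})"
  have "conn (insert (x, y) (T - {(x, y)})) u v" using c g by (simp add: insert_absorb)
  then have "?c u v \<or> ?c u x \<and> ?c y v \<or> ?c u y \<and> ?c x v" by (rule conn_insert)
  then consider "?c u v" | "?c u x" "?c y v" | "?c u y" "?c x v" by blast
  then show ?thesis
  proof cases
    case 1
    then have "?c x u \<longleftrightarrow> ?c x v" using conn_sym conn_trans by metis
    then show ?thesis using 1 by (simp add: sep_def)
  next
    case 2
    then have "?c x u" "\<not> ?c x v" using acyc[OF g] conn_sym conn_trans by metis+
    moreover from this have "\<not> ?c u v" using conn_trans by metis
    ultimately show ?thesis using c by (simp add: sep_def)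
  next
    case 3
    then have "?c x v" "\<not> ?c x u" using acyc[OF g] conn_sym conn_trans by metis+
    moreover from this have "\<not> ?c u v" using conn_sym conn_trans by metis
    ultimately show ?thesis using c by (simp add: sep_def)
  qed
qed

lemma sep_xor:
  assumes "g \<in> T" "conn T u v" "conn T v w"
  shows "sep g u w \<longleftrightarrow> sep g u v \<noteq> sep g v w"
proof -
  obtain x y where g: "g = (x, y)" by (cases g)
  have "conn T u w" using assms(2,3) by (rule conn_trans)
  then show ?thesis using assms unfolding g by (auto simp: sep_side)
qed

lemma path_edge: "(x, y) \<in> T \<Longrightarrow> path x y = {(x, y)}"
proof -
  assume xy: "(x, y) \<in> T"
  have "sep g x y \<longleftrightarrow> g = (x, y)" for g
  proof (cases "g = (x, y)")
    case True
    then show ?thesis using acyc[OF xy] conn_edge[OF xy] by (simp add: sep_def)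
  next
    case False
    then have "conn (T - {g}) x y" using xy by (intro conn_edge) auto
    then show ?thesis using False by (simp add: sep_def)
  qed
  then show ?thesis using xy by (auto simp: path_def)
qed

lemma path_sym: "path u v = path v u"
  unfolding path_def using sep_sym by auto

lemma path_symdiff:
  assumes "conn T u v" "conn T v w"
  shows "path u w = path u v - path v w \<union> (path v w - path u v)"
  using sep_xor[OF _ assms] unfolding path_def by auto

lemma degree_odd_singleton: "x \<noteq> y \<Longrightarrow> degree_odd {(x, y)} w \<longleftrightarrow> (w = x) \<noteq> (w = y)"
proof -
  assume "x \<noteq> y"
  have "{e \<in> {(x, y)}. fst e = w \<or> snd e = w} = (if w = x \<or> w = y then {(x, y)} else {})" by auto
  then show ?thesis using \<open>x \<noteq> y\<close> unfolding degree_odd_def by auto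
qed

text \<open>Each step of a tree connection toggles one edge in the path, hence the parity at the two
  ends of that edge.\<close>

lemma degree_odd_path:
  assumes "conn T u v"
  shows "degree_odd (path u v) w \<longleftrightarrow> (w = u) \<noteq> (w = v)"
  using assms[unfolded conn_def]
proof (induction rule: rtrancl_induct)
  case base
  show ?case by (simp add: path_def sep_def degree_odd_def)
next
  case (step y z)
  have c: "conn T u y" using step.hyps(1) by (simp add: conn_def)
  have ne: "y \<noteq> z" using step.hyps(2) oriented_irrefl[OF D] TD by auto
  have yz: "conn T y z" using step.hyps(2) conn_edge conn_sym by fast
  have "path y z = {(y, z)} \<or> path z y = {(z, y)}"
    using step.hyps(2) path_edge[of y z] path_edge[of z y] by auto
  then have "path y z = {(y, z)} \<or> path y z = {(z, y)}"
    by (subst (2) path_sym)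
  then have "degree_odd (path y z) w \<longleftrightarrow> (w = y) \<noteq> (w = z)"
  proof
    assume p: "path y z = {(y, z)}"
    show ?thesis unfolding p by (rule degree_odd_singleton[OF ne])
  next
    assume p: "path y z = {(z, y)}"
    show ?thesis unfolding p using degree_odd_singleton[OF ne[symmetric], of w] by blast
  qed
  then show ?case
    unfolding path_symdiff[OF c yz] degree_odd_symdiff[OF finite_path finite_path] using step.IH by blast
qed

definition fundamental :: "'a \<times> 'a \<Rightarrow> ('a \<times> 'a) set" where
  "fundamental e = insert e (tree_path e)"

text \<open>The edge \<open>e\<close> cancels the odd degree at both ends of its tree path.\<close>

lemma degree_odd_fundamental:
  assumes "e \<in> D - T"
  shows "\<not> degree_odd (fundamental e) w"
proof -
  obtain u v where e: "e = (u, v)" by (cases e)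
  have ne: "u \<noteq> v" using assms oriented_irrefl[OF D] e by auto
  have "fundamental e = {e} - tree_path e \<union> (tree_path e - {e})"
    using assms path_subset[of u v] by (auto simp: fundamental_def e)
  then show ?thesis
    using degree_odd_symdiff[of "{e}" "tree_path e" w] degree_odd_path[of u v w] span[of u v]
      degree_odd_singleton[OF ne, of w] assms finite_path by (simp add: e)
qed

section \<open>Cuts of tree edges do not cross: a Helly property\<close>

lemma conn_avoid:
  assumes "(x, y) \<in> T" "(x, y) \<noteq> a" "conn (T - {a}) p q" "\<not> conn (T - {a}) p x"
  shows "conn (T - {(x, y)}) p q"
proof -
  have b: "(x, y) \<in> T - {a}" using assms by simp
  let ?A = "T - {a} - {(x, y)}"
  have "conn (insert (x, y) ?A) p q" using assms(3) b by (simp add: insert_absorb)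
  \<comment> \<open>A connection through the edge would join \<open>p\<close> to \<open>x\<close> or
    \<open>y\<close>, in either case to \<open>x\<close>, because the edge survives the removal of
    \<open>a\<close>.\<close>
  then have "conn ?A p q \<or> conn ?A p x \<or> conn ?A p y" using conn_insert by metis
  moreover have "\<not> conn ?A p x" using assms(4) conn_mono[of ?A p x "T - {a}"] by auto
  moreover have "\<not> conn ?A p y"
    using assms(4) conn_mono[of ?A p y "T - {a}"] conn_sym[OF conn_edge[OF b]] conn_trans by (metis Diff_subset)
  ultimately have "conn ?A p q" by blast
  then show ?thesis by (rule conn_mono) auto
qed

text \<open>\<open>a\<close> has \<open>p\<close>, \<open>q\<close> on one side and
  \<open>r\<close>, \<open>s\<close> on the other. The edge \<open>b\<close> lies on one of these
  sides, so it separates nothing within the other.\<close>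

lemma noncrossing:
  assumes "a \<in> T" "b \<in> T" "a \<noteq> b" "conn T p q" "conn T p r" "conn T r s"
    and "\<not> sep a p q" "sep a p r" "\<not> sep a r s" "sep b p q" "sep b r s"
  shows False
proof -
  obtain x y where b: "b = (x, y)" by (cases b)
  have 1: "conn (T - {a}) p q" "\<not> conn (T - {a}) p r" "conn (T - {a}) r s"
    using assms unfolding sep_def by auto
  have "\<not> conn (T - {a}) p x \<or> \<not> conn (T - {a}) r x" using 1(2) conn_sym conn_trans by metis
  then show False
    using conn_avoid[of x y a p q] conn_avoid[of x y a r s] 1 assms unfolding sep_def b by auto
qed

text \<open>The ends with index 0 lie on one side of \<open>g\<close>, those with index 1 on the
  other. Each of \<open>a\<close>, \<open>b\<close>, \<open>c\<close> lies wholly on one side of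
  \<open>g\<close>, so two of them share a side; four of the ends then realise all combinations of
  sides of these two, contrary to \<open>noncrossing\<close>.\<close>

lemma helly_oriented:
  assumes T: "g \<in> T" "a \<in> T" "b \<in> T" "c \<in> T"
    and g: "sep g e0 e1" "sep g f0 f1" "sep g h0 h1" "\<not> sep g e0 f0" "\<not> sep g e0 h0"
    and conn: "conn T e0 f0" "conn T e0 h0"
    and a: "sep a e0 e1" "sep a f0 f1" "\<not> sep a h0 h1"
    and b: "sep b e0 e1" "\<not> sep b f0 f1" "sep b h0 h1"
    and c: "\<not> sep c e0 e1" "sep c f0 f1" "sep c h0 h1"
  shows False
proof -
  \<comment> \<open>The side of \<open>t\<close>, normalised so that \<open>e0\<close> gets
    False.\<close>
  define col where "col = (\<lambda>t v. sep t e0 v)"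
  define W where "W = {e0, e1, f0, f1, h0, h1}"
  have W: "conn T e0 v" if "v \<in> W" for v
    using that g(1-3) conn conn_trans unfolding W_def sep_def by auto
  have col: "sep t u v \<longleftrightarrow> col t u \<noteq> col t v" if "t \<in> T" "u \<in> W" "v \<in> W" for t u v
    using sep_xor[OF that(1) conn_sym[OF W[OF that(2)]] W[OF that(3)]] sep_sym[of t e0 u]
    unfolding col_def by blast
  have mem: "e0 \<in> W" "e1 \<in> W" "f0 \<in> W" "f1 \<in> W" "h0 \<in> W" "h1 \<in> W" by (auto simp: W_def)
  have e0: "\<not> col t e0" for t by (simp add: col_def sep_def)
  have ne: "a \<noteq> g" "b \<noteq> g" "c \<noteq> g" "a \<noteq> b" "a \<noteq> c" "b \<noteq> c" using g a b c by auto
  have N: "\<not> (col s p = col s q \<and> col s p \<noteq> col s r \<and> col s r = col s u \<and> col t p \<noteq> col t q \<and> col t r \<noteq> col t u)"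
    if "s \<in> T" "t \<in> T" "s \<noteq> t" "p \<in> W" "q \<in> W" "r \<in> W" "u \<in> W" for s t p q r u
    using noncrossing[of s t p q r u] that col W conn_sym conn_trans by metis
  have gc: "col g e0 = col g f0" "col g e0 = col g h0" "col g e0 \<noteq> col g e1" "col g f0 \<noteq> col g f1" "col g h0 \<noteq> col g h1"
    using g col[OF T(1)] mem by blast+
  \<comment> \<open>If the colours of \<open>t\<close> varied among the ends on both sides of
    \<open>g\<close>, then \<open>t\<close> and \<open>g\<close> would cross.\<close>
  have const: "col t e0 = col t f0 \<and> col t e0 = col t h0 \<or> col t e1 = col t f1 \<and> col t e1 = col t h1"
    if t: "t \<in> T" "t \<noteq> g" for t
  proof (rule ccontr)
    assume n: "\<not> ?thesis"
    then obtain q where q: "q = f0 \<or> q = h0" "col t e0 \<noteq> col t q" by blast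
    from n obtain u where u: "u = f1 \<or> u = h1" "col t e1 \<noteq> col t u" by blast
    have "q \<in> W" "u \<in> W" using q u mem by auto
    moreover have "col g e0 = col g q" "col g e0 \<noteq> col g e1" "col g e1 = col g u" using q u gc by auto
    ultimately show False using N[of g t e0 q e1 u] T t mem q u by blast
  qed
  have A: "col a e0 \<noteq> col a e1" "col a f0 \<noteq> col a f1" "col a h0 = col a h1"
    and B: "col b e0 \<noteq> col b e1" "col b f0 = col b f1" "col b h0 \<noteq> col b h1"
    and C: "col c e0 = col c e1" "col c f0 \<noteq> col c f1" "col c h0 \<noteq> col c h1"
    using a b c col T mem by blast+
  \<comment> \<open>Three pairs among \<open>a\<close>, \<open>b\<close>, \<open>c\<close>, first
    for colours constant on the ends with index 0, then for colours constant on those with index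
    1.\<close>
  note X = N[OF T(2) T(3) ne(4) mem(2) mem(4) mem(6) mem(5)] N[OF T(2) T(4) ne(5) mem(2) mem(4) mem(5) mem(6)]
    N[OF T(3) T(4) ne(6) mem(2) mem(6) mem(3) mem(4)] N[OF T(2) T(3) ne(4) mem(1) mem(3) mem(5) mem(6)]
    N[OF T(2) T(4) ne(5) mem(1) mem(3) mem(5) mem(6)] N[OF T(3) T(4) ne(6) mem(1) mem(5) mem(3) mem(4)]
  show False
    using X const[OF T(2) ne(1)] const[OF T(3) ne(2)] const[OF T(4) ne(3)] A B C e0[of a] e0[of b] e0[of c]
    by argo
qed

lemma helly:
  assumes "g \<in> path e0 e1" "g \<in> path f0 f1" "g \<in> path h0 h1"
  shows "path e0 e1 \<inter> path f0 f1 \<subseteq> path h0 h1 \<or> path e0 e1 \<inter> path h0 h1 \<subseteq> path f0 f1 \<or>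
    path f0 f1 \<inter> path h0 h1 \<subseteq> path e0 e1"
proof (rule ccontr)
  assume "\<not> ?thesis"
  then obtain a b c where abc: "a \<in> path e0 e1" "a \<in> path f0 f1" "a \<notin> path h0 h1"
    "b \<in> path e0 e1" "b \<in> path h0 h1" "b \<notin> path f0 f1"
    "c \<in> path f0 f1" "c \<in> path h0 h1" "c \<notin> path e0 e1" by blast
  have g: "g \<in> T" "sep g e0 e1" "sep g f0 f1" "sep g h0 h1" using assms by (auto simp: path_def)
  obtain x y where xy: "g = (x, y)" by (cases g)
  have conn: "conn T e0 u" if "sep g u v" for u v
  proof -
    have "conn T x u \<or> conn T x v" if "sep g u v" for u v
      using sep_side[of x y u v] that g(1) conn_mono[of "T - {g}" x _ T] unfolding xy sep_def by auto
    then have "conn T x u" if "sep g u v" for u v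
      using that unfolding sep_def by (metis conn_sym conn_trans)
    from this[OF that] this[OF g(2)] show ?thesis using conn_sym conn_trans by metis
  qed
  \<comment> \<open>Paths are undirected, so the ends are swapped until the first ones lie on the
    side of \<open>e0\<close> with respect to \<open>g\<close>.\<close>
  define f where "f = (if sep g e0 f0 then (f1, f0) else (f0, f1))"
  define h where "h = (if sep g e0 h0 then (h1, h0) else (h0, h1))"
  have f: "path f0 f1 = path (fst f) (snd f)" and h: "path h0 h1 = path (fst h) (snd h)"
    using path_sym by (auto simp: f_def h_def)
  have fg: "sep g (fst f) (snd f)" "sep g (fst h) (snd h)"
    using assms f h by (auto simp: path_def)
  have "\<not> sep g e0 (fst f)" "\<not> sep g e0 (fst h)"
    using sep_xor[OF g(1) conn[OF g(3)], of f1] sep_xor[OF g(1) conn[OF g(4)], of h1] g(3,4)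
    unfolding f_def h_def sep_def by auto
  then show False
    using helly_oriented[of g a b c e0 e1 "fst f" "snd f" "fst h" "snd h"] g(1,2) fg conn[OF fg(1)] conn[OF fg(2)] abc
    unfolding f h by (auto simp: path_def)
qed

text \<open>By \<open>helly\<close>, among three paths through \<open>g\<close> two have the same
  intersection as all three, so a pair always suffices; its members may coincide.\<close>

lemma Inter_tree_paths:
  assumes "finite X" "X \<noteq> {}" "\<forall>e\<in>X. g \<in> tree_path e"
  shows "\<exists>e\<in>X. \<exists>f\<in>X. (\<Inter>i\<in>X. tree_path i) = tree_path e \<inter> tree_path f"
  using assms
proof (induction rule: finite_ne_induct)
  case (insert x X)
  then obtain e f where ef: "e \<in> X" "f \<in> X" "(\<Inter>i\<in>X. tree_path i) = tree_path e \<inter> tree_path f" by auto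
  then have I: "(\<Inter>i\<in>insert x X. tree_path i) = tree_path x \<inter> (tree_path e \<inter> tree_path f)" by simp
  have "tree_path e \<inter> tree_path f \<subseteq> tree_path x \<or> tree_path e \<inter> tree_path x \<subseteq> tree_path f \<or>
      tree_path f \<inter> tree_path x \<subseteq> tree_path e"
    using insert.prems ef by (intro helly[of g]) auto
  then have "tree_path x \<inter> (tree_path e \<inter> tree_path f) = tree_path e \<inter> tree_path f \<or>
    tree_path x \<inter> (tree_path e \<inter> tree_path f) = tree_path x \<inter> tree_path e \<or>
    tree_path x \<inter> (tree_path e \<inter> tree_path f) = tree_path x \<inter> tree_path f" by blast
  then show ?case unfolding I using ef(1,2) by blast
qed auto

section \<open>The divisibility criterion\<close>

definition balanced :: "nat \<Rightarrow> bool" where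
  "balanced d \<longleftrightarrow> (\<forall>e\<in>D - T. d dvd Suc (card (tree_path e)) \<and>
     (\<forall>f\<in>D - T. e \<noteq> f \<longrightarrow> d dvd 2 * card (tree_path e \<inter> tree_path f)))"

lemma card_fundamental: "e \<in> D - T \<Longrightarrow> card (fundamental e) = Suc (card (tree_path e))"
  unfolding fundamental_def using finite_path path_subset[of "fst e" "snd e"] by (subst card_insert_disjoint) auto

lemma balanced_if_cycles:
  assumes "\<And>l us. cycle (D \<union> D\<inverse>) l us \<Longrightarrow> d dvd l"
  shows "balanced d"
  unfolding balanced_def
proof (intro ballI conjI impI)
  have sub: "fundamental e \<subseteq> D" and fin: "finite (fundamental e)" if "e \<in> D - T" for e
    using that TD path_subset[of "fst e" "snd e"] finite_path by (auto simp: fundamental_def)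
  have dvd: "d dvd Suc (card (tree_path e))" if "e \<in> D - T" for e
    using even_degree_card_dvd[OF assms D sub[OF that] degree_odd_fundamental[OF that]]
    by (simp add: card_fundamental[OF that])
  fix e assume e: "e \<in> D - T"
  then show "d dvd Suc (card (tree_path e))" by (rule dvd)
  fix f assume f: "f \<in> D - T" and ne: "e \<noteq> f"
  \<comment> \<open>Distinct fundamental cycles share only tree edges, so this set has the sum of
    their lengths minus \<open>2 * card (tree_path e \<inter> tree_path f)\<close> elements.\<close>
  let ?S = "fundamental e - fundamental f \<union> (fundamental f - fundamental e)"
  have "d dvd card ?S"
    using sub[OF e] sub[OF f] degree_odd_symdiff[OF fin[OF e] fin[OF f]] degree_odd_fundamental[OF e] degree_odd_fundamental[OF f]
    by (intro even_degree_card_dvd[OF assms D]) auto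
  moreover have "fundamental e \<inter> fundamental f = tree_path e \<inter> tree_path f"
    using e f ne path_subset by (auto simp: fundamental_def)
  then have "card ?S + 2 * card (tree_path e \<inter> tree_path f) = Suc (card (tree_path e)) + Suc (card (tree_path f))"
    using card_symdiff[OF fin[OF e] fin[OF f]] card_fundamental[OF e] card_fundamental[OF f] by simp
  ultimately show "d dvd 2 * card (tree_path e \<inter> tree_path f)"
    using dvd[OF e] dvd[OF f] by (metis dvd_add dvd_add_right_iff)
qed

lemma cycles_if_balanced:
  assumes bal: "balanced d" and c: "cycle (D \<union> D\<inverse>) l us"
  shows "d dvd l"
proof -
  obtain C where C: "C \<subseteq> D" "card C = l" and ev:
    "\<And>R (Q :: _ \<Rightarrow> bool). \<forall>a b. (a, b) \<in> D \<longrightarrow> R (a, b) \<longleftrightarrow> Q a \<noteq> Q b \<Longrightarrow> even (card {e \<in> C. R e})"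
    using cycle_edges[OF D c] by blast
  have finC: "finite C" using C finite_D finite_subset by blast
  \<comment> \<open>Removing \<open>g\<close> from the forest defines a cut; the edges of
    \<open>D\<close> across it are those whose tree path contains \<open>g\<close>.\<close>
  have even_cut: "even (card {e \<in> C. g \<in> tree_path e})" if "g \<in> T" for g
  proof -
    obtain x y where g: "g = (x, y)" by (cases g)
    have "\<forall>a b. (a, b) \<in> D \<longrightarrow> g \<in> tree_path (a, b) \<longleftrightarrow> conn (T - {(x, y)}) x a \<noteq> conn (T - {(x, y)}) x b"
      using that span sep_side unfolding g path_def by auto
    then show ?thesis by (rule ev)
  qed
  define F where "F = C - T"
  \<comment> \<open>\<open>N\<close> refers to all non-tree edges, not only to those of the cycle,
    so that its classes are controlled by \<open>balanced\<close> alone.\<close>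
  define N where "N = (\<lambda>g. {e \<in> D - T. g \<in> tree_path e})"
  have finF: "finite F" using finC by (simp add: F_def)
  have finN: "finite (N g)" for g using finite_D by (simp add: N_def)
  have FN: "{e \<in> F. g \<in> tree_path e} = F \<inter> N g" for g using C by (auto simp: F_def N_def)
  then have FN': "F \<inter> N g = {e \<in> C - T. g \<in> tree_path e}" for g by (auto simp: F_def)
  \<comment> \<open>The path of a tree edge is that edge itself, so \<open>g\<close> is the only
    tree edge that \<open>even_cut\<close> can count. Hence \<open>card (F \<inter> N g)\<close> is
    odd iff \<open>g\<close> is in \<open>C\<close>.\<close>
  have split: "card (F \<inter> N g) = of_bool (g \<in> C) + 2 * (card (F \<inter> N g) div 2)" if g: "g \<in> T" for g
  proof -
    have "tree_path e = {e}" if "e \<in> T" for e using that path_edge[of "fst e" "snd e"] by simp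
    then have "{e \<in> C. g \<in> tree_path e} = (if g \<in> C then insert g (F \<inter> N g) else F \<inter> N g)"
      using g FN' by auto
    then have "even (card (F \<inter> N g) + of_bool (g \<in> C))"
      using even_cut[OF g] g finF by (auto simp: F_def split: if_splits)
    then have "card (F \<inter> N g) mod 2 = of_bool (g \<in> C)" by (cases "g \<in> C") (auto simp: odd_iff_mod_2_eq_one)
    then show ?thesis by (metis add.commute mult_div_mod_eq)
  qed
  have "(\<Sum>e\<in>F. Suc (card (tree_path e))) = card F + (\<Sum>e\<in>F. \<Sum>g\<in>T. of_bool (g \<in> tree_path e))"
  proof -
    have "card (tree_path e) = (\<Sum>g\<in>T. of_bool (g \<in> tree_path e))" for e
    proof -
      have "T \<inter> {g. g \<in> tree_path e} = tree_path e" using path_subset by auto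
      then show ?thesis using finite_T by (simp add: of_bool_def sum.If_cases)
    qed
    then show ?thesis by (simp add: sum_Suc)
  qed
  also have "(\<Sum>e\<in>F. \<Sum>g\<in>T. of_bool (g \<in> tree_path e)) = (\<Sum>g\<in>T. \<Sum>e\<in>F. of_bool (g \<in> tree_path e) :: nat)"
    by (rule sum.swap)
  also have "\<dots> = (\<Sum>g\<in>T. card (F \<inter> N g))"
  proof (rule sum.cong[OF refl])
    fix g
    have "F \<inter> {e. g \<in> tree_path e} = F \<inter> N g" using FN[of g] by auto
    then show "(\<Sum>e\<in>F. of_bool (g \<in> tree_path e)) = card (F \<inter> N g)"
      using finF by (simp add: of_bool_def sum.If_cases)
  qed
  also have "\<dots> = (\<Sum>g\<in>T. of_bool (g \<in> C)) + (\<Sum>g\<in>T. 2 * (card (F \<inter> N g) div 2))"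
    unfolding sum.distrib[symmetric] by (rule sum.cong[OF refl split])
  also have "(\<Sum>g\<in>T. of_bool (g \<in> C)) = card (C \<inter> T)"
    using finite_T by (simp add: of_bool_def sum.If_cases Int_commute)
  finally have "(\<Sum>e\<in>F. Suc (card (tree_path e))) = l + (\<Sum>g\<in>T. 2 * (card (F \<inter> N g) div 2))"
    using card_Int_Diff[OF finC, of T] C(2) by (simp add: F_def)
  moreover have "d dvd (\<Sum>e\<in>F. Suc (card (tree_path e)))"
    using bal C(1) by (intro dvd_sum) (auto simp: balanced_def F_def)
  moreover have "d dvd (\<Sum>g\<in>T. 2 * (card (F \<inter> N g) div 2))"
  proof -
    \<comment> \<open>Dropping tree edges used by fewer than two non-tree edges loses only zero
      terms, thanks to \<open>div 2\<close>. For a single edge, \<open>balanced\<close> would not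
      make \<open>2 * card (tree_path e)\<close> divisible.\<close>
    define S where "S = {g \<in> T. 2 \<le> card (N g)}"
    have finS: "finite S" using finite_T by (simp add: S_def)
    have "(\<Sum>g\<in>T. 2 * (card (F \<inter> N g) div 2)) = (\<Sum>g\<in>S. 2 * (card (F \<inter> N g) div 2))"
    proof (rule sum.mono_neutral_right)
      show "\<forall>g\<in>T - S. 2 * (card (F \<inter> N g) div 2) = 0"
      proof
        fix g assume "g \<in> T - S"
        then have "card (N g) < 2" by (auto simp: S_def)
        moreover have "card (F \<inter> N g) \<le> card (N g)" by (rule card_mono[OF finN]) auto
        ultimately show "2 * (card (F \<inter> N g) div 2) = 0" by simp
      qed
    qed (use finite_T in \<open>auto simp: S_def\<close>)
    also have "d dvd \<dots>"
    proof (rule sum_dvd_by_class[OF finS, of d N "\<lambda>X. card (F \<inter> X) div 2"], rule class_dvd[OF finS finN])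
      fix g assume g: "g \<in> S"
      have ne: "N g \<noteq> {}" using g by (auto simp: S_def)
      have "{h \<in> S. N g \<subseteq> N h} = {h \<in> T. N g \<subseteq> N h}"
        using g card_mono[OF finN] by (auto simp: S_def intro: order_trans)
      also have "\<dots> = (\<Inter>e\<in>N g. tree_path e)"
        using ne by (auto simp: N_def path_def)
      finally have up: "{h \<in> S. N g \<subseteq> N h} = (\<Inter>e\<in>N g. tree_path e)" .
      obtain e f where ef: "e \<in> N g" "f \<in> N g" "(\<Inter>e\<in>N g. tree_path e) = tree_path e \<inter> tree_path f"
        using Inter_tree_paths[OF finN ne, of g] by (auto simp: N_def)
      \<comment> \<open>The pair may be a single edge taken twice; then any other member of
        \<open>N g\<close> can be the partner, since its path contains the whole
        intersection.\<close>
      obtain f' where f': "f' \<in> N g" "e \<noteq> f'" "(\<Inter>e\<in>N g. tree_path e) = tree_path e \<inter> tree_path f'"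
      proof (cases "e = f")
        case True
        have "N g \<noteq> {e}" using g by (auto simp: S_def)
        then obtain f' where "f' \<in> N g" "f' \<noteq> e" using ef(1) by blast
        moreover have "(\<Inter>e\<in>N g. tree_path e) \<subseteq> tree_path f'" using \<open>f' \<in> N g\<close> by auto
        ultimately show thesis using ef(3) True that by blast
      qed (use ef that in blast)
      show "d dvd 2 * card {h \<in> S. N g \<subseteq> N h}"
        unfolding up f'(3) using bal ef(1) f'(1,2) by (auto simp: balanced_def N_def)
    qed
    finally show ?thesis .
  qed
  ultimately show ?thesis using dvd_add_left_iff[of d "\<Sum>g\<in>T. 2 * (card (F \<inter> N g) div 2)" l] by argo
qed

theorem balanced_iff: "balanced d \<longleftrightarrow> (\<forall>l us. cycle (D \<union> D\<inverse>) l us \<longrightarrow> d dvd l)"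
  using balanced_if_cycles cycles_if_balanced by blast

end

section \<open>The lexicographically greedy spanning forest\<close>

definition greedy :: "('a::linorder \<times> 'a) set \<Rightarrow> ('a \<times> 'a) set" where
  "greedy D = {e \<in> D. \<not> conn {f \<in> D. f < e} (fst e) (snd e)}"

text \<open>Kruskal's argument: the ends of a rejected edge are joined by smaller edges, whose ends
  are joined in the forest by induction.\<close>

lemma greedy_span:
  assumes "finite D" "e \<in> D"
  shows "conn (greedy D) (fst e) (snd e)"
  using assms(2)
proof (induction "card {f \<in> D. f < e}" arbitrary: e rule: less_induct)
  case less
  show ?case
  proof (cases "e \<in> greedy D")
    case True
    then show ?thesis by (intro conn_edge) simp
  next
    case False
    then have "conn {f \<in> D. f < e} (fst e) (snd e)" using less.prems by (simp add: greedy_def)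
    moreover have small: "conn (greedy D) u v" if uv: "(u, v) \<in> {f \<in> D. f < e}" for u v
    proof -
      have "{f \<in> D. f < (u, v)} \<subset> {f \<in> D. f < e}"
        using uv less_trans[of _ "(u, v)" e] by blast
      then have "card {f \<in> D. f < (u, v)} < card {f \<in> D. f < e}"
        using assms(1) by (intro psubset_card_mono) auto
      then show ?thesis using less.hyps[of "(u, v)"] uv by auto
    qed
    ultimately show ?thesis by (rule conn_lift)
  qed
qed

text \<open>The largest edge of a cycle has its ends joined by smaller edges and is not greedy;
  hence the induction that adds edges in increasing order.\<close>

lemma greedy_acyclic:
  assumes "finite A" "A \<subseteq> greedy D" "(x, y) \<in> A"
  shows "\<not> conn (A - {(x, y)}) x y"
  using assms
proof (induction A arbitrary: x y rule: finite_linorder_max_induct)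
  case (insert f A)
  obtain a b where f: "f = (a, b)" by (cases f)
  have new: "\<not> conn A a b"
  proof
    assume "conn A a b"
    then have "conn {e \<in> D. e < f} a b"
      by (rule conn_mono) (use insert in \<open>auto simp: greedy_def\<close>)
    then show False using insert.prems(1) f by (auto simp: greedy_def)
  qed
  show ?case
  proof (cases "(x, y) = f")
    case True
    have "insert f A - {f} = A" using insert.hyps(2) by auto
    then show ?thesis using new True f by simp
  next
    case False
    then have xy: "(x, y) \<in> A" using insert.prems by auto
    let ?A = "A - {(x, y)}"
    have old: "\<not> conn ?A x y" by (rule insert.IH) (use insert.prems xy in auto)
    have eq: "insert f A - {(x, y)} = insert (a, b) ?A" using False f by auto
    show ?thesis
    proof
      assume "conn (insert f A - {(x, y)}) x y"
      then have "conn ?A x a \<and> conn ?A b y \<or> conn ?A x b \<and> conn ?A a y"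
        using conn_insert[of a b ?A x y] old unfolding eq by blast
      then have "conn A x a \<and> conn A b y \<or> conn A x b \<and> conn A a y"
        using conn_mono[of ?A _ _ A] by auto
      then have "conn A a b" using conn_edge[OF xy] conn_sym conn_trans by metis
      then show False using new by blast
    qed
  qed
qed simp

lemma forest_greedy:
  assumes "oriented D"
  shows "forest D (greedy D)"
proof
  have fin: "finite D" using assms by (simp add: oriented_def)
  show "greedy D \<subseteq> D" by (auto simp: greedy_def)
  show "conn (greedy D) u v" if "(u, v) \<in> D" for u v
    using greedy_span[OF fin that] by simp
  show "\<not> conn (greedy D - {(x, y)}) x y" if "(x, y) \<in> greedy D" for x y
    by (rule greedy_acyclic[OF _ subset_refl that]) (use fin in \<open>simp add: greedy_def\<close>)
qed (rule assms)

section \<open>Expressing the criterion\<close>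

text \<open>The lengths with residue outside \<open>S\<close> form an additive monoid that contains
  \<open>m\<close> and depends only on residues; \<open>d\<close> is its least positive element. For
  empty \<open>S\<close> this gives \<open>d = 1\<close>.\<close>

lemma closed_complement_multiples:
  fixes m :: nat and S :: "nat set"
  assumes m: "0 < m" and S: "0 \<notin> S"
    and closed: "\<And>p d1 d2. p \<in> S \<Longrightarrow> d1 < m \<Longrightarrow> d2 < m \<Longrightarrow> [d1 + d2 = p] (mod m) \<Longrightarrow> d1 \<in> S \<or> d2 \<in> S"
  obtains d where "0 < d" "\<And>l. l mod m \<in> S \<longleftrightarrow> \<not> d dvd l"
proof -
  define N where "N = {l. l mod m \<notin> S}"
  have add: "a + b \<in> N" if "a \<in> N" "b \<in> N" for a b
  proof (rule ccontr)
    assume "a + b \<notin> N"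
    then have "(a + b) mod m \<in> S" by (simp add: N_def)
    then have "a mod m \<in> S \<or> b mod m \<in> S"
      by (rule closed) (use m in \<open>auto simp: cong_def mod_add_eq\<close>)
    then show False using that by (auto simp: N_def)
  qed
  have mult: "k * a \<in> N" if "a \<in> N" for a k
    by (induction k) (use add[OF that] S in \<open>auto simp: N_def\<close>)
  have mN: "m \<in> N" using S by (simp add: N_def)
  define d where "d = (LEAST k. 0 < k \<and> k \<in> N)"
  have d: "0 < d" "d \<in> N"
    using LeastI[of "\<lambda>k. 0 < k \<and> k \<in> N" m] m mN unfolding d_def by auto
  have least: "d \<le> k" if "0 < k" "k \<in> N" for k
    unfolding d_def by (rule Least_le) (use that in auto)
  have "l \<in> N \<longleftrightarrow> d dvd l" for l
  proof
    assume "d dvd l"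
    then show "l \<in> N" using mult[OF d(2)] by (auto elim!: dvdE simp: mult.commute)
  next
    assume l: "l \<in> N"
    let ?k = "l div d"
    \<comment> \<open>Adding \<open>m - 1\<close> times \<open>?k * d\<close> imitates subtracting
      it; modulo \<open>m\<close> only \<open>l mod d\<close> is left.\<close>
    have "l + ?k * (m - 1) * d \<in> N" by (rule add[OF l mult[OF d(2)]])
    moreover have "l + ?k * (m - 1) * d = l mod d + ?k * d * m"
    proof -
      have "l + ?k * (m - 1) * d = l mod d + ?k * d + ?k * (m - 1) * d" by simp
      also have "\<dots> = l mod d + ?k * d * (1 + (m - 1))" by (simp add: algebra_simps)
      finally show ?thesis using m by simp
    qed
    ultimately have "l mod d \<in> N" by (simp add: N_def)
    then have "l mod d = 0" using least[of "l mod d"] d(1) by (meson mod_less_divisor not_gr0 not_le)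
    then show "d dvd l" by auto
  qed
  then show thesis using that[of d] d(1) by (auto simp: N_def)
qed

section \<open>Adjacency matrices as bit strings\<close>

lemma nth_concat_equal:
  assumes "\<And>u. length (f u) = n" "i < k" "j < n"
  shows "concat (map f [0..<k]) ! (i * n + j) = f i ! j"
  using assms(2)
proof (induction k)
  case (Suc k)
  have len: "length (concat (map f [0..<k])) = k * n" for k
    using assms(1) by (induction k) auto
  show ?case
  proof (cases "i = k")
    case True
    then show ?thesis using assms(1,3) by (simp add: nth_append len)
  next
    case False
    then have "i < k" using Suc.prems by simp
    have "i * n + j < (i + 1) * n" using assms(3) by simp
    also have "\<dots> \<le> k * n" using \<open>i < k\<close> by (intro mult_right_mono) auto
    finally show ?thesis using Suc.IH[OF \<open>i < k\<close>] by (simp add: nth_append len)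
  qed
qed simp

lemma length_adjacency_matrix: "length (adjacency_matrix n E) = n * n"
proof -
  have "length (concat (map (\<lambda>u. map (\<lambda>v. (u, v) \<in> E) [0..<n]) [0..<k])) = k * n" for k
    by (induction k) auto
  then show ?thesis by (simp add: adjacency_matrix_def)
qed

lemma nth_adjacency_matrix:
  "i < n \<Longrightarrow> j < n \<Longrightarrow> adjacency_matrix n E ! (i * n + j) \<longleftrightarrow> (i, j) \<in> E"
  unfolding adjacency_matrix_def by (subst nth_concat_equal) auto

lemma adjacency_matrix_eq_iff:
  "x = adjacency_matrix n E \<longleftrightarrow>
    length x = n * n \<and> (\<forall>i<n. \<forall>j<n. x ! (i * n + j) \<longleftrightarrow> (i, j) \<in> E)"
proof (intro iffI conjI)
  assume r: "length x = n * n \<and> (\<forall>i<n. \<forall>j<n. x ! (i * n + j) \<longleftrightarrow> (i, j) \<in> E)"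
  show "x = adjacency_matrix n E"
  proof (rule nth_equalityI)
    fix t assume "t < length x"
    then have t: "t < n * n" using r by simp
    then have n: "0 < n" by (cases n) auto
    have "t div n < n" "t mod n < n" using t n by (auto simp: less_mult_imp_div_less)
    then show "x ! t = adjacency_matrix n E ! t"
      using r nth_adjacency_matrix[of "t div n" n "t mod n" E] by (metis div_mult_mod_eq)
  qed (use r in \<open>simp add: length_adjacency_matrix\<close>)
qed (auto simp: length_adjacency_matrix nth_adjacency_matrix)

section \<open>The criterion as a query\<close>

definition Apply :: "(nat \<Rightarrow> nat) \<Rightarrow> expr \<Rightarrow> expr" where
  "Apply f a = Op (\<lambda>p q. f p) a a"

definition Neg :: "expr \<Rightarrow> expr" where
  "Neg a = Apply (\<lambda>p. of_bool (p = 0)) a"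

definition Conj :: "expr \<Rightarrow> expr \<Rightarrow> expr" where
  "Conj a b = Op (\<lambda>p q. of_bool (p \<noteq> 0 \<and> q \<noteq> 0)) a b"

definition Disj :: "expr \<Rightarrow> expr \<Rightarrow> expr" where
  "Disj a b = Op (\<lambda>p q. of_bool (p \<noteq> 0 \<or> q \<noteq> 0)) a b"

definition Exists :: "nat \<Rightarrow> expr \<Rightarrow> expr" where
  "Exists x a = Fold x (\<lambda>p q. of_bool (p \<noteq> 0 \<or> q \<noteq> 0)) a"

definition Count :: "nat \<Rightarrow> nat \<Rightarrow> expr \<Rightarrow> expr" where
  "Count d x a = Fold x (\<lambda>p q. (p + q) mod d) a"

definition LexLess :: "nat \<Rightarrow> nat \<Rightarrow> nat \<Rightarrow> nat \<Rightarrow> expr" where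
  "LexLess p q r s = Disj (Less p r) (Conj (Neg (Less r p)) (Less q s))"

definition Distinct :: "nat \<Rightarrow> nat \<Rightarrow> nat \<Rightarrow> nat \<Rightarrow> expr" where
  "Distinct p q r s = Disj (LexLess p q r s) (LexLess r s p q)"

text \<open>Each undirected edge is taken once, from its smaller to its larger vertex.\<close>

definition Up_edge :: "nat \<Rightarrow> nat \<Rightarrow> expr" where
  "Up_edge p q = Conj (Edge p q) (Less p q)"

definition Smaller_edge :: "nat \<Rightarrow> nat \<Rightarrow> nat \<Rightarrow> nat \<Rightarrow> expr" where
  "Smaller_edge p q r s = Conj (Up_edge p q) (LexLess p q r s)"

text \<open>Membership in the greedy forest. Both orders of the bound pair occur because
  \<open>Reach\<close> follows a directed relation.\<close>

definition Tree :: "nat \<Rightarrow> nat \<Rightarrow> expr" where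
  "Tree p q = Conj (Up_edge p q)
     (Neg (Reach 10 11 (Disj (Smaller_edge 10 11 p q) (Smaller_edge 11 10 p q)) p q))"

definition Other_tree :: "nat \<Rightarrow> nat \<Rightarrow> nat \<Rightarrow> nat \<Rightarrow> expr" where
  "Other_tree p q r s = Conj (Tree p q) (Distinct p q r s)"

text \<open>Removal of the edge must disconnect \<open>u\<close> and \<open>v\<close>. The variables
  8 and 9 have to differ from 10 and 11, which \<open>Tree\<close> binds inside.\<close>

definition On_path :: "nat \<Rightarrow> nat \<Rightarrow> nat \<Rightarrow> nat \<Rightarrow> expr" where
  "On_path x y u v = Conj (Tree x y)
     (Neg (Reach 8 9 (Disj (Other_tree 8 9 x y) (Other_tree 9 8 x y)) u v))"

definition Non_tree :: "nat \<Rightarrow> nat \<Rightarrow> expr" where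
  "Non_tree u v = Conj (Up_edge u v) (Neg (Tree u v))"

text \<open>
  Variables 2 to 5 range over the ends of two non-tree edges and 6, 7 over those of a tree edge; 8 to
  11 are bound by \<open>Reach\<close>.
\<close>

definition Unbalanced :: "nat \<Rightarrow> expr" where
  "Unbalanced d = Exists 2 (Exists 3 (Conj (Non_tree 2 3) (Disj
     (Apply (\<lambda>c. of_bool (\<not> d dvd Suc c)) (Count d 6 (Count d 7 (On_path 6 7 2 3))))
     (Exists 4 (Exists 5 (Conj (Conj (Non_tree 4 5) (Distinct 2 3 4 5))
       (Apply (\<lambda>c. of_bool (\<not> d dvd 2 * c))
         (Count d 6 (Count d 7 (Conj (On_path 6 7 2 3) (On_path 6 7 4 5)))))))))))"

text \<open>Detects matrices that encode no undirected graph: a missing reverse edge or a loop,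
  where equality of vertices means that both comparisons fail.\<close>

definition Asymmetric :: expr where
  "Asymmetric = Exists 2 (Exists 3 (Conj (Edge 2 3)
     (Disj (Neg (Edge 3 2)) (Conj (Neg (Less 2 3)) (Neg (Less 3 2))))))"

definition Query :: "nat \<Rightarrow> expr" where
  "Query d = Conj (Neg Asymmetric) (Unbalanced d)"

lemmas query_defs = Apply_def Neg_def Conj_def Disj_def Exists_def Count_def LexLess_def Distinct_def
  Up_edge_def Smaller_edge_def Tree_def Other_tree_def On_path_def Non_tree_def Unbalanced_def
  Asymmetric_def Query_def

lemma wf_Query: "wf_expr 12 {} (Query d)"
  unfolding query_defs by simp

section \<open>Meaning of the formulas\<close>

locale query =
  fixes K d n :: nat and E :: "nat \<Rightarrow> nat \<Rightarrow> bool"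
  assumes K: "2 \<le> K" "d \<le> K" "0 < d"
begin

abbreviation val :: "expr \<Rightarrow> (nat \<Rightarrow> nat) \<Rightarrow> nat" where
  "val \<equiv> value_of K n E"

lemma K_neq [simp]: "K \<noteq> 0" "K \<noteq> Suc 0"
  using K by auto

lemma val_Apply: "val (Apply f a) \<rho> = f (val a \<rho>) mod K"
  by (simp add: Apply_def)

lemma val_Neg [simp]: "val (Neg a) \<rho> = of_bool (val a \<rho> = 0)"
  by (simp add: Neg_def val_Apply)

lemma val_Conj [simp]: "val (Conj a b) \<rho> = of_bool (val a \<rho> \<noteq> 0 \<and> val b \<rho> \<noteq> 0)"
  by (simp add: Conj_def)

lemma val_Disj [simp]: "val (Disj a b) \<rho> = of_bool (val a \<rho> \<noteq> 0 \<or> val b \<rho> \<noteq> 0)"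
  by (simp add: Disj_def)

lemma val_Exists [simp]: "val (Exists x a) \<rho> = of_bool (\<exists>i<n. val a (\<rho>(x := i)) \<noteq> 0)"
proof -
  have "fold (\<lambda>i s. of_bool (s \<noteq> 0 \<or> val a (\<rho>(x := i)) \<noteq> 0) mod K) [0..<k] 0 =
      (of_bool (\<exists>i<k. val a (\<rho>(x := i)) \<noteq> 0) :: nat)" for k
    by (induction k) (auto simp: less_Suc_eq simp del: of_bool_eq_0_iff of_bool_eq_1_iff cong: conj_cong)
  then show ?thesis by (simp add: Exists_def)
qed

lemma val_Exists_nonzero: "val (Exists x a) \<rho> \<noteq> 0 \<longleftrightarrow> (\<exists>i<n. val a (\<rho>(x := i)) \<noteq> 0)"
  by simp

text \<open>Residues modulo \<open>d\<close> are below \<open>K\<close>, so the reduction modulo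
  \<open>K\<close> inside \<open>Fold\<close> does not disturb them.\<close>

lemma val_Count: "val (Count d x a) \<rho> = (\<Sum>i<n. val a (\<rho>(x := i))) mod d"
proof -
  have "p mod d mod K = p mod d" for p
    using K mod_less_divisor[of d p] by (intro mod_less) linarith
  then have "fold (\<lambda>i s. (s + val a (\<rho>(x := i))) mod d mod K) [0..<k] 0 = (\<Sum>i<k. val a (\<rho>(x := i))) mod d" for k
    by (induction k) (auto simp: mod_simps add.commute)
  then show ?thesis by (simp add: Count_def)
qed

lemma val_Count2:
  assumes "A \<subseteq> {..<n} \<times> {..<n}" "x \<noteq> y"
    and "\<And>i j. i < n \<Longrightarrow> j < n \<Longrightarrow> val a (\<rho>(x := i, y := j)) = of_bool ((i, j) \<in> A)"
  shows "val (Count d x (Count d y a)) \<rho> = card A mod d"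
proof -
  have "(\<Sum>i<n. \<Sum>j<n. of_bool ((i, j) \<in> A)) = (\<Sum>e\<in>{..<n} \<times> {..<n}. of_bool (e \<in> A) :: nat)"
    by (subst sum.cartesian_product) (simp add: case_prod_beta')
  also have "\<dots> = card A"
    using assms(1) by (simp add: of_bool_def sum.If_cases Int_absorb1)
  finally have "card A = (\<Sum>i<n. \<Sum>j<n. of_bool ((i, j) \<in> A))" by simp
  then show ?thesis using assms(3) by (simp add: val_Count mod_sum_eq)
qed

lemma val_LexLess [simp]: "val (LexLess p q r s) \<rho> = of_bool ((\<rho> p, \<rho> q) < (\<rho> r, \<rho> s))"
  by (auto simp: LexLess_def)

lemma val_Distinct [simp]: "val (Distinct p q r s) \<rho> = of_bool ((\<rho> p, \<rho> q) \<noteq> (\<rho> r, \<rho> s))"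
  by (auto simp: Distinct_def simp del: less_prod_simp)

definition D :: "(nat \<times> nat) set" where
  "D = {(i, j). i < j \<and> j < n \<and> E i j}"

abbreviation T :: "(nat \<times> nat) set" where
  "T \<equiv> greedy D"

lemma D_bound: "D \<subseteq> {..<n} \<times> {..<n}"
  by (auto simp: D_def)

lemma oriented_D: "oriented D"
  unfolding oriented_def using finite_subset[OF D_bound] by (auto simp: D_def)

sublocale forest D T
  by (rule forest_greedy[OF oriented_D])

lemma T_bound: "T \<subseteq> {..<n} \<times> {..<n}"
  using TD D_bound by blast

lemma val_Up_edge [simp]: "\<rho> q < n \<Longrightarrow> val (Up_edge p q) \<rho> = of_bool ((\<rho> p, \<rho> q) \<in> D)"
  by (auto simp: Up_edge_def D_def)

lemma val_Tree [simp]: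
  assumes "\<rho> p < n" "\<rho> q < n" "p < 10 \<and> q < 10"
  shows "val (Tree p q) \<rho> = of_bool ((\<rho> p, \<rho> q) \<in> T)"
proof -
  let ?X = "{f \<in> D. f < (\<rho> p, \<rho> q)}"
  have "{(i, j). i < n \<and> j < n \<and> val (Disj (Smaller_edge 10 11 p q) (Smaller_edge 11 10 p q)) (\<rho>(10 := i, 11 := j)) \<noteq> 0}
      = ?X \<union> ?X\<inverse>"
    using D_bound assms by (auto simp: Smaller_edge_def simp del: less_prod_simp)
  then have "val (Reach 10 11 (Disj (Smaller_edge 10 11 p q) (Smaller_edge 11 10 p q)) p q) \<rho> = of_bool (conn ?X (\<rho> p) (\<rho> q))"
    unfolding conn_def value_of.simps by simp
  then show ?thesis
    using assms unfolding Tree_def by (auto simp: greedy_def simp del: value_of.simps)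
qed

text \<open>Connectivity of the ends is assumed because, for ends in different trees, the formula
  holds for every tree edge whereas \<open>path\<close> is empty.\<close>

lemma val_On_path:
  assumes "\<rho> x < n" "\<rho> y < n" "x < 8" "y < 8" "u < 8" "v < 8" "conn T (\<rho> u) (\<rho> v)"
  shows "val (On_path x y u v) \<rho> = of_bool ((\<rho> x, \<rho> y) \<in> path (\<rho> u) (\<rho> v))"
proof -
  let ?X = "T - {(\<rho> x, \<rho> y)}"
  have "{(i, j). i < n \<and> j < n \<and> val (Disj (Other_tree 8 9 x y) (Other_tree 9 8 x y)) (\<rho>(8 := i, 9 := j)) \<noteq> 0}
      = ?X \<union> ?X\<inverse>"
    using T_bound assms by (auto simp: Other_tree_def)
  then have "val (Reach 8 9 (Disj (Other_tree 8 9 x y) (Other_tree 9 8 x y)) u v) \<rho> = of_bool (conn ?X (\<rho> u) (\<rho> v))"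
    unfolding conn_def value_of.simps by simp
  then show ?thesis
    using assms unfolding On_path_def path_def sep_def by (auto simp del: value_of.simps)
qed

lemma val_Non_tree [simp]:
  "\<rho> p < n \<Longrightarrow> \<rho> q < n \<Longrightarrow> p < 10 \<and> q < 10 \<Longrightarrow> val (Non_tree p q) \<rho> = of_bool ((\<rho> p, \<rho> q) \<in> D - T)"
  by (simp add: Non_tree_def)

lemma path_bound: "path u v \<subseteq> {..<n} \<times> {..<n}"
  using path_subset T_bound by blast

lemma dvd_mod: "d dvd c mod d + b \<longleftrightarrow> d dvd c + b" "d dvd 2 * (c mod d) \<longleftrightarrow> d dvd 2 * c"
  by (simp_all add: dvd_eq_mod_eq_0 mod_simps)

lemma val_Unbalanced: "val (Unbalanced d) \<rho> = of_bool (\<not> balanced d)"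
proof -
  have one: "val (Apply (\<lambda>c. of_bool (\<not> d dvd Suc c)) (Count d 6 (Count d 7 (On_path 6 7 2 3)))) \<rho> =
      of_bool (\<not> d dvd Suc (card (path (\<rho> 2) (\<rho> 3))))" if "conn T (\<rho> 2) (\<rho> 3)" for \<rho>
  proof -
    have "val (Count d 6 (Count d 7 (On_path 6 7 2 3))) \<rho> = card (path (\<rho> 2) (\<rho> 3)) mod d"
      by (rule val_Count2[OF path_bound]) (use that in \<open>auto simp: val_On_path\<close>)
    then show ?thesis using dvd_mod(1)[of _ 1] by (simp add: val_Apply)
  qed
  have two: "val (Apply (\<lambda>c. of_bool (\<not> d dvd 2 * c)) (Count d 6 (Count d 7 (Conj (On_path 6 7 2 3) (On_path 6 7 4 5))))) \<rho> =
      of_bool (\<not> d dvd 2 * card (path (\<rho> 2) (\<rho> 3) \<inter> path (\<rho> 4) (\<rho> 5)))"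
    if "conn T (\<rho> 2) (\<rho> 3)" "conn T (\<rho> 4) (\<rho> 5)" for \<rho>
  proof -
    have "val (Count d 6 (Count d 7 (Conj (On_path 6 7 2 3) (On_path 6 7 4 5)))) \<rho> =
        card (path (\<rho> 2) (\<rho> 3) \<inter> path (\<rho> 4) (\<rho> 5)) mod d"
      by (rule val_Count2) (use that path_bound[of "\<rho> 2" "\<rho> 3"] in \<open>auto simp: val_On_path\<close>)
    then show ?thesis using dvd_mod(2) by (simp add: val_Apply)
  qed
  have DT: "conn T i j" if "(i, j) \<in> D - T" for i j using that span by blast
  have lt: "i < n" "j < n" if "(i, j) \<in> D" for i j using that D_bound by auto
  let ?two = "Conj (Conj (Non_tree 4 5) (Distinct 2 3 4 5)) (Apply (\<lambda>c. of_bool (\<not> d dvd 2 * c))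
      (Count d 6 (Count d 7 (Conj (On_path 6 7 2 3) (On_path 6 7 4 5)))))"
  let ?one = "Apply (\<lambda>c. of_bool (\<not> d dvd Suc c)) (Count d 6 (Count d 7 (On_path 6 7 2 3)))"
  let ?bad = "\<lambda>i j. (i, j) \<in> D - T \<and> (\<not> d dvd Suc (card (path i j)) \<or>
      (\<exists>k<n. \<exists>l<n. (k, l) \<in> D - T \<and> (i, j) \<noteq> (k, l) \<and> \<not> d dvd 2 * card (path i j \<inter> path k l)))"
  \<comment> \<open>Membership in \<open>D - T\<close> connects the ends in the forest, as
    \<open>val_On_path\<close> requires; for other \<open>k\<close>, \<open>l\<close> the first
    conjunct already fails.\<close>
  have B: "val ?two (\<rho>(2 := i, 3 := j, 4 := k, 5 := l)) \<noteq> 0 \<longleftrightarrow>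
      (k, l) \<in> D - T \<and> (i, j) \<noteq> (k, l) \<and> \<not> d dvd 2 * card (path i j \<inter> path k l)"
    if "(i, j) \<in> D - T" "k < n" "l < n" for i j k l
    using that two[of "\<rho>(2 := i, 3 := j, 4 := k, 5 := l)"] DT[of i j] DT[of k l]
    by (cases "(k, l) \<in> D - T") auto
  have A: "val (Conj (Non_tree 2 3) (Disj ?one (Exists 4 (Exists 5 ?two)))) (\<rho>(2 := i, 3 := j)) \<noteq> 0 \<longleftrightarrow> ?bad i j"
    if "i < n" "j < n" for i j
  proof (cases "(i, j) \<in> D - T")
    case True
    have "val (Exists 4 (Exists 5 ?two)) (\<rho>(2 := i, 3 := j)) \<noteq> 0 \<longleftrightarrow>
        (\<exists>k<n. \<exists>l<n. val ?two (\<rho>(2 := i, 3 := j, 4 := k, 5 := l)) \<noteq> 0)"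
      unfolding val_Exists_nonzero ..
    also have "\<dots> \<longleftrightarrow> (\<exists>k<n. \<exists>l<n. (k, l) \<in> D - T \<and> (i, j) \<noteq> (k, l) \<and> \<not> d dvd 2 * card (path i j \<inter> path k l))"
      by (simp only: B[OF True] cong: conj_cong)
    finally show ?thesis
      using True that one[of "\<rho>(2 := i, 3 := j)"] DT[OF True] unfolding val_Conj val_Disj by simp
  qed (use that in simp)
  have "val (Unbalanced d) \<rho> = of_bool (\<exists>i<n. \<exists>j<n. val (Conj (Non_tree 2 3) (Disj ?one (Exists 4 (Exists 5 ?two)))) (\<rho>(2 := i, 3 := j)) \<noteq> 0)"
    unfolding Unbalanced_def val_Exists[of 2] val_Exists_nonzero[of 3] ..
  also have "(\<exists>i<n. \<exists>j<n. val (Conj (Non_tree 2 3) (Disj ?one (Exists 4 (Exists 5 ?two)))) (\<rho>(2 := i, 3 := j)) \<noteq> 0) \<longleftrightarrow>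
      (\<exists>i<n. \<exists>j<n. ?bad i j)"
    by (simp only: A cong: conj_cong)
  also have "(\<exists>i<n. \<exists>j<n. ?bad i j) \<longleftrightarrow> \<not> balanced d"
  proof
    assume "\<exists>i<n. \<exists>j<n. ?bad i j"
    then obtain i j where ij: "?bad i j" by blast
    show "\<not> balanced d"
    proof
      assume bal: "balanced d"
      have mem: "(i, j) \<in> D - T" using ij by (rule conjunct1)
      note b = bal[unfolded balanced_def, rule_format, OF mem]
      have "d dvd Suc (card (path i j))" using b[THEN conjunct1] by simp
      with ij obtain k l where kl: "(k, l) \<in> D - T" "(i, j) \<noteq> (k, l)" "\<not> d dvd 2 * card (path i j \<inter> path k l)"
        by blast
      show False using b[THEN conjunct2, rule_format, OF kl(1,2)] kl(3) by simp
    qed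
  next
    assume "\<not> balanced d"
    then obtain e f where e: "e \<in> D - T" "\<not> d dvd Suc (card (tree_path e)) \<or>
        f \<in> D - T \<and> e \<noteq> f \<and> \<not> d dvd 2 * card (tree_path e \<inter> tree_path f)"
      unfolding balanced_def by blast
    obtain i j k l where ef: "e = (i, j)" "f = (k, l)" by (cases e, cases f)
    have "?bad i j"
    proof (cases "d dvd Suc (card (path i j))")
      case True
      then have "(k, l) \<in> D - T" "(i, j) \<noteq> (k, l)" "\<not> d dvd 2 * card (path i j \<inter> path k l)"
        using e unfolding ef by auto
      then show ?thesis using e(1) lt[of k l] unfolding ef by blast
    qed (use e ef in auto)
    moreover have "i < n" "j < n" using lt[of i j] e(1) ef by auto
    ultimately show "\<exists>i<n. \<exists>j<n. ?bad i j" by blast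
  qed
  finally show ?thesis .
qed

lemma val_Query:
  "val (Query d) \<rho> = of_bool ((\<forall>i<n. \<forall>j<n. E i j \<longrightarrow> E j i \<and> i \<noteq> j) \<and> \<not> balanced d)"
proof -
  have "i = j \<longleftrightarrow> \<not> i < j \<and> \<not> j < i" for i j :: nat by auto
  then have "val Asymmetric \<rho> = of_bool (\<exists>i<n. \<exists>j<n. E i j \<and> (\<not> E j i \<or> i = j))"
    unfolding Asymmetric_def by simp blast
  then show ?thesis
    unfolding Query_def val_Conj val_Neg val_Unbalanced by (intro arg_cong[of _ _ of_bool]) auto
qed

end

section \<open>From the query to the decision problem\<close>

lemma UC_iff:
  assumes d: "0 < d" and S: "\<And>l. l mod m \<in> S \<longleftrightarrow> \<not> d dvd l"
  shows "x \<in> UC S m \<longleftrightarrow> (\<exists>n>0. length x = n * n \<and>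
    value_of (d + 2) n (\<lambda>i j. x ! (i * n + j)) (Query d) (\<lambda>_. 0) = 1)"
proof -
  have "(\<exists>E. x = adjacency_matrix n E \<and> undirected_graph {0..<n} E \<and> has_cycle_mod S m E) \<longleftrightarrow>
    n > 0 \<and> length x = n * n \<and> value_of (d + 2) n (\<lambda>i j. x ! (i * n + j)) (Query d) (\<lambda>_. 0) = 1" for n
  proof -
    \<comment> \<open>\<open>d + 2\<close> values make room for the residues modulo \<open>d\<close>
      and for both truth values, even if \<open>d = 1\<close>.\<close>
    interpret query "d + 2" d n "\<lambda>i j. x ! (i * n + j)"
      by unfold_locales (use d in auto)
    let ?sym = "\<forall>i<n. \<forall>j<n. x ! (i * n + j) \<longrightarrow> x ! (j * n + i) \<and> i \<noteq> j"
    let ?E = "{(i, j). i < n \<and> j < n \<and> x ! (i * n + j)}"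
    have graph: "undirected_graph {0..<n} ?E \<longleftrightarrow> ?sym"
      unfolding undirected_graph_def sym_def irrefl_def
      using finite_subset[of ?E "{0..<n} \<times> {0..<n}"] by auto
    have "(\<exists>E. x = adjacency_matrix n E \<and> undirected_graph {0..<n} E \<and> has_cycle_mod S m E) \<longleftrightarrow>
        length x = n * n \<and> ?sym \<and> has_cycle_mod S m ?E"
    proof
      assume "\<exists>E. x = adjacency_matrix n E \<and> undirected_graph {0..<n} E \<and> has_cycle_mod S m E"
      then obtain E where E: "x = adjacency_matrix n E" "undirected_graph {0..<n} E" "has_cycle_mod S m E" by blast
      \<comment> \<open>The edges lie within \<open>{0..<n}\<close>, so the matrix determines
        them.\<close>
      then have "E = ?E" unfolding adjacency_matrix_eq_iff undirected_graph_def by auto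
      with E have "undirected_graph {0..<n} ?E" "has_cycle_mod S m ?E" by simp_all
      then show "length x = n * n \<and> ?sym \<and> has_cycle_mod S m ?E"
        using E(1) graph by (simp add: length_adjacency_matrix)
    next
      assume r: "length x = n * n \<and> ?sym \<and> has_cycle_mod S m ?E"
      then have "x = adjacency_matrix n ?E" by (simp add: adjacency_matrix_eq_iff)
      moreover have "undirected_graph {0..<n} ?E" using r by (subst graph) (rule conjunct1[OF conjunct2])
      ultimately show "\<exists>E. x = adjacency_matrix n E \<and> undirected_graph {0..<n} E \<and> has_cycle_mod S m E"
        using r by (intro exI[of _ ?E] conjI) simp_all
    qed
    also have "\<dots> \<longleftrightarrow> length x = n * n \<and> ?sym \<and> \<not> balanced d"
    proof -
      have "has_cycle_mod S m ?E \<longleftrightarrow> \<not> balanced d" if ?sym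
      proof -
        have A: "x ! (j * n + i) \<and> i \<noteq> j" if "x ! (i * n + j)" "i < n" "j < n" for i j
          using that \<open>?sym\<close> by blast
        have "(i, j) \<in> ?E \<longleftrightarrow> (i, j) \<in> D \<union> D\<inverse>" for i j
          by (cases i j rule: linorder_cases) (use A[of i j] A[of j i] in \<open>auto simp: D_def\<close>)
        then have "?E = D \<union> D\<inverse>" by auto
        then show ?thesis unfolding has_cycle_mod_def balanced_iff S by auto
      qed
      then show ?thesis by blast
    qed
    also have "\<dots> \<longleftrightarrow> n > 0 \<and> length x = n * n \<and> ?sym \<and> \<not> balanced d"
    proof -
      \<comment> \<open>The empty graph is balanced, hence no instance, so the restriction to
        positive \<open>n\<close> agrees with a machine that rejects the empty input.\<close>
      have "balanced d" if "n = 0" unfolding balanced_def using that D_bound by auto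
      then show ?thesis using neq0_conv[of n] by blast
    qed
    finally show ?thesis using val_Query[of "\<lambda>_. 0"] by simp
  qed
  then show ?thesis unfolding UC_def by auto
qed

theorem theorem11:
  fixes m :: nat and S :: "nat set"
  assumes "m > 2"
    and "S \<subseteq> {1..m - 1}"
    and "\<And>p d1 d2. p \<in> S \<Longrightarrow> d1 < m \<Longrightarrow> d2 < m \<Longrightarrow> [d1 + d2 = p] (mod m) \<Longrightarrow> d1 \<in> S \<or> d2 \<in> S"
  shows "solvable_in_polynomial_time (UC S m)"
proof -
  obtain d where d: "0 < d" "\<And>l. l mod m \<in> S \<longleftrightarrow> \<not> d dvd l"
    by (rule closed_complement_multiples[of m S]) (use assms in auto)
  show ?thesis
    by (rule expr_solvable[OF wf_Query _ _ UC_iff[OF d]]) auto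
qed

end
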